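(* Assume that conditions $\mathcal{C}_2(\boldsymbol{\gamma},\boldsymbol{\rho},\boldsymbol{A})$ and $\mathcal{J}(\boldsymbol{R})$ (stated in the context) hold with $\boldsymbol{\gamma}=\gamma\boldsymbol{1}$, $\rho_j<0$ and $A_j(t)=\gamma\beta_jt^{\rho_j}$ for all $j$. Suppose that $n_1\leq\cdots\leq n_m$ and that, for any $j\in\{1,\ldots,m\}$, as $n\to\infty$: $k_j=k_j(n)\to\infty$, $k_j/n_j\to0$, $n_1/n_j\to b_j\in(0,1]$, $k_1/k_j\to c_j\in(0,\infty)$ and $\sqrt{k_j}A_j(n_j/k_j)\to\lambda_j\in\mathbb{R}$. Assume that the matrix $\mathbf{V}_{\boldsymbol{c}}$ defined in the context is positive definite. Assume further that, for all $j$, $\widehat{\beta}_j$ is a consistent estimator of $\beta_j$ and $(\widehat{\rho}_j-\rho_j)\log n_j=\operatorname{o}_{\mathbb{P}}(1)$. Then, with $k=\sum_{j=1}^mk_j$, $$\sqrt{k}(\widehat{\gamma}_n(\widehat{\boldsymbol{\omega}}_n^{(\mathrm{Var})})-\gamma)\stackrel{d}{\longrightarrow}\mathcal{N}\left(\frac{\boldsymbol{1}^\top\mathbf{V}_{\boldsymbol{c}}^{-1}\boldsymbol{B}_{\boldsymbol{c}}}{\boldsymbol{1}^\top\mathbf{V}_{\boldsymbol{c}}^{-1}\boldsymbol{1}},\frac{1}{\boldsymbol{1}^\top\mathbf{V}_{\boldsymbol{c}}^{-1}\boldsymbol{1}}\right)$$ and $$\sqrt{k}(\widehat{\gamma}_n(\widehat{\boldsymbol{\omega}}_n^{(\mathrm{AMSE})})-\gamma)\stackrel{d}{\longrightarrow}\mathcal{N}\left((\boldsymbol{\omega}^{(\mathrm{AMSE})})^\top\boldsymbol{B}_{\boldsymbol{c}},(\boldsymbol{\omega}^{(\mathrm{AMSE})})^\top\mathbf{V}_{\boldsymbol{c}}\boldsymbol{\omega}^{(\mathrm{AMSE})}\right),$$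 where $$((\boldsymbol{\omega}^{(\mathrm{AMSE})})^\top\boldsymbol{B}_{\boldsymbol{c}})^2+(\boldsymbol{\omega}^{(\mathrm{AMSE})})^\top\mathbf{V}_{\boldsymbol{c}}\boldsymbol{\omega}^{(\mathrm{AMSE})}=\frac{1+\boldsymbol{B}_{\boldsymbol{c}}^\top\mathbf{V}_{\boldsymbol{c}}^{-1}\boldsymbol{B}_{\boldsymbol{c}}}{(1+\boldsymbol{B}_{\boldsymbol{c}}^\top\mathbf{V}_{\boldsymbol{c}}^{-1}\boldsymbol{B}_{\boldsymbol{c}})(\boldsymbol{1}^\top\mathbf{V}_{\boldsymbol{c}}^{-1}\boldsymbol{1})-(\boldsymbol{1}^\top\mathbf{V}_{\boldsymbol{c}}^{-1}\boldsymbol{B}_{\boldsymbol{c}})^2}.$$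
   Context: Setting: $m$ is a fixed integer, $\boldsymbol{X}=(X_1,\ldots,X_m)^\top$ is a random vector and $\boldsymbol{X}_i=(X_{i,1},\ldots,X_{i,m})^\top$, $i\geq1$, are independent copies of $\boldsymbol{X}$. The data are the $X_{i,j}$ for $1\leq j\leq m$, $1\leq i\leq n_j=n_j(n)$, with $n=\sum_{j=1}^m n_j$ and $n_j\to\infty$ as $n\to\infty$. Each $X_j$ has a continuous distribution function $F_j$, $\overline{F}_j=1-F_j$, and tail quantile function $U_j(t)=\inf\{x\in\mathbb{R}:1/\overline{F}_j(x)\geq t\}$. Condition $\mathcal{C}_2(\boldsymbol{\gamma},\boldsymbol{\rho},\boldsymbol{A})$: for every $j$, $\gamma_j>0$, $\rho_j\leq0$, $A_j$ has constant sign and converges to $0$ at infinity, and for all $x>0$, $\lim_{t\to\infty}\frac{1}{A_j(t)}\left[\frac{U_j(tx)}{U_j(t)}-x^{\gamma_j}\right]=x^{\gamma_j}\frac{x^{\rho_j}-1}{\rho_j}$ (read as $x^{\gamma_j}\log x$ if $\rho_j=0$). Condition $\mathcal{J}(\boldsymbol{R})$: with $\overline{C}_{j,\ell}(u,v)=\mathbb{P}(\overline{F}_j(X_j)\leq u,\overline{F}_\ell(X_\ell)\leq v)$, for any $j\neq\ell$ there is a function $R_{j,\ell}$ on $[0,\infty]^2\setminus\{(\infty,\infty)\}$ such that $\lim_{s\to\infty}s\,\overline{C}_{j,\ell}(x_j/s,x_\ell/s)=R_{j,\ell}(x_j,x_\ell)$ for all $(x_j,x_\ell)$ in this set. Hill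 estimators: with $X_{1:n_j,j}\leq\cdots\leq X_{n_j:n_j,j}$ the order statistics of the $j$th sample, $\widehat{\gamma}_j(k_j)=k_j^{-1}\sum_{i=1}^{k_j}\log(X_{n_j-i+1:n_j,j}/X_{n_j-k_j:n_j,j})$, and $\widehat{\gamma}_n(\boldsymbol{\omega})=\sum_{j=1}^m\omega_j\widehat{\gamma}_j(k_j)$ for $\boldsymbol{\omega}\in\mathbb{R}^m$. $\boldsymbol{1}$ is the vector of ones in $\mathbb{R}^m$. Asymptotic bias and variance: $\boldsymbol{B}_{\boldsymbol{c}}=\sqrt{\sum_{i=1}^mc_i^{-1}}\left(\sqrt{c_1}\frac{\lambda_1}{1-\rho_1},\ldots,\sqrt{c_m}\frac{\lambda_m}{1-\rho_m}\right)^\top$, and $\mathbf{V}_{\boldsymbol{c}}$ is the symmetric matrix with $[\mathbf{V}_{\boldsymbol{c}}]_{j,j}=(\sum_{i=1}^mc_i^{-1})\gamma^2c_j$ and $[\mathbf{V}_{\boldsymbol{c}}]_{j,\ell}=(\sum_{i=1}^mc_i^{-1})\gamma^2c_jR_{j,\ell}(c_\ell/c_j,b_\ell/b_j)$ for $j<\ell$. AMSE weights: for a vector $\boldsymbol{B}$ and positive definite matrix $\mathbf{V}$ put $w(\boldsymbol{B},\mathbf{V})=\frac{(1+\boldsymbol{B}^\top\mathbf{V}^{-1}\boldsymbol{B})\mathbf{V}^{-1}\boldsymbol{1}-(\boldsymbol{1}^\top\mathbf{V}^{-1}\boldsymbol{B})\mathbf{V}^{-1}\boldsymbol{B}}{(1+\boldsymbol{B}^\top\mathbf{V}^{-1}\boldsymbol{B})(\boldsymbol{1}^\top\mathbf{V}^{-1}\boldsymbol{1})-(\boldsymbol{1}^\top\mathbf{V}^{-1}\boldsymbol{B})^2}$;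 then $\boldsymbol{\omega}^{(\mathrm{AMSE})}=w(\boldsymbol{B}_{\boldsymbol{c}},\mathbf{V}_{\boldsymbol{c}})$. Estimated quantities: let $\boldsymbol{\omega}_0\in\mathbb{R}^m$ be an arbitrary fixed (pilot) vector with $\boldsymbol{\omega}_0^\top\boldsymbol{1}=1$, and $\widehat{\lambda}_j=\sqrt{k_j}\,\widehat{\gamma}_n(\boldsymbol{\omega}_0)\widehat{\beta}_j(n_j/k_j)^{\widehat{\rho}_j}$. Let $n_{j,\ell}=\min(n_j,n_\ell)$, $k_{j,\ell}=k_j$ if $n_j<n_\ell$ and $k_{j,\ell}=k_\ell$ otherwise, and $$\widehat{R}_{j,\ell}(u,v)=\frac{1}{k_{j,\ell}}\sum_{i=1}^{n_{j,\ell}}\mathbb{1}\left\{\frac{n_{j,\ell}+1-r_{n_{j,\ell},i,j}}{k_{j,\ell}(n_{j,\ell}+1)/n_{j,\ell}}\leq u,\ \frac{n_{j,\ell}+1-r_{n_{j,\ell},i,\ell}}{k_{j,\ell}(n_{j,\ell}+1)/n_{j,\ell}}\leq v\right\},$$ where $r_{n_{j,\ell},i,j}$ (resp. $r_{n_{j,\ell},i,\ell}$) is the rank of $X_{i,j}$ among $X_{1,j},\ldots,X_{n_{j,\ell},j}$ (resp. of $X_{i,\ell}$ among $X_{1,\ell},\ldots,X_{n_{j,\ell},\ell}$). Set $$\widehat{\boldsymbol{B}}_{\boldsymbol{c}}=\sqrt{k}\left(\frac{\widehat{\lambda}_1/\sqrt{k_1}}{1-\widehat{\rho}_1},\ldots,\frac{\widehat{\lambda}_m/\sqrt{k_m}}{1-\widehat{\rho}_m}\right)^\top,$$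 and let $\widehat{\mathbf{V}}_{\boldsymbol{c}}$ be the symmetric matrix with $[\widehat{\mathbf{V}}_{\boldsymbol{c}}]_{j,j}=k\,\widehat{\gamma}_n^2(\boldsymbol{\omega}_0)/k_j$ and $[\widehat{\mathbf{V}}_{\boldsymbol{c}}]_{j,\ell}=k\,\widehat{\gamma}_n^2(\boldsymbol{\omega}_0)\,k_j^{-1}\widehat{R}_{j,\ell}(k_j/k_\ell,n_j/n_\ell)$ for $j<\ell$. Then $\widehat{\boldsymbol{\omega}}_n^{(\mathrm{Var})}=\widehat{\mathbf{V}}_{\boldsymbol{c}}^{-1}\boldsymbol{1}/(\boldsymbol{1}^\top\widehat{\mathbf{V}}_{\boldsymbol{c}}^{-1}\boldsymbol{1})$ and $\widehat{\boldsymbol{\omega}}_n^{(\mathrm{AMSE})}=w(\widehat{\boldsymbol{B}}_{\boldsymbol{c}},\widehat{\mathbf{V}}_{\boldsymbol{c}})$ (defined with probability tending to 1). *)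

theory Defs
  imports "HOL-Probability.Probability"
begin

section \<open>General notions\<close>

definition tendsto_in_prob ::
  "'a measure \<Rightarrow> (nat \<Rightarrow> 'a \<Rightarrow> real) \<Rightarrow> real \<Rightarrow> bool" where
  "tendsto_in_prob M Y c \<longleftrightarrow>
     (\<forall>\<epsilon>>0. (\<lambda>n. measure M {\<omega> \<in> space M. \<bar>Y n \<omega> - c\<bar> > \<epsilon>}) \<longlonglongrightarrow> 0)"

definition tendsto_in_distr ::
  "'a measure \<Rightarrow> (nat \<Rightarrow> 'a \<Rightarrow> real) \<Rightarrow> real measure \<Rightarrow> bool" where
  "tendsto_in_distr M Y \<mu> \<longleftrightarrow> weak_conv_m (\<lambda>n. distr M borel (Y n)) \<mu>"

(* The second parameter is the variance, whereas normal_density takes the standard deviation.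
   Meaningful for positive variance only. *)
definition normal_law :: "real \<Rightarrow> real \<Rightarrow> real measure" where
  "normal_law \<mu> v = density lborel (normal_density \<mu> (sqrt v))"

definition pos_def_matrix :: "real^'m^'m \<Rightarrow> bool" where
  "pos_def_matrix V \<longleftrightarrow> transpose V = V \<and> (\<forall>x. x \<noteq> 0 \<longrightarrow> x \<bullet> (V *v x) > 0)"


section \<open>Marginal and joint tails of a random vector\<close>

definition marg_cdf :: "'a measure \<Rightarrow> ('a \<Rightarrow> real^'m) \<Rightarrow> 'm \<Rightarrow> real \<Rightarrow> real" where
  "marg_cdf M X j = cdf (distr M borel (\<lambda>\<omega>. X \<omega> $ j))"

definition marg_surv :: "'a measure \<Rightarrow> ('a \<Rightarrow> real^'m) \<Rightarrow> 'm \<Rightarrow> real \<Rightarrow> real" where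
  "marg_surv M X j x = 1 - marg_cdf M X j x"

(* The quotient is taken in the extended reals, where 1 / 0 = \<infinity>. *)
definition tail_quantile :: "'a measure \<Rightarrow> ('a \<Rightarrow> real^'m) \<Rightarrow> 'm \<Rightarrow> real \<Rightarrow> real" where
  "tail_quantile M X j t = Inf {x. 1 / ereal (marg_surv M X j x) \<ge> ereal t}"

definition second_order_cond ::
  "'a measure \<Rightarrow> ('a \<Rightarrow> real^'m) \<Rightarrow> real^'m \<Rightarrow> real^'m \<Rightarrow> ('m \<Rightarrow> real \<Rightarrow> real) \<Rightarrow> bool" where
  "second_order_cond M X \<gamma> \<rho> A \<longleftrightarrow>
     (\<forall>j. \<gamma> $ j > 0 \<and> \<rho> $ j \<le> 0 \<and>
        ((\<forall>t>0. A j t > 0) \<or> (\<forall>t>0. A j t < 0)) \<and>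
        (A j \<longlongrightarrow> 0) at_top \<and>
        (\<forall>x>0. ((\<lambda>t. 1 / A j t *
                    (tail_quantile M X j (t * x) / tail_quantile M X j t - x powr (\<gamma> $ j)))
           \<longlongrightarrow> x powr (\<gamma> $ j) *
                 (if \<rho> $ j = 0 then ln x else (x powr (\<rho> $ j) - 1) / \<rho> $ j)) at_top))"

definition surv_copula ::
  "'a measure \<Rightarrow> ('a \<Rightarrow> real^'m) \<Rightarrow> 'm \<Rightarrow> 'm \<Rightarrow> ereal \<Rightarrow> ereal \<Rightarrow> real" where
  "surv_copula M X j l u v =
     measure M {\<omega> \<in> space M. ereal (marg_surv M X j (X \<omega> $ j)) \<le> u \<and>
                             ereal (marg_surv M X l (X \<omega> $ l)) \<le> v}"

(* R j l matters only on [0,\<infinity>]^2 without (\<infinity>,\<infinity>). *)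
definition tail_dependence_cond ::
  "'a measure \<Rightarrow> ('a \<Rightarrow> real^'m) \<Rightarrow> ('m \<Rightarrow> 'm \<Rightarrow> ereal \<Rightarrow> ereal \<Rightarrow> real) \<Rightarrow> bool" where
  "tail_dependence_cond M X R \<longleftrightarrow>
     (\<forall>j l. j \<noteq> l \<longrightarrow>
        (\<forall>x y. 0 \<le> x \<and> 0 \<le> y \<and> (x, y) \<noteq> (\<infinity>, \<infinity>) \<longrightarrow>
           ((\<lambda>s::real. s * surv_copula M X j l (x / ereal s) (y / ereal s))
              \<longlongrightarrow> R j l x y) at_top))"


section \<open>Asymptotic bias, asymptotic variance and weights\<close>

definition B_asym :: "real^'m \<Rightarrow> real^'m \<Rightarrow> real^'m \<Rightarrow> real^'m" where
  "B_asym c lam \<rho> =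
     (\<chi> j. sqrt (\<Sum>i\<in>UNIV. 1 / c $ i) * (sqrt (c $ j) * (lam $ j / (1 - \<rho> $ j))))"

definition V_asym ::
  "real \<Rightarrow> ('m \<Rightarrow> 'm \<Rightarrow> ereal \<Rightarrow> ereal \<Rightarrow> real) \<Rightarrow>
   real^('m::{finite,linorder}) \<Rightarrow> real^('m::{finite,linorder}) \<Rightarrow>
   real^('m::{finite,linorder})^('m::{finite,linorder})" where
  "V_asym \<gamma> R c b =
     (let upper = (\<lambda>j l. (\<Sum>i\<in>UNIV. 1 / c $ i) * \<gamma>\<^sup>2 * c $ j *
                     R j l (ereal (c $ l / c $ j)) (ereal (b $ l / b $ j)))
      in \<chi> j l. if j = l then (\<Sum>i\<in>UNIV. 1 / c $ i) * \<gamma>\<^sup>2 * c $ j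
                else if j < l then upper j l else upper l j)"

(* In these two weights matrix_inv is a fixed unspecified matrix if V is singular, and division
   by 0 gives 0. This makes the estimated weights total functions of the data. *)
definition var_weights :: "real^'m^'m \<Rightarrow> real^'m" where
  "var_weights V = (1 / (1 \<bullet> (matrix_inv V *v 1))) *\<^sub>R (matrix_inv V *v 1)"

definition amse_weights :: "real^'m \<Rightarrow> real^'m^'m \<Rightarrow> real^'m" where
  "amse_weights B V =
     (1 / ((1 + B \<bullet> (matrix_inv V *v B)) * (1 \<bullet> (matrix_inv V *v 1))
            - (1 \<bullet> (matrix_inv V *v B))\<^sup>2)) *\<^sub>R
     ((1 + B \<bullet> (matrix_inv V *v B)) *\<^sub>R (matrix_inv V *v 1)
       - (1 \<bullet> (matrix_inv V *v B)) *\<^sub>R (matrix_inv V *v B))"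


section \<open>Estimators\<close>

(* Data points are indexed from 1, so a sample y of size n consists of y 1, ..., y n.
   In the multivariate case x i $ j is the i-th observation of the j-th sample,
   N j is the size of that sample and K j is its effective size. *)

definition order_stat :: "nat \<Rightarrow> nat \<Rightarrow> (nat \<Rightarrow> real) \<Rightarrow> real" where
  "order_stat i n y = sort (map y [1..<Suc n]) ! (i - 1)"

definition hill :: "nat \<Rightarrow> nat \<Rightarrow> (nat \<Rightarrow> real) \<Rightarrow> real" where
  "hill n k y =
     1 / real k * (\<Sum>i = 1..k. ln (order_stat (n - i + 1) n y / order_stat (n - k) n y))"

definition pooled_hill ::
  "(nat \<Rightarrow> real^'m) \<Rightarrow> ('m \<Rightarrow> nat) \<Rightarrow> ('m \<Rightarrow> nat) \<Rightarrow> real^'m \<Rightarrow> real" where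
  "pooled_hill x N K w = (\<Sum>j\<in>UNIV. w $ j * hill (N j) (K j) (\<lambda>i. x i $ j))"

definition sample_rank :: "nat \<Rightarrow> nat \<Rightarrow> (nat \<Rightarrow> real) \<Rightarrow> nat" where
  "sample_rank n i y = card {l \<in> {1..n}. y l \<le> y i}"

definition R_hat ::
  "(nat \<Rightarrow> real^'m) \<Rightarrow> ('m \<Rightarrow> nat) \<Rightarrow> ('m \<Rightarrow> nat) \<Rightarrow> 'm \<Rightarrow> 'm \<Rightarrow> real \<Rightarrow> real \<Rightarrow> real" where
  "R_hat x N K j l u v =
     (let n = min (N j) (N l);
          k = (if N j < N l then K j else K l);
          q = (\<lambda>i h. (real n + 1 - real (sample_rank n i (\<lambda>i'. x i' $ h)))
                       / (real k * (real n + 1) / real n))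
      in 1 / real k * (\<Sum>i = 1..n. of_bool (q i j \<le> u \<and> q i l \<le> v)))"

(* Arguments: data x, N, K, pilot weights w0, and the values of the estimators
   of \<beta> and \<rho>. *)
definition lambda_hat ::
  "(nat \<Rightarrow> real^'m) \<Rightarrow> ('m \<Rightarrow> nat) \<Rightarrow> ('m \<Rightarrow> nat) \<Rightarrow> real^'m \<Rightarrow> real^'m \<Rightarrow> real^'m \<Rightarrow> real^'m" where
  "lambda_hat x N K w0 \<beta> \<rho> =
     (\<chi> j. sqrt (real (K j)) * pooled_hill x N K w0 * \<beta> $ j
            * (real (N j) / real (K j)) powr (\<rho> $ j))"

definition B_hat ::
  "(nat \<Rightarrow> real^'m) \<Rightarrow> ('m \<Rightarrow> nat) \<Rightarrow> ('m \<Rightarrow> nat) \<Rightarrow> real^'m \<Rightarrow> real^'m \<Rightarrow> real^'m \<Rightarrow> real^'m" where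
  "B_hat x N K w0 \<beta> \<rho> =
     (\<chi> j. sqrt (real (\<Sum>i\<in>UNIV. K i)) *
            ((lambda_hat x N K w0 \<beta> \<rho> $ j / sqrt (real (K j))) / (1 - \<rho> $ j)))"

definition V_hat ::
  "(nat \<Rightarrow> real^('m::{finite,linorder})) \<Rightarrow> ('m \<Rightarrow> nat) \<Rightarrow> ('m \<Rightarrow> nat) \<Rightarrow>
   real^('m::{finite,linorder}) \<Rightarrow> real^('m::{finite,linorder})^('m::{finite,linorder})" where
  "V_hat x N K w0 =
     (let k = real (\<Sum>i\<in>UNIV. K i);
          g = pooled_hill x N K w0;
          upper = (\<lambda>j l. k * g\<^sup>2 * (1 / real (K j)) *
                     R_hat x N K j l (real (K j) / real (K l)) (real (N j) / real (N l)))
      in \<chi> j l. if j = l then k * g\<^sup>2 / real (K j)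
                else if j < l then upper j l else upper l j)"

end

(* Marginally, E = - ln (1 - F_j (X_j)) is standard exponential and X_j = U_j (exp E) almost surely.
   Summing the second order condition along dyadic scales gives
   ln (U_j (exp x)) = L + gamma x + exp (rho_j x) (gamma beta_j / rho_j + o(1)), so each Hill estimator is
   gamma times the Hill estimator of an exponential sample plus an explicit bias term. Comparing the k
   largest observations with those above the deterministic level tau = ln (n_j / k_j), together with
   Ghosh's argument for the random level, shows that sqrt k_j (gamma_j - gamma) is asymptotically
   gamma / sqrt k_j times the sum of (E_i - tau - 1) 1{E_i > tau}, plus lambda_j / (1 - rho_j). Linear
   combinations of these sums obey Lyapunov's theorem; homogeneity of the tail dependence function R
   reduces their limiting covariances to R itself. Random weights summing to one and converging in
   probability do not change the limit law, and the estimated weights are continuous functions of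
   consistent estimators of the bias and of the covariance matrix. *)
theory Submission
  imports Defs
begin

section \<open>Convergence in probability\<close>

text \<open>Everything is reduced to sums of independent terms above deterministic levels, whose
  moments are explicit because the exponential law is memoryless. Two obstacles shape the argument.
  The samples have different lengths, so the central limit theorem is applied to whole vectors:
  observation i contributes only the coordinates j with i \<le> \<open>N n j\<close>, and for j < l
  exactly \<open>N n j\<close> observations are shared. And the tail condition gives joint tail
  limits only at fixed arguments; uniform margins make the copula Lipschitz, which supplies the
  uniformity needed at moving arguments. With s = n_j / k_l the tail levels k_j / n_j and k_l / n_l
  are (k_j / k_l) / s and (n_j / n_l) / s, which is the origin of the arguments c_l / c_j and b_l /
  b_j of R. The covariance collapses because the limiting joint tail r(s, t) beyond shifted levels
  satisfies r(s + h, t + h) = exp (-h) r(s, t): its double integral is the integral of r(u, 0) plus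
  that of r(0, u), and these are exactly the terms removed by the centring, so that r(0, 0)
  remains.\<close>

context prob_space
begin

text \<open>Convergence in probability is convergence along the following filter on pairs \<open>(n, \<omega>)\<close>, so
  that the library's limit calculus applies to it without measurability assumptions.\<close>
definition in_prob :: "(nat \<times> 'a) filter" where
  "in_prob = Abs_filter (\<lambda>Q. \<forall>\<eta>>0. \<forall>\<^sub>F n in sequentially.
     \<exists>A\<in>events. prob A \<le> \<eta> \<and> (\<forall>\<omega>\<in>space M - A. Q (n, \<omega>)))"

lemma eventually_in_prob:
  "eventually Q in_prob \<longleftrightarrow> (\<forall>\<eta>>0. \<forall>\<^sub>F n in sequentially.
     \<exists>A\<in>events. prob A \<le> \<eta> \<and> (\<forall>\<omega>\<in>space M - A. Q (n, \<omega>)))"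
  unfolding in_prob_def
proof (rule eventually_Abs_filter, rule is_filter.intro, goal_cases)
  case 1
  show ?case by (auto intro!: bexI[of _ "{}"])
next
  case (2 P Q)
  show ?case
  proof (intro allI impI)
    fix \<eta> :: real assume "\<eta> > 0"
    then have e: "\<eta> / 2 > 0" by simp
    from 2(1)[rule_format, OF e] 2(2)[rule_format, OF e]
    show "\<forall>\<^sub>F n in sequentially. \<exists>A\<in>events. prob A
        \<le> \<eta> \<and> (\<forall>\<omega>\<in>space M - A. P (n, \<omega>) \<and> Q (n, \<omega>))"
    proof eventually_elim
      case (elim n)
      then obtain A B where "A \<in> events" "prob A
          \<le> \<eta> / 2" "\<forall>\<omega>\<in>space M - A. P (n, \<omega>)"
        "B \<in> events" "prob B \<le> \<eta> / 2" "\<forall>\<omega>\<in>space M - B. Q (n, \<omega>)"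
            by blast
      moreover from this have "prob (A \<union> B) \<le> \<eta>"
        using measure_Un_le[of A M B] by simp
      ultimately show ?case by (intro bexI[of _ "A \<union> B"]) auto
    qed
  qed
next
  case (3 P Q)
  show ?case
  proof (intro allI impI)
    fix \<eta> :: real assume "\<eta> > 0"
    from 3(2)[rule_format, OF this]
    show "\<forall>\<^sub>F n in sequentially. \<exists>A\<in>events. prob A
        \<le> \<eta> \<and> (\<forall>\<omega>\<in>space M - A. Q (n, \<omega>))"
      by (rule eventually_mono) (use 3(1) in blast)
  qed
qed

lemma eventually_in_probD:
  assumes "eventually Q in_prob" "\<eta> > 0"
  shows "\<forall>\<^sub>F n in sequentially.
     \<exists>A\<in>events. prob A \<le> \<eta> \<and> (\<forall>\<omega>\<in>space M - A. Q (n, \<omega>))"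
  using assms unfolding eventually_in_prob by blast

lemma eventually_in_prob_sequentially:
  assumes "eventually P sequentially"
  shows "eventually (\<lambda>z. P (fst z)) in_prob"
  unfolding eventually_in_prob
proof (intro allI impI)
  fix \<eta> :: real assume "\<eta> > 0"
  then show "\<forall>\<^sub>F n in sequentially. \<exists>A\<in>events. prob A
      \<le> \<eta> \<and> (\<forall>\<omega>\<in>space M - A. P (fst (n, \<omega>)))"
    by (intro eventually_mono[OF assms] bexI[of _ "{}"]) auto
qed

text \<open>The bridge from deterministic limits: composing with it turns a limit in n into a limit
  along \<open>in_prob\<close>, so that both kinds can be mixed in one limit calculation.\<close>

lemma filterlim_fst_in_prob: "filterlim fst sequentially in_prob"
  unfolding filterlim_iff by (intro allI impI eventually_in_prob_sequentially)

lemma tendsto_in_prob_const: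
  "(x \<longlongrightarrow> c) sequentially \<Longrightarrow> ((\<lambda>z. x (fst z))
      \<longlongrightarrow> c) in_prob"
  by (rule filterlim_compose[OF _ filterlim_fst_in_prob])

lemma eventually_in_prob_AE:
  assumes "\<And>n. AE \<omega> in M. Q n \<omega>"
  shows "eventually (\<lambda>z. Q (fst z) (snd z)) in_prob"
  unfolding eventually_in_prob
proof (intro allI impI always_eventually)
  fix \<eta> :: real and n assume "\<eta> > 0"
  obtain N where "{\<omega>\<in>space M. \<not> Q n \<omega>} \<subseteq> N" "emeasure M N
      = 0" "N \<in> events"
    by (rule AE_E[OF assms[of n]])
  then show "\<exists>A\<in>events. prob A \<le> \<eta> \<and> (\<forall>\<omega>\<in>space M
      - A. Q (fst (n, \<omega>)) (snd (n, \<omega>)))"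
    using \<open>\<eta> > 0\<close> by (intro bexI[of _ N]) (auto simp: measure_def)
qed

lemma eventually_in_prob_prob:
  assumes "\<And>n. {\<omega>\<in>space M. \<not> Q n \<omega>} \<in> events"
    and "(\<lambda>n. prob {\<omega>\<in>space M. \<not> Q n \<omega>}) \<longlonglongrightarrow> 0"
  shows "eventually (\<lambda>z. Q (fst z) (snd z)) in_prob"
  unfolding eventually_in_prob
proof (intro allI impI)
  fix \<eta> :: real assume "\<eta> > 0"
  from order_tendstoD(2)[OF assms(2) this]
  show "\<forall>\<^sub>F n in sequentially. \<exists>A\<in>events. prob A \<le> \<eta> \<and>
      (\<forall>\<omega>\<in>space M - A. Q (fst (n, \<omega>)) (snd (n, \<omega>)))"
  proof eventually_elim
    case (elim n)
    then show ?case using assms(1)[of n]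
      by (intro bexI[of _ "{\<omega>\<in>space M. \<not> Q n \<omega>}"]) auto
  qed
qed

lemma tendsto_in_prob_imp_tendsto:
  assumes [measurable]: "\<And>n. Y n \<in> borel_measurable M" and "tendsto_in_prob M Y c"
  shows "((\<lambda>z. Y (fst z) (snd z)) \<longlongrightarrow> c) in_prob"
proof (rule tendstoI)
  fix e :: real assume "e > 0"
  have "eventually (\<lambda>z. \<bar>Y (fst z) (snd z) - c\<bar> \<le> e / 2) in_prob"
    using assms(2)[unfolded tendsto_in_prob_def, rule_format, of "e/2"] \<open>e > 0\<close>
    by (intro eventually_in_prob_prob) (simp_all add: not_le)
  then show "\<forall>\<^sub>F z in in_prob. dist (Y (fst z) (snd z)) c < e"
    by eventually_elim (use \<open>e > 0\<close> in \<open>auto simp: dist_real_def\<close>)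
qed

text \<open>Markov's inequality for the square, that is, Chebyshev about 0. The event is a negated
  bound to match the form of \<open>eventually_in_prob_prob\<close>.\<close>

lemma second_moment_tail_bound:
  assumes [measurable]: "Z \<in> borel_measurable M"
      and "integrable M (\<lambda>\<omega>. (Z \<omega>)\<^sup>2)" "C > 0"
  shows "prob {\<omega>\<in>space M. \<not> \<bar>Z \<omega>\<bar> \<le> C}
      \<le> expectation (\<lambda>\<omega>. (Z \<omega>)\<^sup>2) / C\<^sup>2"
proof -
  have "prob {\<omega>\<in>space M. \<not> \<bar>Z \<omega>\<bar> \<le> C}
      \<le> prob {\<omega>\<in>space M. (Z \<omega>)\<^sup>2 \<ge> C\<^sup>2}"
    by (intro finite_measure_mono) (use \<open>C > 0\<close> in \<open>auto simp:
        abs_le_square_iff[symmetric]\<close>)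
  also have "\<dots> \<le> expectation (\<lambda>\<omega>. (Z \<omega>)\<^sup>2) / C\<^sup>2"
    by (rule integral_Markov_inequality_measure[OF assms(2), of "{}"]) (use \<open>C > 0\<close> in auto)
  finally show ?thesis .
qed

lemma tendsto_in_prob_L2:
  fixes Y :: "nat \<Rightarrow> 'a \<Rightarrow> real"
  assumes [measurable]: "\<And>n. Y n \<in> borel_measurable M"
    and int: "\<And>n. integrable M (\<lambda>\<omega>. (Y n \<omega>)\<^sup>2)"
    and lim: "(\<lambda>n. expectation (\<lambda>\<omega>. (Y n \<omega>)\<^sup>2))
        \<longlonglongrightarrow> 0"
  shows "((\<lambda>z. Y (fst z) (snd z)) \<longlongrightarrow> 0) in_prob"
proof (rule tendstoI)
  fix e :: real assume "e > 0"
  have "(\<lambda>n. prob {\<omega>\<in>space M. \<not> \<bar>Y n \<omega>\<bar>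
      \<le> e/2}) \<longlonglongrightarrow> 0"
  proof (rule tendsto_sandwich[OF _ _ tendsto_const])
    show "\<forall>\<^sub>F n in sequentially. prob {\<omega>\<in>space M. \<not> \<bar>Y n \<omega>\<bar>
        \<le> e/2} \<le> expectation (\<lambda>\<omega>. (Y n \<omega>)\<^sup>2) / (e/2)\<^sup>2"
      using \<open>e > 0\<close> int by (intro always_eventually allI second_moment_tail_bound) auto
    show "(\<lambda>n. expectation (\<lambda>\<omega>. (Y n \<omega>)\<^sup>2)
        / (e/2)\<^sup>2) \<longlonglongrightarrow> 0"
      using tendsto_divide[OF lim tendsto_const, of "(e/2)\<^sup>2"] \<open>e > 0\<close> by simp
  qed simp
  then have "eventually (\<lambda>z. \<bar>Y (fst z) (snd z)\<bar> \<le> e / 2) in_prob"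
    by (intro eventually_in_prob_prob) auto
  then show "\<forall>\<^sub>F z in in_prob. dist (Y (fst z) (snd z)) 0 < e"
    by eventually_elim (use \<open>e > 0\<close> in \<open>auto simp: dist_real_def\<close>)
qed

text \<open>Boundedness in probability, in the same style as \<open>in_prob\<close>: only an
  exceptional event has to be measurable, and only large n are constrained.\<close>

definition tight_seq :: "(nat \<Rightarrow> 'a \<Rightarrow> real) \<Rightarrow> bool" where
  "tight_seq Z \<longleftrightarrow> (\<forall>\<eta>>0. \<exists>C>0. \<forall>\<^sub>F n in sequentially.
     \<exists>A\<in>events. prob A \<le> \<eta> \<and> (\<forall>\<omega>\<in>space M
         - A. \<bar>Z n \<omega>\<bar> \<le> C))"

lemma tight_seq_L2:
  assumes [measurable]: "\<And>n. Z n \<in> borel_measurable M"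
    and int: "\<And>n. integrable M (\<lambda>\<omega>. (Z n \<omega>)\<^sup>2)"
    and bd: "\<forall>\<^sub>F n in sequentially. expectation (\<lambda>\<omega>. (Z n \<omega>)\<^sup>2)
        \<le> C"
  shows "tight_seq Z"
  unfolding tight_seq_def
proof (intro allI impI)
  fix \<eta> :: real assume "\<eta> > 0"
  \<comment> \<open>Chosen so that Chebyshev returns exactly \<open>\<eta>\<close>; |C| + 1 keeps
    the quotient positive whatever the sign of \<open>C\<close>.\<close>
  define D where "D = sqrt ((\<bar>C\<bar> + 1) / \<eta>)"
  have D: "D > 0" "D\<^sup>2 = (\<bar>C\<bar> + 1) / \<eta>" using \<open>\<eta> > 0\<close>
      by (auto simp: D_def divide_pos_pos)
  from bd have "\<forall>\<^sub>F n in sequentially. \<exists>A\<in>events. prob A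
      \<le> \<eta> \<and> (\<forall>\<omega>\<in>space M - A. \<bar>Z n \<omega>\<bar> \<le> D)"
  proof eventually_elim
    case (elim n)
    have "prob {\<omega>\<in>space M. \<not> \<bar>Z n \<omega>\<bar> \<le> D}
        \<le> expectation (\<lambda>\<omega>. (Z n \<omega>)\<^sup>2) / D\<^sup>2"
      using int D by (intro second_moment_tail_bound) auto
    also have "\<dots> \<le> (\<bar>C\<bar> + 1) / D\<^sup>2"
      using elim by (intro divide_right_mono) auto
    also have "\<dots> = \<eta>"
    proof -
      have "\<bar>C\<bar> + 1 \<noteq> 0" by linarith
      then show ?thesis unfolding D(2) using \<open>\<eta> > 0\<close> by simp
    qed
    finally show ?case
      by (intro bexI[of _ "{\<omega>\<in>space M. \<not> \<bar>Z n \<omega>\<bar> \<le> D}"]) auto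
  qed
  with D(1) show "\<exists>C>0. \<forall>\<^sub>F n in sequentially. \<exists>A\<in>events. prob A
      \<le> \<eta> \<and> (\<forall>\<omega>\<in>space M - A. \<bar>Z n \<omega>\<bar> \<le> C)"
    by (intro exI[of _ D] conjI)
qed

lemma tight_seqD:
  assumes "tight_seq Z" "\<eta> > 0"
  shows "\<exists>C>0. \<forall>\<^sub>F n in sequentially.
     \<exists>A\<in>events. prob A \<le> \<eta> \<and> (\<forall>\<omega>\<in>space M
         - A. \<bar>Z n \<omega>\<bar> \<le> C)"
  using assms(1)[unfolded tight_seq_def, rule_format, OF assms(2)] .

text \<open>Localization: an eventual property may be proved on the event that a tight sequence
  stays below a fixed constant. Objects such as a finite grid may then depend on that
  constant.\<close>

lemma eventually_in_prob_tight:
  assumes "tight_seq Z" and "\<And>C. C > 0 \<Longrightarrow> \<forall>\<^sub>F z in in_prob. \<bar>Z (fst z)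
      (snd z)\<bar> \<le> C \<longrightarrow> Q z"
  shows "eventually Q in_prob"
  unfolding eventually_in_prob
proof (intro allI impI)
  fix \<eta> :: real assume "\<eta> > 0"
  then have e: "\<eta> / 2 > 0" by simp
  obtain C where C: "C > 0" "\<forall>\<^sub>F n in sequentially.
     \<exists>A\<in>events. prob A \<le> \<eta>/2 \<and> (\<forall>\<omega>\<in>space M
         - A. \<bar>Z n \<omega>\<bar> \<le> C)"
    using tight_seqD[OF assms(1) e] by (elim exE conjE)
  from eventually_in_probD[OF assms(2)[OF C(1)] e] C(2)
  show "\<forall>\<^sub>F n in sequentially. \<exists>A\<in>events. prob A
      \<le> \<eta> \<and> (\<forall>\<omega>\<in>space M - A. Q (n, \<omega>))"
  proof eventually_elim
    case (elim n)
    then obtain A B where "A \<in> events" "prob A \<le> \<eta>/2" "\<forall>\<omega>\<in>space M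
        - A. \<bar>Z n \<omega>\<bar> \<le> C \<longrightarrow> Q (n, \<omega>)"
       "B \<in> events" "prob B \<le> \<eta>/2" "\<forall>\<omega>\<in>space M
           - B. \<bar>Z n \<omega>\<bar> \<le> C" by auto
    moreover from this have "prob (A \<union> B) \<le> \<eta>"
      using measure_Un_le[of A M B] by simp
    ultimately show ?case by (intro bexI[of _ "A \<union> B"]) auto
  qed
qed

lemma tendsto_mult_tight:
  assumes "tight_seq Z" and Y: "((\<lambda>z. Y (fst z) (snd z)) \<longlongrightarrow> 0) in_prob"
  shows "((\<lambda>z. Y (fst z) (snd z) * Z (fst z) (snd z)) \<longlongrightarrow> (0::real)) in_prob"
proof (rule tendstoI)
  fix e :: real assume "e > 0"
  show "\<forall>\<^sub>F z in in_prob. dist (Y (fst z) (snd z) * Z (fst z) (snd z)) 0 < e"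
  proof (rule eventually_in_prob_tight[OF assms(1)])
    fix C :: real assume C: "C > 0"
    have "\<forall>\<^sub>F z in in_prob. dist (Y (fst z) (snd z)) 0 < e / C"
      using Y C \<open>e > 0\<close> by (intro tendstoD) auto
    then show "\<forall>\<^sub>F z in in_prob. \<bar>Z (fst z) (snd z)\<bar>
        \<le> C \<longrightarrow> dist (Y (fst z) (snd z) * Z (fst z) (snd z)) 0 < e"
    proof eventually_elim
      case (elim z)
      show ?case
      proof
        assume "\<bar>Z (fst z) (snd z)\<bar> \<le> C"
        then have "\<bar>Y (fst z) (snd z)\<bar> * \<bar>Z (fst z) (snd z)\<bar>
            \<le> \<bar>Y (fst z) (snd z)\<bar> * C"
          by (intro mult_left_mono) auto
        also have "\<dots> < e" using elim C by (simp add: dist_real_def field_simps)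
        finally show "dist (Y (fst z) (snd z) * Z (fst z) (snd z)) 0 < e"
          by (simp add: dist_real_def abs_mult)
      qed
    qed
  qed
qed

lemma tight_seq_add_tendsto:
  assumes "tight_seq Z" and Y: "((\<lambda>z. Y (fst z) (snd z) - Z (fst z) (snd z))
      \<longlongrightarrow> c) in_prob"
  shows "tight_seq Y"
  unfolding tight_seq_def
proof (intro allI impI)
  fix \<eta> :: real assume "\<eta> > 0"
  then have e: "\<eta> / 2 > 0" by simp
  obtain C where C: "C > 0" "\<forall>\<^sub>F n in sequentially.
     \<exists>A\<in>events. prob A \<le> \<eta>/2 \<and> (\<forall>\<omega>\<in>space M
         - A. \<bar>Z n \<omega>\<bar> \<le> C)"
    using tight_seqD[OF assms(1) e] by (elim exE conjE)
  have "\<forall>\<^sub>F z in in_prob. dist (Y (fst z) (snd z) - Z (fst z) (snd z)) c < 1"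
    by (rule tendstoD[OF Y]) simp
  from eventually_in_probD[OF this e] C(2)
  have "\<forall>\<^sub>F n in sequentially. \<exists>A\<in>events. prob A
      \<le> \<eta> \<and> (\<forall>\<omega>\<in>space M - A. \<bar>Y n \<omega>\<bar>
      \<le> C + \<bar>c\<bar> + 1)"
  proof eventually_elim
    case (elim n)
    from elim(1) obtain A where A: "A \<in> events" "prob A \<le> \<eta>/2"
      "\<forall>\<omega>\<in>space M - A. \<bar>Y n \<omega> - Z n \<omega> - c\<bar>
          < 1" unfolding dist_real_def fst_conv snd_conv by blast
    from elim(2) obtain B where B: "B \<in> events" "prob B
        \<le> \<eta>/2" "\<forall>\<omega>\<in>space M - B. \<bar>Z n \<omega>\<bar> \<le> C" by blast
    note AB = A B
    then have "prob (A \<union> B) \<le> \<eta>"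
      using measure_Un_le[of A M B] by simp
    moreover have *: "\<bar>Y n \<omega>\<bar> \<le> C + \<bar>c\<bar> + 1" if "\<omega> \<in> space M
        - (A \<union> B)" for \<omega>
    proof -
      have "\<bar>Y n \<omega> - Z n \<omega> - c\<bar> < 1" "\<bar>Z n \<omega>\<bar> \<le> C"
          using AB(3,6) that by blast+
      then show ?thesis by linarith
    qed
    ultimately show ?case using AB(1,4) by (intro bexI[of _ "A \<union> B"] conjI ballI) simp_all
  qed
  moreover have "C + \<bar>c\<bar> + 1 > 0" using C(1) by linarith
  ultimately show "\<exists>C>0. \<forall>\<^sub>F n in sequentially. \<exists>A\<in>events. prob A
      \<le> \<eta> \<and> (\<forall>\<omega>\<in>space M - A. \<bar>Y n \<omega>\<bar> \<le> C)"
    by (intro exI[of _ "C + \<bar>c\<bar> + 1"] conjI)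
qed

text \<open>Slutsky's theorem for characteristic functions: \<open>iexp\<close> has modulus 1 and is
  1-Lipschitz in its real argument, so the integrands differ by at most |t| d off a small event and
  by at most 2 on it.\<close>

lemma char_diff_tendsto_0:
  assumes [measurable]: "\<And>n. Y n \<in> borel_measurable M" "\<And>n. Z n \<in> borel_measurable M"
    and lim: "((\<lambda>z. Y (fst z) (snd z) - Z (fst z) (snd z)) \<longlongrightarrow> 0) in_prob"
  shows "(\<lambda>n. char (distr M borel (Y n)) t - char (distr M borel (Z n)) t)
      \<longlonglongrightarrow> 0"
proof (rule tendstoI)
  fix e :: real assume e: "e > 0"
  \<comment> \<open>Together with an exceptional probability of at most e / 8 the total stays below
    e / 2 + e / 4; the summand 1 covers t = 0.\<close>
  define d where "d = e / 4 / (\<bar>t\<bar> + 1)"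
  have d: "d > 0" "\<bar>t\<bar> * d < e / 2"
  proof -
    have t: "\<bar>t\<bar> + 1 > 0" by linarith
    then show "d > 0" using e by (simp add: d_def)
    have "\<bar>t\<bar> * d \<le> (\<bar>t\<bar> + 1) * d" using \<open>d > 0\<close> by simp
    also have "\<dots> = e / 4" using t less_imp_neq[OF t] unfolding d_def
        by (metis nonzero_mult_div_cancel_left times_divide_eq_right)
    finally show "\<bar>t\<bar> * d < e / 2" using e by simp
  qed
  have "e / 8 > 0" using e by simp
  have "\<forall>\<^sub>F z in in_prob. dist (Y (fst z) (snd z) - Z (fst z) (snd z)) 0 < d"
    by (rule tendstoD[OF lim d(1)])
  from eventually_in_probD[OF this \<open>e / 8 > 0\<close>]
  show "\<forall>\<^sub>F n in sequentially. dist (char (distr M borel (Y n)) t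
      - char (distr M borel (Z n)) t) 0 < e"
  proof eventually_elim
    case (elim n)
    then obtain A where A[measurable]: "A \<in> events" and pA: "prob A \<le> e / 8"
      and AA: "\<forall>\<omega>\<in>space M - A. \<bar>Y n \<omega> - Z n \<omega>\<bar> < d"
      unfolding dist_real_def fst_conv snd_conv diff_0_right by blast
    have i: "integrable M (\<lambda>x. iexp (t * f x))" if [measurable]: "f \<in> borel_measurable M" for f
      by (intro integrable_const_bound[where B=1]) auto
    have b: "cmod (iexp (t * Y n x) - iexp (t * Z n x))
        \<le> \<bar>t\<bar> * d + 2 * indicator A x" if "x \<in> space M" for x
    proof (cases "x \<in> A")
      case True
      have "cmod (iexp (t * Y n x) - iexp (t * Z n x)) \<le> 1 + 1"
        by (rule order_trans[OF norm_triangle_ineq4]) simp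
      then show ?thesis using True d by (simp add: add_increasing)
    next
      case False
      have "iexp (t * Y n x) - iexp (t * Z n x) = iexp (t * Z n x) * (iexp (t * (Y n x - Z n x)) - 1)"
        by (simp add: algebra_simps flip: exp_add)
      then have "cmod (iexp (t * Y n x) - iexp (t * Z n x)) = cmod (iexp (t * (Y n x - Z n x)) - 1)"
        by (simp add: norm_mult)
      also have "\<dots> \<le> \<bar>t * (Y n x - Z n x)\<bar>"
        using iexp_approx1[of "t * (Y n x - Z n x)" 0] by simp
      also have "\<dots> \<le> \<bar>t\<bar> * d"
        using AA False that unfolding abs_mult by (intro mult_left_mono) (auto intro: less_imp_le)
      finally show ?thesis using False by simp
    qed
    have "cmod (char (distr M borel (Y n)) t - char (distr M borel (Z n)) t)
       = cmod (CLINT x|M. iexp (t * Y n x) - iexp (t * Z n x))"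
      by (subst Bochner_Integration.integral_diff[OF i i]) (simp_all add: char_def integral_distr)
    also have "\<dots> \<le> (LINT x|M. cmod (iexp (t * Y n x) - iexp (t * Z n x)))"
      by (rule integral_norm_bound)
    also have "\<dots> \<le> (LINT x|M. \<bar>t\<bar> * d + 2 * indicator A x)"
    proof (rule integral_mono)
      show "integrable M (\<lambda>x. cmod (iexp (t * Y n x) - iexp (t * Z n x)))"
        by (intro integrable_norm Bochner_Integration.integrable_diff i assms)
      show "integrable M (\<lambda>x. \<bar>t\<bar> * d + 2 * indicator A x)"
        using d by (intro integrable_const_bound[where B="\<bar>t\<bar> * d + 2"]) (auto simp: indicator_def)
    qed (rule b)
    also have "\<dots> = \<bar>t\<bar> * d + 2 * prob A"
      by (subst Bochner_Integration.integral_add)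
        (auto simp: prob_space intro!: integrable_const_bound[where B=1])
    also have "\<dots> < e" using d pA e by linarith
    finally show ?case by (simp add: dist_norm)
  qed
qed

end

section \<open>Sums of independent random variables\<close>

text \<open>Orthogonality: each new summand is centred and independent of the partial sum, so the
  mixed term has mean zero. Integrability of the squared sum is part of the induction because it
  makes the partial sum itself integrable.\<close>

lemma (in prob_space) indep_sum_second_moment:
  fixes Y :: "'i \<Rightarrow> 'a \<Rightarrow> real"
  assumes "finite A" "indep_vars (\<lambda>_. borel) Y A"
    and "\<And>i. i \<in> A \<Longrightarrow> integrable M (\<lambda>\<omega>. (Y i \<omega>)\<^sup>2)"
        "\<And>i. i \<in> A \<Longrightarrow> expectation (Y i) = 0"
  shows "integrable M (\<lambda>\<omega>. (\<Sum>i\<in>A. Y i \<omega>)\<^sup>2) \<and>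
    expectation (\<lambda>\<omega>. (\<Sum>i\<in>A. Y i \<omega>)\<^sup>2)
        = (\<Sum>i\<in>A. expectation (\<lambda>\<omega>. (Y i \<omega>)\<^sup>2))"
  using assms
proof (induction A rule: finite_induct)
  case empty
  then show ?case by simp
next
  case (insert a A)
  define S where "S = (\<lambda>\<omega>. \<Sum>i\<in>A. Y i \<omega>)"
  have rv[measurable]: "Y i \<in> borel_measurable M" if "i \<in> insert a A" for i
    using insert.prems(1) that unfolding indep_vars_def2 by blast
  have [measurable]: "S \<in> borel_measurable M" "Y a \<in> borel_measurable M"
    unfolding S_def by (auto intro!: borel_measurable_sum rv)
  have IH: "integrable M (\<lambda>\<omega>. (S \<omega>)\<^sup>2)"
      "expectation (\<lambda>\<omega>. (S \<omega>)\<^sup>2)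
          = (\<Sum>i\<in>A. expectation (\<lambda>\<omega>. (Y i \<omega>)\<^sup>2))"
    using insert.IH[OF indep_vars_subset[OF insert.prems(1)]] insert.prems(2,3)
    unfolding S_def by auto
  have Ya: "integrable M (\<lambda>\<omega>. (Y a \<omega>)\<^sup>2)" using insert.prems(2) by blast
  have i1: "integrable M (Y a)" "integrable M S"
    using square_integrable_imp_integrable[OF _ Ya] square_integrable_imp_integrable[OF _ IH(1)]
    by simp_all
  have ind: "indep_var borel (Y a) borel S"
    unfolding S_def by (rule indep_vars_sum[OF insert.hyps insert.prems(1)])
  have prod: "integrable M (\<lambda>\<omega>. Y a \<omega>
      * S \<omega>)" "expectation (\<lambda>\<omega>. Y a \<omega> * S \<omega>) = 0"
    using indep_var_integrable[OF ind i1] indep_var_lebesgue_integral[OF ind i1] insert.prems(3)[of a]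
    by auto
  have eq: "(\<lambda>\<omega>. (\<Sum>i\<in>insert a A. Y i \<omega>)\<^sup>2)
      = (\<lambda>\<omega>. (Y a \<omega>)\<^sup>2 + (2 * (Y a \<omega> * S \<omega>)
      + (S \<omega>)\<^sup>2))"
    using insert.hyps by (simp add: S_def fun_eq_iff power2_sum)
  have "integrable M (\<lambda>\<omega>. (Y a \<omega>)\<^sup>2 + (2 * (Y a \<omega> * S \<omega>)
      + (S \<omega>)\<^sup>2))"
    using Ya IH(1) prod(1) by (intro Bochner_Integration.integrable_add integrable_mult_right)
  moreover have "expectation (\<lambda>\<omega>. (Y a \<omega>)\<^sup>2 + (2 * (Y a \<omega> * S \<omega>)
      + (S \<omega>)\<^sup>2))
     = (\<Sum>i\<in>insert a A. expectation (\<lambda>\<omega>. (Y i \<omega>)\<^sup>2))"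
    using Ya IH prod insert.hyps by simp
  ultimately show ?case unfolding eq by blast
qed

text \<open>Serves to replace 1 - a by the Gaussian factor exp (- a) in the central limit theorem,
  where a is half of t^2 times a small variance; any error quadratic in a suffices.\<close>

lemma exp_neg_approx:
  assumes "0 \<le> (a::real)"
  shows "\<bar>exp (- a) - (1 - a)\<bar> \<le> a\<^sup>2"
proof -
  have "1 - a \<le> exp (- a)" using exp_ge_add_one_self[of "- a"] by simp
  moreover have "exp (- a) \<le> 1 - a + a\<^sup>2"
  proof -
    \<comment> \<open>The product on the right is 1 + a^3.\<close>
    have "1 \<le> (1 - a + a\<^sup>2) * (1 + a)" using assms by (simp add: algebra_simps power2_eq_square)
    also have "\<dots> \<le> (1 - a + a\<^sup>2) * exp a"
    proof (rule mult_left_mono)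
      have "(1 - a + a\<^sup>2) = (a - 1/2)\<^sup>2 + 3/4" by (simp add: power2_eq_square algebra_simps)
      then show "0 \<le> 1 - a + a\<^sup>2" by simp
    qed simp
    finally show ?thesis by (simp add: exp_minus field_simps)
  qed
  ultimately show ?thesis by simp
qed

text \<open>Copies are indexed from 1, like the data; \<open>Xs 0\<close> is unconstrained, hence
  the side condition i \<ge> 1 in the transfer lemmas.\<close>

locale iid_sample = prob_space M for M :: "'a measure" +
  fixes X :: "'a \<Rightarrow> 'b :: topological_space" and Xs :: "nat \<Rightarrow> 'a \<Rightarrow> 'b"
  assumes X_measurable[measurable]: "X \<in> borel_measurable M"
    and Xs_indep: "indep_vars (\<lambda>_. borel) Xs {1..}"
    and Xs_distr: "\<And>i. i \<ge> 1 \<Longrightarrow> distr M borel (Xs i) = distr M borel X"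
begin

lemma Xs_measurable: "i \<ge> 1 \<Longrightarrow> Xs i \<in> borel_measurable M"
  using Xs_indep unfolding indep_vars_def2 by auto

lemma distr_Xs:
  assumes [measurable]: "\<phi> \<in> borel_measurable borel" and "i \<ge> 1"
  shows "distr M borel (\<lambda>\<omega>. \<phi> (Xs i \<omega>))
      = distr M borel (\<lambda>\<omega>. \<phi> (X \<omega>))"
proof -
  note Xs_measurable[OF assms(2), measurable]
  have "distr M borel (\<lambda>\<omega>. \<phi> (Xs i \<omega>)) = distr (distr M borel (Xs i)) borel \<phi>"
    by (simp add: distr_distr comp_def)
  also have "\<dots> = distr M borel (\<lambda>\<omega>. \<phi> (X \<omega>))"
    unfolding Xs_distr[OF assms(2)] by (simp add: distr_distr comp_def)
  finally show ?thesis .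
qed

lemma expectation_Xs:
  fixes \<phi> :: "'b \<Rightarrow> real"
  assumes [measurable]: "\<phi> \<in> borel_measurable borel" and i: "i \<ge> 1"
  shows "expectation (\<lambda>\<omega>. \<phi> (Xs i \<omega>))
      = expectation (\<lambda>\<omega>. \<phi> (X \<omega>))"
proof -
  note Xs_measurable[OF i, measurable]
  show ?thesis
    using integral_distr[of "Xs i" M borel \<phi>] integral_distr[of X M borel \<phi>] Xs_distr[OF i] by simp
qed

lemma integrable_Xs:
  fixes \<phi> :: "'b \<Rightarrow> real"
  assumes [measurable]: "\<phi> \<in> borel_measurable borel" and i: "i \<ge> 1"
  shows "integrable M (\<lambda>\<omega>. \<phi> (Xs i \<omega>))
      \<longleftrightarrow> integrable M (\<lambda>\<omega>. \<phi> (X \<omega>))"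
proof -
  note Xs_measurable[OF i, measurable]
  show ?thesis
    using integrable_distr_eq[of "Xs i" M borel \<phi>] integrable_distr_eq[of X M borel \<phi>] Xs_distr[OF
        i]
    by simp
qed

lemma AE_Xs:
  assumes [measurable]: "Measurable.pred borel P" and i: "i \<ge> 1" and "AE \<omega> in M. P (X \<omega>)"
  shows "AE \<omega> in M. P (Xs i \<omega>)"
proof -
  note Xs_measurable[OF i, measurable]
  show ?thesis
    using AE_distr_iff[of "Xs i" M borel P] AE_distr_iff[of X M borel P] assms(3)
    unfolding Xs_distr[OF i] by simp
qed

lemma sum_second_moment:
  assumes [measurable]: "\<And>i. i \<in> {1..n} \<Longrightarrow> \<psi> i \<in> borel_measurable borel"
    and int: "\<And>i. i \<in> {1..n} \<Longrightarrow> integrable M (\<lambda>\<omega>. (\<psi> i (X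
        \<omega>))\<^sup>2)"
    and zero: "\<And>i. i \<in> {1..n} \<Longrightarrow> expectation (\<lambda>\<omega>. \<psi> i (X
        \<omega>)) = (0::real)"
  shows "integrable M (\<lambda>\<omega>. (\<Sum>i=1..n. \<psi> i (Xs i \<omega>))\<^sup>2)"
    and "expectation (\<lambda>\<omega>. (\<Sum>i=1..n. \<psi> i (Xs i \<omega>))\<^sup>2)
        = (\<Sum>i=1..n. expectation (\<lambda>\<omega>. (\<psi> i (X \<omega>))\<^sup>2))"
proof -
  have 1: "indep_vars (\<lambda>_. borel) (\<lambda>i \<omega>. \<psi> i (Xs i \<omega>)) {1..n}"
    by (rule indep_vars_compose2[OF indep_vars_subset[OF Xs_indep]]) auto
  have 2: "integrable M (\<lambda>\<omega>. (\<psi> i (Xs i \<omega>))\<^sup>2)" if i: "i \<in> {1..n}" for i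
    using integrable_Xs[of "\<lambda>x. (\<psi> i x)\<^sup>2" i] int[OF i] assms(1)[OF i] i by simp
  have 3: "expectation (\<lambda>\<omega>. \<psi> i (Xs i \<omega>)) = 0" if i: "i \<in> {1..n}" for i
    using expectation_Xs[of "\<psi> i" i] zero[OF i] assms(1)[OF i] i by simp
  have 4: "expectation (\<lambda>\<omega>. (\<psi> i (Xs i \<omega>))\<^sup>2)
      = expectation (\<lambda>\<omega>. (\<psi> i (X \<omega>))\<^sup>2)" if i: "i \<in> {1..n}" for i
    using expectation_Xs[of "\<lambda>x. (\<psi> i x)\<^sup>2" i] assms(1)[OF i] i by simp
  show "integrable M (\<lambda>\<omega>. (\<Sum>i=1..n. \<psi> i (Xs i \<omega>))\<^sup>2)"
    and "expectation (\<lambda>\<omega>. (\<Sum>i=1..n. \<psi> i (Xs i \<omega>))\<^sup>2)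
        = (\<Sum>i=1..n. expectation (\<lambda>\<omega>. (\<psi> i (X \<omega>))\<^sup>2))"
    using indep_sum_second_moment[OF _ 1 2 3] by (simp_all add: 4 cong: sum.cong_simp)
qed

text \<open>The variance of one term is bounded by its raw second moment, that is, the squared mean
  is dropped. For functions supported on a rare event the raw moment is the easy one to compute and
  little is lost.\<close>

lemma centered_sum_second_moment:
  fixes \<phi> :: "'b \<Rightarrow> real" and n :: nat
  assumes [measurable]: "\<phi> \<in> borel_measurable borel"
    and int: "integrable M (\<lambda>\<omega>. (\<phi> (X \<omega>))\<^sup>2)"
  defines "Z \<equiv> \<lambda>\<omega>. (\<Sum>i=1..n. \<phi> (Xs i \<omega>)) - real n
      * expectation (\<lambda>\<omega>. \<phi> (X \<omega>))"
  shows "Z \<in> borel_measurable M" "integrable M (\<lambda>\<omega>. (Z \<omega>)\<^sup>2)"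
    and "expectation (\<lambda>\<omega>. (Z \<omega>)\<^sup>2)
        \<le> real n * expectation (\<lambda>\<omega>. (\<phi> (X \<omega>))\<^sup>2)"
proof -
  define m where "m = expectation (\<lambda>\<omega>. \<phi> (X \<omega>))"
  have i1: "integrable M (\<lambda>\<omega>. \<phi> (X \<omega>))"
    by (rule square_integrable_imp_integrable[OF _ int]) measurable
  have Z: "Z = (\<lambda>\<omega>. \<Sum>i=1..n. \<phi> (Xs i \<omega>) - m)"
    by (simp add: Z_def m_def sum_subtractf)
  have sq: "(\<lambda>\<omega>. (\<phi> (X \<omega>) - m)\<^sup>2)
      = (\<lambda>\<omega>. (\<phi> (X \<omega>))\<^sup>2 - 2 * m * \<phi> (X \<omega>) + m\<^sup>2)"
    by (simp add: power2_diff algebra_simps)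
  have i2: "integrable M (\<lambda>\<omega>. (\<phi> (X \<omega>) - m)\<^sup>2)"
    unfolding sq using int i1 by simp
  have "expectation (\<lambda>\<omega>. (\<phi> (X \<omega>) - m)\<^sup>2)
      = expectation (\<lambda>\<omega>. (\<phi> (X \<omega>))\<^sup>2) - m\<^sup>2"
    unfolding sq using int i1 by (simp add: prob_space m_def power2_eq_square)
  then have le: "expectation (\<lambda>\<omega>. (\<phi> (X \<omega>) - m)\<^sup>2)
      \<le> expectation (\<lambda>\<omega>. (\<phi> (X \<omega>))\<^sup>2)" by simp
  have e0: "expectation (\<lambda>\<omega>. \<phi> (X \<omega>) - m) = 0" using i1
      by (simp add: prob_space m_def)
  show "Z \<in> borel_measurable M"
    unfolding Z by (intro borel_measurable_sum borel_measurable_diff borel_measurable_const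
        measurable_compose[OF Xs_measurable]) auto
  show "integrable M (\<lambda>\<omega>. (Z \<omega>)\<^sup>2)"
    unfolding Z using sum_second_moment(1)[of n "\<lambda>_ x. \<phi> x - m"] i2 e0 by simp
  have "expectation (\<lambda>\<omega>. (Z \<omega>)\<^sup>2)
      = real n * expectation (\<lambda>\<omega>. (\<phi> (X \<omega>) - m)\<^sup>2)"
    unfolding Z using sum_second_moment(2)[of n "\<lambda>_ x. \<phi> x - m"] i2 e0 by simp
  also have "\<dots> \<le> real n * expectation (\<lambda>\<omega>. (\<phi> (X \<omega>))\<^sup>2)"
    using le by (intro mult_left_mono) auto
  finally show "expectation (\<lambda>\<omega>. (Z \<omega>)\<^sup>2)
      \<le> real n * expectation (\<lambda>\<omega>. (\<phi> (X \<omega>))\<^sup>2)" .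
qed

text \<open>Weak law for arrays whose function changes with n: the centred sum vanishes in mean
  square by the preceding bound, and the deterministic mean is added back.\<close>

lemma iid_sum_tendsto:
  fixes \<phi> :: "nat \<Rightarrow> 'b \<Rightarrow> real"
  assumes meas: "\<And>n. \<phi> n \<in> borel_measurable borel"
    and int: "\<And>n. integrable M (\<lambda>\<omega>. (\<phi> n (X \<omega>))\<^sup>2)"
    and m: "(\<lambda>n. real (N n) * expectation (\<lambda>\<omega>. \<phi> n (X \<omega>)))
        \<longlonglongrightarrow> \<mu>"
    and v: "(\<lambda>n. real (N n) * expectation (\<lambda>\<omega>. (\<phi> n (X \<omega>))\<^sup>2))
        \<longlonglongrightarrow> 0"
  shows "((\<lambda>z. \<Sum>i=1..N (fst z). \<phi> (fst z) (Xs i (snd z)))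
      \<longlongrightarrow> \<mu>) in_prob"
proof -
  note Z = centered_sum_second_moment[OF meas int]
  have "((\<lambda>z. (\<Sum>i=1..N (fst z). \<phi> (fst z) (Xs i (snd z)))
        - real (N (fst z)) * expectation (\<lambda>\<omega>. \<phi> (fst z) (X \<omega>)))
            \<longlongrightarrow> 0) in_prob"
  proof (rule tendsto_in_prob_L2[OF Z(1,2)])
    show "(\<lambda>n. expectation (\<lambda>\<omega>. ((\<Sum>i=1..N n. \<phi> n (Xs i \<omega>))
        - real (N n) * expectation (\<lambda>\<omega>. \<phi> n (X \<omega>)))\<^sup>2))
            \<longlonglongrightarrow> 0"
      by (rule tendsto_sandwich[OF _ always_eventually[OF allI[OF Z(3)]] tendsto_const v]) simp
  qed
  from tendsto_add[OF this tendsto_in_prob_const[OF m]] show ?thesis by simp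
qed

lemma iid_sum_tight:
  fixes \<phi> :: "nat \<Rightarrow> 'b \<Rightarrow> real"
  assumes meas: "\<And>n. \<phi> n \<in> borel_measurable borel"
    and int: "\<And>n. integrable M (\<lambda>\<omega>. (\<phi> n (X \<omega>))\<^sup>2)"
    and v: "\<forall>\<^sub>F n in sequentially. real (N n)
        * expectation (\<lambda>\<omega>. (\<phi> n (X \<omega>))\<^sup>2) \<le> C"
  shows "tight_seq (\<lambda>n \<omega>. (\<Sum>i=1..N n. \<phi> n (Xs i \<omega>)) - real (N n)
      * expectation (\<lambda>\<omega>. \<phi> n (X \<omega>)))"
proof -
  note Z = centered_sum_second_moment[OF meas int]
  show ?thesis
    by (rule tight_seq_L2[OF Z(1,2)], rule eventually_mono[OF v], rule order_trans[OF Z(3)])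
qed

text \<open>The characteristic function factorizes, and replacing the factors one at a time costs
  the sum of the individual errors. The function may depend on i because observations beyond the end
  of a short sample contribute fewer coordinates; moment conditions are needed only for large n,
  where the thresholds are positive.\<close>

lemma lyapunov_clt:
  fixes \<psi> :: "nat \<Rightarrow> nat \<Rightarrow> 'b \<Rightarrow> real" and L :: "nat \<Rightarrow> nat"
  assumes meas: "\<And>n i. \<psi> n i \<in> borel_measurable borel"
    and ev: "\<forall>\<^sub>F n in sequentially. \<forall>i\<in>{1..L n}. integrable M (\<lambda>\<omega>.
        \<bar>\<psi> n i (X \<omega>)\<bar> ^ 3) \<and>
          expectation (\<lambda>\<omega>. \<psi> n i (X \<omega>))
              = 0 \<and> expectation (\<lambda>\<omega>. (\<psi> n i (X \<omega>))\<^sup>2) \<le> v n"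
    and v: "v \<longlonglongrightarrow> 0"
    and s: "(\<lambda>n. \<Sum>i=1..L n. expectation (\<lambda>\<omega>. (\<psi> n i (X \<omega>))\<^sup>2))
        \<longlonglongrightarrow> s"
    and third: "(\<lambda>n. \<Sum>i=1..L n. expectation (\<lambda>\<omega>. \<bar>\<psi> n i (X
        \<omega>)\<bar> ^ 3)) \<longlonglongrightarrow> 0"
  shows "(\<lambda>n. char (distr M borel (\<lambda>\<omega>. \<Sum>i=1..L n. \<psi> n i (Xs i \<omega>))) t)
           \<longlonglongrightarrow> complex_of_real (exp (- (t\<^sup>2 * s / 2)))"
proof -
  define e2 where "e2 n i = expectation (\<lambda>\<omega>. (\<psi> n i (X \<omega>))\<^sup>2)" for n i
  define e3 where "e3 n i = expectation (\<lambda>\<omega>. \<bar>\<psi> n i (X \<omega>)\<bar> ^ 3)" for n i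
  \<comment> \<open>First term: replacing each characteristic function by 1 - t^2 e2 / 2. Second
    term: replacing that by the Gaussian factor, an error of order e2^2 in which one factor e2 is
    bounded by the uniform \<open>v n\<close>.\<close>
  define err where "err n = \<bar>t\<bar> ^ 3 / 6 * (\<Sum>i=1..L n. e3 n i) + t ^ 4 / 4 * (v n
      * (\<Sum>i=1..L n. e2 n i))" for n
  let ?c = "\<lambda>n. char (distr M borel (\<lambda>\<omega>. \<Sum>i=1..L n. \<psi> n i (Xs i \<omega>)))
      t"
  let ?w = "\<lambda>n. complex_of_real (exp (- (t\<^sup>2 * (\<Sum>i=1..L n. e2 n i) / 2)))"
  have bound: "\<forall>\<^sub>F n in sequentially. norm (?c n - ?w n) \<le> err n"
    using ev
  proof eventually_elim
    case (elim n)
    note meas[of n, measurable]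
    have "indep_vars (\<lambda>_. borel) (\<lambda>i \<omega>. \<psi> n i (Xs i \<omega>)) {1..L n}"
      by (rule indep_vars_compose2[OF indep_vars_subset[OF Xs_indep]]) auto
    then have "?c n = (\<Prod>i\<in>{1..L n}. char (distr M borel (\<lambda>\<omega>. \<psi> n i (Xs i
        \<omega>))) t)"
      by (rule char_distr_sum)
    also have "\<dots> = (\<Prod>i\<in>{1..L n}. char (distr M borel (\<lambda>\<omega>. \<psi> n i (X
        \<omega>))) t)"
      by (intro prod.cong refl) (simp add: distr_Xs)
    finally have c: "?c n = (\<Prod>i\<in>{1..L n}. char (distr M borel (\<lambda>\<omega>. \<psi> n i (X
        \<omega>))) t)" .
    have w: "?w n = (\<Prod>i\<in>{1..L n}. complex_of_real (exp (- (t\<^sup>2 * e2 n i / 2))))"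
      by (simp add: of_real_prod[symmetric] exp_sum[symmetric] sum_negf sum_divide_distrib sum_distrib_left
          del: of_real_exp)
    have e2nn: "0 \<le> e2 n i" for i unfolding e2_def by simp
    have "norm (?c n - ?w n) \<le> (\<Sum>i\<in>{1..L n}. norm (char (distr M borel (\<lambda>\<omega>.
        \<psi> n i (X \<omega>))) t
             - complex_of_real (exp (- (t\<^sup>2 * e2 n i / 2)))))"
      unfolding c w
    proof (rule norm_prod_diff)
      fix i
      interpret D: real_distribution "distr M borel (\<lambda>\<omega>. \<psi> n i (X \<omega>))"
        by (rule real_distribution_distr) measurable
      show "norm (char (distr M borel (\<lambda>\<omega>. \<psi> n i (X \<omega>))) t) \<le> 1"
        by (rule D.cmod_char_le_1)
      show "norm (complex_of_real (exp (- (t\<^sup>2 * e2 n i / 2)))) \<le> 1"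
        using e2nn[of i] by (simp del: of_real_exp)
    qed
    also have "\<dots> \<le> (\<Sum>i\<in>{1..L n}. \<bar>t\<bar> ^ 3 / 6 * e3 n i + t ^ 4 / 4 * (v n
        * e2 n i))"
    proof (rule sum_mono)
      fix i assume i: "i \<in> {1..L n}"
      have i3: "integrable M (\<lambda>\<omega>. \<bar>\<psi> n i (X \<omega>)\<bar> ^ 3)"
          and e1: "expectation (\<lambda>\<omega>. \<psi> n i (X \<omega>)) = 0"
        and ev: "e2 n i \<le> v n" using elim i unfolding e2_def by auto
      have "integrable M (\<lambda>\<omega>. 1 + \<bar>\<psi> n i (X \<omega>)\<bar> ^ 3)" using i3 by simp
      then have i2: "integrable M (\<lambda>\<omega>. (\<psi> n i (X \<omega>))\<^sup>2)"
      proof (rule Bochner_Integration.integrable_bound)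
        show "AE x in M. norm ((\<psi> n i (X x))\<^sup>2) \<le> norm (1 + \<bar>\<psi> n i (X x)\<bar> ^ 3)"
        proof (rule AE_I2)
          fix x
          let ?y = "\<bar>\<psi> n i (X x)\<bar>"
          have "?y\<^sup>2 \<le> 1 + ?y ^ 3"
          proof (cases "?y \<le> 1")
            case True
            then have "?y\<^sup>2 \<le> 1" by (intro power_le_one) auto
            then show ?thesis by (simp add: add_increasing2)
          next
            case False
            then have "?y\<^sup>2 \<le> ?y ^ 3" by (intro power_increasing) auto
            then show ?thesis by simp
          qed
          then show "norm ((\<psi> n i (X x))\<^sup>2) \<le> norm (1 + ?y ^ 3)" by simp
        qed
      qed measurable
      have i1: "integrable M (\<lambda>\<omega>. \<psi> n i (X \<omega>))"
        by (rule square_integrable_imp_integrable[OF _ i2]) measurable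
      have var: "variance (\<lambda>\<omega>. \<psi> n i (X \<omega>)) = e2 n i" by (simp add: e1 e2_def)
      have "norm (char (distr M borel (\<lambda>\<omega>. \<psi> n i (X \<omega>))) t - (1 - t^2 * e2 n i
          / 2)) \<le>
          (t^2 / 6) * expectation (\<lambda>x. min (6 * (\<psi> n i (X x))^2) (\<bar>t\<bar>
              * \<bar>\<psi> n i (X x)\<bar>^3))"
        by (rule char_approx3'[OF _ i1 i2 e1 var refl]) measurable
      also have "\<dots> \<le> (t^2 / 6) * expectation (\<lambda>x. \<bar>t\<bar>
          * \<bar>\<psi> n i (X x)\<bar>^3)"
      proof (intro mult_left_mono integral_mono)
        show "integrable M (\<lambda>x. \<bar>t\<bar> * \<bar>\<psi> n i (X x)\<bar>^3)" using i3
            by (rule integrable_mult_right)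
        show "integrable M (\<lambda>x. min (6 * (\<psi> n i (X x))^2) (\<bar>t\<bar>
            * \<bar>\<psi> n i (X x)\<bar>^3))"
          by (intro integrable_min integrable_mult_right i2 i3)
      qed simp_all
      also have "\<dots> = \<bar>t\<bar> ^ 3 / 6 * e3 n i"
      proof -
        have "t\<^sup>2 * \<bar>t\<bar> = \<bar>t\<bar> ^ 3"
            by (metis power2_abs power3_eq_cube power2_eq_square)
        then show ?thesis by (simp add: e3_def)
      qed
      finally have A: "norm (char (distr M borel (\<lambda>\<omega>. \<psi> n i (X \<omega>))) t - (1 - t^2
          * e2 n i / 2)) \<le> \<bar>t\<bar> ^ 3 / 6 * e3 n i" .
      have "norm (complex_of_real (1 - t^2 * e2 n i / 2) - complex_of_real (exp (- (t\<^sup>2 * e2 n i / 2))))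
         = \<bar>exp (- (t\<^sup>2 * e2 n i / 2)) - (1 - t^2 * e2 n i / 2)\<bar>"
        unfolding of_real_diff[symmetric] norm_of_real by (rule abs_minus_commute)
      also have "\<dots> \<le> (t^2 * e2 n i / 2)\<^sup>2"
        using e2nn[of i] by (intro exp_neg_approx) simp
      also have "\<dots> = t ^ 4 / 4 * (e2 n i * e2 n i)" by (simp add: power2_eq_square power4_eq_xxxx)
      also have "\<dots> \<le> t ^ 4 / 4 * (v n * e2 n i)"
        using ev e2nn[of i] by (intro mult_left_mono mult_right_mono) auto
      finally have B: "norm (complex_of_real (1 - t^2 * e2 n i / 2) - complex_of_real (exp (- (t\<^sup>2
          * e2 n i / 2))))
        \<le> t ^ 4 / 4 * (v n * e2 n i)" .
      have A': "norm (char (distr M borel (\<lambda>\<omega>. \<psi> n i (X \<omega>))) t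
          - complex_of_real (1 - t^2 * e2 n i / 2)) \<le> \<bar>t\<bar> ^ 3 / 6 * e3 n i"
        using A by simp
      show "norm (char (distr M borel (\<lambda>\<omega>. \<psi> n i (X \<omega>))) t
          - complex_of_real (exp (- (t\<^sup>2 * e2 n i / 2))))
         \<le> \<bar>t\<bar> ^ 3 / 6 * e3 n i + t ^ 4 / 4 * (v n * e2 n i)"
        using norm_diff_triangle_le[OF A' B] .
    qed
    also have "\<dots> = err n"
      by (simp add: err_def sum.distrib sum_distrib_left)
    finally show ?case .
  qed
  have "err \<longlonglongrightarrow> \<bar>t\<bar> ^ 3 / 6 * 0 + t ^ 4 / 4 * (0 * s)"
    unfolding err_def using third s v unfolding e3_def[symmetric] e2_def[symmetric]
    by (intro tendsto_intros)
  then have "(\<lambda>n. ?c n - ?w n) \<longlonglongrightarrow> 0"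
    using Lim_null_comparison[OF bound] by simp
  moreover have "?w \<longlonglongrightarrow> complex_of_real (exp (- (t\<^sup>2 * s / 2)))"
    using s unfolding e2_def[symmetric] by (intro tendsto_intros) simp_all
  ultimately show ?thesis
    using tendsto_add[of "\<lambda>n. ?c n - ?w n" 0 sequentially ?w] by simp
qed

end

section \<open>Order statistics and exponential moments\<close>

lemma sorted_nth_le_iff:
  fixes xs :: "real list"
  assumes "sorted xs" "k < length xs"
  shows "xs ! k \<le> a \<longleftrightarrow> k < length (filter (\<lambda>x. x \<le> a) xs)"
  using assms
proof (induction xs arbitrary: k)
  case Nil
  then show ?case by simp
next
  case (Cons x xs)
  show ?case
  proof (cases "x \<le> a")
    case True
    then show ?thesis using Cons by (cases k) auto
  next
    case False
    then have "filter (\<lambda>x. x \<le> a) (x # xs) = []"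
      using Cons.prems(1) by (force simp: filter_empty_conv)
    moreover have "\<not> (x # xs) ! k \<le> a"
    proof (cases k)
      case (Suc j)
      then have "xs ! j \<in> set xs" using Cons.prems(2) by simp
      then show ?thesis using Cons.prems(1) False Suc by fastforce
    qed (use False in simp)
    ultimately show ?thesis by (metis length_0_conv not_less_zero)
  qed
qed

lemma order_stat_le_iff:
  assumes "1 \<le> i" "i \<le> n"
  shows "order_stat i n y \<le> a \<longleftrightarrow> i \<le> card {l\<in>{1..n}. y l \<le> a}"
proof -
  have "length (filter (\<lambda>x. x \<le> a) (sort (map y [1..<Suc n])))
      = length (filter (\<lambda>x. x \<le> a) (map y [1..<Suc n]))"
    by (metis mset_filter mset_sort size_mset)
  also have "\<dots> = card {l\<in>{1..n}. y l \<le> a}"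
    by (simp add: length_filter_map comp_def distinct_length_filter del: upt_Suc)
      (rule arg_cong[of _ _ card], auto)
  finally show ?thesis
    using sorted_nth_le_iff[of "sort (map y [1..<Suc n])" "i - 1" a] assms
    unfolding order_stat_def by auto
qed

text \<open>Trades an order statistic, a complicated functional of the sample, for a sum of
  indicators at a fixed level. The index n - k makes it the (k + 1)-th largest value.\<close>

lemma order_stat_le_iff_exceedances:
  assumes "k < n"
  shows "order_stat (n - k) n y \<le> a \<longleftrightarrow> (\<Sum>i=1..n. of_bool (y i > a)) \<le> real k"
proof -
  have "{1..n} = {l\<in>{1..n}. y l \<le> a} \<union> {l\<in>{1..n}. y l > a}" by auto
  then have "n = card ({l\<in>{1..n}. y l \<le> a} \<union> {l\<in>{1..n}. y l > a})"
    by (metis card_atLeastAtMost diff_Suc_1)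
  also have "\<dots> = card {l\<in>{1..n}. y l \<le> a} + card {l\<in>{1..n}. y l > a}"
    by (rule card_Un_disjoint) auto
  finally have n: "n = card {l\<in>{1..n}. y l \<le> a} + card {l\<in>{1..n}. y l > a}" .
  have s: "(\<Sum>i=1..n. of_bool (y i > a)) = real (card {l\<in>{1..n}. y l > a})"
    by (simp add: sum.If_cases of_bool_def Int_def)
  have "order_stat (n - k) n y \<le> a \<longleftrightarrow> n - k \<le> card {l\<in>{1..n}. y l \<le> a}"
    using assms by (intro order_stat_le_iff) auto
  also have "\<dots> \<longleftrightarrow> card {l\<in>{1..n}. y l > a} \<le> k"
    using n assms by linarith
  finally show ?thesis unfolding s by simp
qed

lemma sum_sort_nth:
  fixes g :: "real \<Rightarrow> real"
  shows "(\<Sum>i=1..n. g (y i)) = (\<Sum>m<n. g (sort (map y [1..<Suc n]) ! m))"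
proof -
  have "(\<Sum>i=1..n. g (y i)) = sum_list (map g (map y [1..<Suc n]))"
    by (simp add: sum_list_distinct_conv_sum_set atLeastLessThanSuc_atLeastAtMost comp_def del: upt_Suc)
  also have "\<dots> = sum_list (map g (sort (map y [1..<Suc n])))"
    by (metis mset_map mset_sort sum_mset_sum_list)
  also have "\<dots> = (\<Sum>m<n. g (sort (map y [1..<Suc n]) ! m))"
    by (simp add: sum_list_sum_nth atLeast0LessThan del: upt_Suc)
  finally show ?thesis .
qed

text \<open>Running over all sorted positions with an indicator makes the sum comparable, term by
  term, with a sum over exceedances rewritten by \<open>sum_sort_nth\<close>. List positions start
  at 0, so the k largest values occupy n - k, ..., n - 1.\<close>

lemma sum_top_order_stat:
  fixes \<phi> :: "real \<Rightarrow> real"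
  assumes "k \<le> n"
  shows "(\<Sum>i=1..k. \<phi> (order_stat (n - i + 1) n y))
    = (\<Sum>m<n. \<phi> (sort (map y [1..<Suc n]) ! m) * of_bool (n - k \<le> m))"
proof -
  let ?s = "sort (map y [1..<Suc n])"
  have "(\<Sum>i=1..k. \<phi> (order_stat (n - i + 1) n y)) = (\<Sum>m\<in>{n-k..<n}. \<phi> (?s ! m))"
    by (rule sum.reindex_bij_witness[of _ "\<lambda>m. n - m" "\<lambda>i. n - i"])
      (use assms in \<open>auto simp: order_stat_def\<close>)
  also have "\<dots> = (\<Sum>m<n. \<phi> (?s ! m) * of_bool (n - k \<le> m))"
    by (rule sum.mono_neutral_cong_left) auto
  finally show ?thesis .
qed

lemma sum_abs_eq_abs_sum:
  fixes f :: "'i \<Rightarrow> real"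
  assumes "(\<forall>m\<in>A. 0 \<le> f m) \<or> (\<forall>m\<in>A. f m \<le> 0)"
  shows "(\<Sum>m\<in>A. \<bar>f m\<bar>) = \<bar>\<Sum>m\<in>A. f m\<bar>"
  using assms
proof
  assume "\<forall>m\<in>A. f m \<le> 0"
  then have "(\<Sum>m\<in>A. \<bar>f m\<bar>) = - (\<Sum>m\<in>A. f m)" "(\<Sum>m\<in>A. f m) \<le> 0"
    by (auto simp: sum_negf[symmetric] intro: sum_nonpos)
  then show ?thesis by simp
qed (auto simp: sum_nonneg)

text \<open>The \<open>k\<close> largest observations and the observations exceeding \<open>\<tau>\<close> are nested sets, so that
  their symmetric difference has \<open>\<bar>D - k\<bar>\<close> elements, all lying between
      \<open>\<tau>\<close> and the order statistic.\<close>
lemma sum_top_vs_exceedances: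
  fixes \<phi> :: "real \<Rightarrow> real" and y :: "nat \<Rightarrow> real"
  assumes kn: "k < n"
  defines "T \<equiv> order_stat (n - k) n y"
  assumes B: "\<And>x. min T \<tau> \<le> x \<Longrightarrow> x
      \<le> max T \<tau> \<Longrightarrow> \<bar>\<phi> x\<bar> \<le> B"
  shows "\<bar>(\<Sum>i=1..k. \<phi> (order_stat (n - i + 1) n y)) - (\<Sum>i=1..n. \<phi> (y i)
      * of_bool (y i > \<tau>))\<bar>
     \<le> \<bar>(\<Sum>i=1..n. of_bool (y i > \<tau>)) - real k\<bar> * B"
proof -
  let ?s = "sort (map y [1..<Suc n])"
  let ?a = "\<lambda>m. of_bool (n - k \<le> m) :: real" and ?b
      = "\<lambda>m. of_bool (?s ! m > \<tau>) :: real"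
  have T: "T = ?s ! (n - k - 1)" by (simp add: T_def order_stat_def)
  have lo: "?s ! m \<le> T" if "m < n - k" for m
    unfolding T using that kn by (intro sorted_nth_mono) auto
  have hi: "T \<le> ?s ! m" if "n - k \<le> m" "m < n" for m
    unfolding T using that kn by (intro sorted_nth_mono) auto
  have k: "real k = (\<Sum>m<n. ?a m)"
    using sum_top_order_stat[of k n "\<lambda>_. 1" y] kn by simp
  have D: "(\<Sum>i=1..n. of_bool (y i > \<tau>)) = (\<Sum>m<n. ?b m)"
    by (rule sum_sort_nth)
  have "(\<Sum>i=1..k. \<phi> (order_stat (n - i + 1) n y)) - (\<Sum>i=1..n. \<phi> (y i)
      * of_bool (y i > \<tau>))
      = (\<Sum>m<n. \<phi> (?s ! m) * (?a m - ?b m))"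
    unfolding sum_top_order_stat[OF less_imp_le[OF kn]] sum_sort_nth[of "\<lambda>x. \<phi> x
        * of_bool (x > \<tau>)" y n]
    by (simp only: sum_subtractf[symmetric] right_diff_distrib)
  then have "\<bar>(\<Sum>i=1..k. \<phi> (order_stat (n - i + 1) n y)) - (\<Sum>i=1..n. \<phi> (y i)
      * of_bool (y i > \<tau>))\<bar>
      \<le> (\<Sum>m<n. \<bar>\<phi> (?s ! m) * (?a m - ?b m)\<bar>)" by (simp only: sum_abs)
  also have "\<dots> \<le> (\<Sum>m<n. B * \<bar>?a m - ?b m\<bar>)"
  proof (rule sum_mono)
    fix m assume m: "m \<in> {..<n}"
    show "\<bar>\<phi> (?s ! m) * (?a m - ?b m)\<bar> \<le> B * \<bar>?a m - ?b m\<bar>"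
    proof (cases "?a m = ?b m")
      case False
      have "min T \<tau> \<le> ?s ! m \<and> ?s ! m \<le> max T \<tau>"
      proof (cases "n - k \<le> m")
        case True
        then have "\<not> ?s ! m > \<tau>" using False by simp
        then show ?thesis using hi[OF True] m by simp
      next
        case F: False
        then have "?s ! m > \<tau>" using False by simp
        then show ?thesis using lo[of m] F by simp
      qed
      then have "\<bar>\<phi> (?s ! m)\<bar> \<le> B" using B by blast
      then show ?thesis unfolding abs_mult by (intro mult_right_mono) auto
    qed simp
  qed
  also have "\<dots> = B * (\<Sum>m<n. \<bar>?a m - ?b m\<bar>)" by (simp add: sum_distrib_left)
  also have "(\<Sum>m<n. \<bar>?a m - ?b m\<bar>) = \<bar>(\<Sum>m<n. ?a m - ?b m)\<bar>"
  proof (rule sum_abs_eq_abs_sum, cases "T \<le> \<tau>")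
    case True
    have "0 \<le> ?a m - ?b m" if "m < n" for m
    proof (cases "n - k \<le> m")
      case False
      then show ?thesis using lo[of m] True by simp
    qed simp
    then show "(\<forall>m\<in>{..<n}. 0 \<le> ?a m - ?b m) \<or> (\<forall>m\<in>{..<n}. ?a m - ?b m
        \<le> 0)"
      unfolding Ball_def lessThan_iff by blast
  next
    case False
    have "?a m - ?b m \<le> 0" if "m < n" for m
    proof (cases "n - k \<le> m")
      case True
      then show ?thesis using hi[of m] False that by simp
    qed simp
    then show "(\<forall>m\<in>{..<n}. 0 \<le> ?a m - ?b m) \<or> (\<forall>m\<in>{..<n}. ?a m - ?b m
        \<le> 0)"
      unfolding Ball_def lessThan_iff by blast
  qed
  also have "\<dots> = \<bar>(\<Sum>i=1..n. of_bool (y i > \<tau>)) - real k\<bar>"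
    unfolding k D by (simp add: sum_subtractf abs_minus_commute)
  finally show ?thesis by (simp add: mult.commute)
qed

text \<open>Memorylessness: above \<open>\<tau>\<close> the density is exp (- \<open>\<tau>\<close>)
  times its own translate by \<open>\<tau>\<close>. Every moment of an excess thereby becomes the
  unconditional moment times the exceedance probability.\<close>

lemma (in prob_space) exponential_tail_shift:
  fixes h :: "real \<Rightarrow> real"
  assumes E: "distributed M lborel E (exponential_density 1)" and "\<tau> \<ge> 0"
    and [measurable]: "h \<in> borel_measurable borel"
        and int: "integrable M (\<lambda>\<omega>. h (E \<omega>))"
  shows "integrable M (\<lambda>\<omega>. h (E \<omega> - \<tau>) * of_bool (E \<omega> > \<tau>))"
    and "expectation (\<lambda>\<omega>. h (E \<omega> - \<tau>) * of_bool (E \<omega> > \<tau>))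
        = exp (- \<tau>) * expectation (\<lambda>\<omega>. h (E \<omega>))"
proof -
  let ?f = "exponential_density 1"
  let ?g = "\<lambda>x. h (x - \<tau>) * of_bool (x > \<tau>)"
  let ?c = "expectation (\<lambda>\<omega>. h (E \<omega>))"
  have f0: "0 \<le> ?f x" for x by (simp add: exponential_density_nonneg)
  have "integrable lborel (\<lambda>x. ?f x * h x)" "(\<integral>x. ?f x * h x \<partial>lborel) = ?c"
    using distributed_integrable[OF E, where g = h] distributed_integral[OF E, where g = h] int f0 by simp_all
  then have "has_bochner_integral lborel (\<lambda>x. ?f x * h x) ?c"
    by (simp add: has_bochner_integral_iff)
  then have "has_bochner_integral lborel (\<lambda>x. ?f (x - \<tau>) * h (x - \<tau>)) ?c"
    using lborel_has_bochner_integral_real_affine_iff[of 1 "\<lambda>x. ?f x * h x" ?c "- \<tau>"] by simp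
  then have "has_bochner_integral lborel (\<lambda>x. exp (- \<tau>) * (?f (x - \<tau>) * h (x
      - \<tau>))) (exp (- \<tau>) * ?c)"
    by (intro has_bochner_integral_mult_right)
  also have "?this \<longleftrightarrow> has_bochner_integral lborel (\<lambda>x. ?f x
      * ?g x) (exp (- \<tau>) * ?c)"
  proof (rule has_bochner_integral_cong_AE)
    \<comment> \<open>The two sides can differ only at x = \<open>\<tau>\<close>, where the density
      is taken at 0 and is positive while the strict exceedance fails.\<close>
    show "AE x in lborel. exp (- \<tau>) * (?f (x - \<tau>) * h (x - \<tau>)) = ?f x * ?g x"
      using AE_lborel_singleton[of \<tau>]
    proof eventually_elim
      case (elim x)
      then show ?case using \<open>\<tau> \<ge> 0\<close>
        by (auto simp: exponential_density_def simp flip: exp_add)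
    qed
  qed measurable
  finally have "integrable lborel (\<lambda>x. ?f x * ?g x)" "(\<integral>x. ?f x * ?g x \<partial>lborel)
      = exp (- \<tau>) * ?c"
    by (simp_all add: has_bochner_integral_iff)
  then show "integrable M (\<lambda>\<omega>. h (E \<omega> - \<tau>) * of_bool (E \<omega> > \<tau>))"
    and "expectation (\<lambda>\<omega>. h (E \<omega> - \<tau>) * of_bool (E \<omega> > \<tau>))
        = exp (- \<tau>) * ?c"
    using distributed_integrable[OF E, where g = ?g] distributed_integral[OF E, where g = ?g] f0 by simp_all
qed

lemma (in prob_space) exponential_power_moment:
  assumes E: "distributed M lborel E (exponential_density 1)"
  shows "integrable M (\<lambda>\<omega>. E \<omega> ^ p)" "expectation (\<lambda>\<omega>. E \<omega> ^ p)
      = fact p"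
  using has_bochner_integral_erlang_ith_moment[OF _ E, of p] by (simp_all add: has_bochner_integral_iff)

text \<open>Exponential tilting: exp (r x) times the standard exponential density is 1 / (1 - r)
  times the exponential density of rate 1 - r, which has total mass one.\<close>

lemma (in prob_space) exponential_exp_moment:
  assumes E: "distributed M lborel E (exponential_density 1)" and "r < 1"
  shows "integrable M (\<lambda>\<omega>. exp (r * E \<omega>))" "expectation (\<lambda>\<omega>. exp (r
      * E \<omega>)) = 1 / (1 - r)"
proof -
  have f0: "0 \<le> exponential_density 1 x" for x by (simp add: exponential_density_nonneg)
  have r: "0 < 1 - r" using \<open>r < 1\<close> by simp
  interpret D: prob_space "density lborel (exponential_density (1 - r))"
    by (rule prob_space_exponential_density[OF r])
  have "has_bochner_integral lborel (exponential_density (1 - r)) 1"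
    using D.emeasure_space_1 exponential_density_nonneg[OF r]
    by (intro has_bochner_integral_nn_integral) (auto simp: emeasure_density)
  then have "has_bochner_integral lborel (\<lambda>x. 1 / (1 - r) * exponential_density (1 - r) x) (1 / (1
      - r) * 1)"
    by (intro has_bochner_integral_mult_right)
  also have "(\<lambda>x. 1 / (1 - r) * exponential_density (1 - r) x)
      = (\<lambda>x. exponential_density 1 x * exp (r * x))"
  proof
    fix x
    have "exp (- x * (1 - r)) = exp (- x) * exp (r * x)" by (simp add: algebra_simps flip: exp_add)
    then show "1 / (1 - r) * exponential_density (1 - r) x = exponential_density 1 x * exp (r * x)"
      using r by (simp add: exponential_density_def)
  qed
  finally show "integrable M (\<lambda>\<omega>. exp (r
      * E \<omega>))" "expectation (\<lambda>\<omega>. exp (r * E \<omega>)) = 1 / (1 - r)"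
    using distributed_integrable[OF E, where g = "\<lambda>x. exp (r * x)"]
      distributed_integral[OF E, where g = "\<lambda>x. exp (r * x)"] f0
    by (simp_all add: has_bochner_integral_iff)
qed

section \<open>Exponential samples above a high level\<close>

text \<open>The derivative of exp at 0 along - x / q. The case x = 0 is separate because the
  difference quotient would have denominator 0.\<close>

lemma exp_difference_quotient:
  fixes x :: real
  assumes "filterlim q at_top F"
  shows "((\<lambda>n. q n * (1 - exp (- (x / q n)))) \<longlongrightarrow> x) F"
proof (cases "x = 0")
  case False
  have q0: "((\<lambda>n. - (x / q n)) \<longlongrightarrow> 0) F"
    using tendsto_minus[OF tendsto_divide_0[OF tendsto_const[of x] filterlim_at_top_imp_at_infinity[OF
        assms]]]
    by simp
  have ev: "\<forall>\<^sub>F n in F. q n > 0" using assms by (simp add: filterlim_at_top_dense)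
  then have "filterlim (\<lambda>n. - (x / q n)) (at 0) F"
    by (intro filterlim_atI[OF q0] eventually_mono[OF ev]) (use False in auto)
  from tendsto_mult[OF tendsto_const[of x] filterlim_compose[OF lim_exp_minus_1 this]]
  have "((\<lambda>n. x * ((exp (- (x / q n)) - 1) / - (x / q n))) \<longlongrightarrow> x) F"
    unfolding mult_1_right .
  moreover have "\<forall>\<^sub>F n in F. x * ((exp (- (x / q n)) - 1) / - (x / q n))
      = q n * (1 - exp (- (x / q n)))"
    by (rule eventually_mono[OF ev]) (use False in \<open>simp add: field_simps\<close>)
  ultimately show ?thesis
    by (rule Lim_transform_eventually)
qed simp

lemma exp_neg_mult_at_top:
  assumes "r < 0" "filterlim g at_top F"
  shows "((\<lambda>n. exp (r * g n)) \<longlongrightarrow> (0::real)) F"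
proof -
  have "filterlim (\<lambda>n. r * g n) at_bot F"
    by (rule filterlim_tendsto_neg_mult_at_bot[OF tendsto_const assms])
  then show ?thesis by (rule filterlim_compose[OF exp_at_bot])
qed

text \<open>Treats one coordinate in isolation: \<open>e\<close> turns an observation into its
  standard exponential score, and \<open>N\<close>, \<open>K\<close> are the size and the effective
  size of that one sample.\<close>

locale exp_tail = iid_sample M X Xs
  for M :: "'a measure" and X :: "'a \<Rightarrow> 'b :: topological_space" and Xs +
  fixes e :: "'b \<Rightarrow> real" and N K :: "nat \<Rightarrow> nat"
  assumes e_measurable[measurable]: "e \<in> borel_measurable borel"
    and e_distr: "distributed M lborel (\<lambda>\<omega>. e (X \<omega>)) (exponential_density 1)"
    and N_top: "filterlim N at_top sequentially"
    and K_top: "filterlim K at_top sequentially"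
    and K_N: "(\<lambda>n. real (K n) / real (N n)) \<longlonglongrightarrow> 0"
begin

text \<open>The level whose expected number of exceedances among \<open>N n\<close> standard
  exponential scores is \<open>K n\<close>.\<close>

definition \<tau> :: "nat \<Rightarrow> real" where "\<tau> n = ln (real (N n) / real (K n))"

text \<open>The (\<open>K n\<close> + 1)-th largest score: the random threshold of the Hill
  estimator on the exponential scale.\<close>

definition T :: "nat \<Rightarrow> 'a \<Rightarrow> real" where
  "T n \<omega> = order_stat (N n - K n) (N n) (\<lambda>i. e (Xs i \<omega>))"

definition exceed :: "nat \<Rightarrow> 'a \<Rightarrow> real \<Rightarrow> real" where
  "exceed n \<omega> y = (\<Sum>i=1..N n. of_bool (e (Xs i \<omega>) > y))"

definition top_sum :: "(real \<Rightarrow> real) \<Rightarrow> nat \<Rightarrow> 'a \<Rightarrow> real" where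
  "top_sum \<phi> n \<omega> = (\<Sum>i=1..K n. \<phi> (order_stat (N n - i
      + 1) (N n) (\<lambda>i. e (Xs i \<omega>))))"

lemma K_real_top: "filterlim (\<lambda>n. real (K n)) at_top sequentially"
  by (rule filterlim_compose[OF filterlim_real_sequentially K_top])

lemma sqrt_K_top: "filterlim (\<lambda>n. sqrt (real (K n))) at_top sequentially"
  by (rule filterlim_compose[OF sqrt_at_top K_real_top])

lemma eventually_K_N: "\<forall>\<^sub>F n in sequentially. 0 < K n \<and> K n < N n"
proof -
  have "\<forall>\<^sub>F n in sequentially. real (K n) / real (N n) < 1"
    by (rule order_tendstoD(2)[OF K_N]) simp
  moreover have "\<forall>\<^sub>F n in sequentially. 0 < K n" "\<forall>\<^sub>F n in sequentially. 0 < N n"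
    using K_top[unfolded filterlim_at_top, rule_format, of 1] N_top[unfolded filterlim_at_top, rule_format,
        of 1]
    by (simp_all add: Suc_le_eq)
  ultimately show ?thesis by eventually_elim simp
qed

lemma \<tau>_top: "filterlim \<tau> at_top sequentially"
proof -
  have "filterlim (\<lambda>n. inverse (real (K n) / real (N n))) at_top sequentially"
    by (rule filterlim_inverse_at_top[OF K_N], rule eventually_mono[OF eventually_K_N]) auto
  then have "filterlim (\<lambda>n. real (N n) / real (K n)) at_top sequentially" by simp
  from filterlim_compose[OF ln_at_top this] show ?thesis by (simp add: \<tau>_def[abs_def])
qed

lemma exp_\<tau>: "\<forall>\<^sub>F n in sequentially. exp (- \<tau> n) = real (K n) / real (N n)"
  by (rule eventually_mono[OF eventually_K_N]) (simp add: \<tau>_def exp_minus)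

lemma \<tau>_pos: "\<forall>\<^sub>F n in sequentially. 0 < \<tau> n"
  by (rule \<tau>_top[unfolded filterlim_at_top_dense, rule_format])

lemma expectation_exceedance:
  assumes "0 \<le> a"
  shows "expectation (\<lambda>\<omega>. of_bool (e (X \<omega>) > a)) = exp (- a)"
  using exponential_tail_shift(2)[OF e_distr assms borel_measurable_const, of 1]
  unfolding mult_1 by (simp only: integrable_const lebesgue_integral_const prob_space real_scaleR_def
      mult_1_right)

lemma integrable_exceedance[simp]: "integrable M (\<lambda>\<omega>. of_bool (e (X \<omega>) > a) :: real)"
  by (rule integrable_const_bound[where B=1]) simp_all

text \<open>Moving the level by x / sqrt K changes the exceedance count by about x sqrt K, with only
  negligible randomness: the scaled mean is sqrt K (1 - exp (- x / sqrt K)), and the scaled second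
  moment is |1 - exp (- x / sqrt K)|, which vanishes.\<close>

lemma exceed_increment:
  "((\<lambda>z. (exceed (fst z) (snd z) (\<tau> (fst z))
      - exceed (fst z) (snd z) (\<tau> (fst z) + x / sqrt (K (fst z))))
          / sqrt (K (fst z))) \<longlongrightarrow> x) in_prob"
proof -
  let ?\<sigma> = "\<lambda>n. \<tau> n + x / sqrt (K n)"
  let ?\<phi> = "\<lambda>n y. (of_bool (e y > \<tau> n) - of_bool (e y > ?\<sigma> n)) / sqrt (K n)"
  have int: "integrable M (\<lambda>\<omega>. (?\<phi> n (X \<omega>))\<^sup>2)" for n
    by (intro integrable_const_bound[where B="(1 / sqrt (K n))\<^sup>2"] AE_I2) (auto simp: of_bool_def
        power_divide)
  have x0: "(\<lambda>n. x / sqrt (K n)) \<longlonglongrightarrow> 0"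
    by (rule tendsto_divide_0[OF tendsto_const filterlim_at_top_imp_at_infinity[OF sqrt_K_top]])
  then have \<sigma>_top: "filterlim ?\<sigma> at_top sequentially"
    using filterlim_tendsto_add_at_top[OF x0 \<tau>_top] by (simp add: add.commute)
  have \<sigma>: "\<forall>\<^sub>F n in sequentially. 0 < ?\<sigma> n" using \<sigma>_top
      by (simp add: filterlim_at_top_dense)
  have mean: "\<forall>\<^sub>F n in sequentially. real (N n)
      * expectation (\<lambda>\<omega>. ?\<phi> n (X \<omega>))
      = sqrt (K n) * (1 - exp (- (x / sqrt (K n))))"
    using \<sigma> \<tau>_pos exp_\<tau> eventually_K_N
  proof eventually_elim
    case (elim n)
    have E: "expectation (\<lambda>\<omega>. ?\<phi> n (X \<omega>))
        = (exp (- \<tau> n) - exp (- ?\<sigma> n)) / sqrt (K n)"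
      using elim by (simp add: expectation_exceedance)
    have X: "exp (- ?\<sigma> n) = exp (- \<tau> n) * exp (- (x / sqrt (K n)))"
      by (simp flip: exp_add)
    have "real (N n) * expectation (\<lambda>\<omega>. ?\<phi> n (X \<omega>))
        = real (N n) * (exp (- \<tau> n) / sqrt (K n) * (1 - exp (- (x / sqrt (K n)))))"
      unfolding E X by (simp add: algebra_simps diff_divide_distrib)
    also have "\<dots> = real (K n) / sqrt (K n) * (1 - exp (- (x / sqrt (K n))))"
      using elim by simp
    also have "real (K n) / sqrt (K n) = sqrt (K n)" by (simp add: real_div_sqrt)
    finally show ?case .
  qed
  have sec: "\<forall>\<^sub>F n in sequentially. real (N n)
      * expectation (\<lambda>\<omega>. (?\<phi> n (X \<omega>))\<^sup>2)
      = \<bar>1 - exp (- (x / sqrt (K n)))\<bar>"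
    using \<sigma> \<tau>_pos exp_\<tau> eventually_K_N
  proof eventually_elim
    case (elim n)
    \<comment> \<open>The two exceedance events are nested, so the square of the difference of
      indicators is that difference up to the sign fixed by x. This makes the second moment linear
      in the tail probabilities.\<close>
    have sgn: "(?\<phi> n y)\<^sup>2 = (if 0 \<le> x then 1 else -1) * (of_bool (e y > \<tau> n)
        - of_bool (e y > ?\<sigma> n)) / K n" for y
    proof (cases "0 \<le> x")
      case True
      then have "e y > ?\<sigma> n \<Longrightarrow> e y > \<tau> n"
          by (smt (verit) divide_nonneg_nonneg real_sqrt_ge_zero of_nat_0_le_iff)
      then show ?thesis using True by (auto simp: of_bool_def power_divide)
    next
      case False
      then have "e y > \<tau> n \<Longrightarrow> e y > ?\<sigma> n"
          by (smt (verit) divide_nonpos_nonneg real_sqrt_ge_zero of_nat_0_le_iff)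
      then show ?thesis using False by (auto simp: of_bool_def power_divide)
    qed
    have E: "expectation (\<lambda>\<omega>. (?\<phi> n (X \<omega>))\<^sup>2)
       = (if 0 \<le> x then 1 else -1) * (exp (- \<tau> n) - exp (- ?\<sigma> n)) / K n"
      unfolding sgn using elim by (simp add: expectation_exceedance)
    have X: "exp (- ?\<sigma> n) = exp (- \<tau> n) * exp (- (x / sqrt (K n)))"
      by (simp flip: exp_add)
    have "real (N n) * expectation (\<lambda>\<omega>. (?\<phi> n (X \<omega>))\<^sup>2)
        = real (N n) * ((if 0 \<le> x then 1 else -1) * exp (- \<tau> n) / K n * (1 - exp (- (x
            / sqrt (K n)))))"
      unfolding E X by (simp add: algebra_simps diff_divide_distrib)
    also have "\<dots> = (if 0 \<le> x then 1 else -1) * (1 - exp (- (x / sqrt (K n))))"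
      using elim by simp
    also have "\<dots> = \<bar>1 - exp (- (x / sqrt (K n)))\<bar>"
    proof (cases "0 \<le> x")
      case True
      then have "exp (- (x / sqrt (K n))) \<le> 1" by simp
      then show ?thesis using True by simp
    next
      case False
      then have "1 \<le> exp (- (x / sqrt (K n)))" by (simp add: divide_nonpos_nonneg)
      then show ?thesis using False by simp
    qed
    finally show ?case .
  qed
  have "((\<lambda>z. \<Sum>i=1..N (fst z). ?\<phi> (fst z) (Xs i (snd z))) \<longlongrightarrow> x) in_prob"
  proof (rule iid_sum_tendsto[OF _ int])
    show "(\<lambda>n. real (N n) * expectation (\<lambda>\<omega>. ?\<phi> n (X \<omega>)))
        \<longlonglongrightarrow> x"
      using exp_difference_quotient[OF sqrt_K_top] eventually_mono[OF mean]
      by (rule Lim_transform_eventually) simp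
    have "(\<lambda>n. \<bar>1 - exp (- (x / sqrt (K n)))\<bar>)
        \<longlonglongrightarrow> \<bar>1 - exp (- 0)\<bar>"
      by (intro tendsto_intros x0)
    then show "(\<lambda>n. real (N n) * expectation (\<lambda>\<omega>. (?\<phi> n (X \<omega>))\<^sup>2))
        \<longlonglongrightarrow> 0"
      unfolding minus_zero exp_zero diff_self abs_zero
      by (rule Lim_transform_eventually) (rule eventually_mono[OF sec], erule sym)
  qed measurable
  then show ?thesis
    by (simp add: exceed_def sum_subtractf sum_divide_distrib diff_divide_distrib del: sum_of_bool_eq)
qed

section \<open>Fluctuation of the exceedance count and of the random threshold\<close>

definition D :: "nat \<Rightarrow> 'a \<Rightarrow> real" where
  "D n \<omega> = (exceed n \<omega> (\<tau> n) - K n) / sqrt (K n)"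

text \<open>For large n the raw second moments of the scaled indicators add up to \<open>N n\<close>
  exp (- \<open>\<tau>\<close> n) / \<open>K n\<close> = 1, which bounds the variance of the count
  uniformly.\<close>

lemma D_tight: "tight_seq D"
proof -
  let ?\<phi> = "\<lambda>n y. of_bool (e y > \<tau> n) / sqrt (K n)"
  have int: "integrable M (\<lambda>\<omega>. (?\<phi> n (X \<omega>))\<^sup>2)" for n
    by (intro integrable_const_bound[where B="(1 / sqrt (K n))\<^sup>2"] AE_I2) (auto simp: of_bool_def
        power_divide)
  have "\<forall>\<^sub>F n in sequentially. real (N n)
      * expectation (\<lambda>\<omega>. (?\<phi> n (X \<omega>))\<^sup>2) \<le> 1"
    using \<tau>_pos exp_\<tau> eventually_K_N
  proof eventually_elim
    case (elim n)
    have "(?\<phi> n y)\<^sup>2 = of_bool (e y > \<tau> n) / K n" for y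
        by (simp add: of_bool_def power_divide)
    then show ?case using elim by (simp add: expectation_exceedance)
  qed
  from iid_sum_tight[OF _ int this]
  have *: "tight_seq (\<lambda>n \<omega>. (\<Sum>i=1..N n. ?\<phi> n (Xs i \<omega>)) - real (N n)
      * expectation (\<lambda>\<omega>. ?\<phi> n (X \<omega>)))"
    by measurable
  show ?thesis
  proof (rule tight_seq_add_tendsto[OF *])
    have "\<forall>\<^sub>F n in sequentially. real (N n)
        * expectation (\<lambda>\<omega>. ?\<phi> n (X \<omega>)) = K n / sqrt (K n)"
      using \<tau>_pos exp_\<tau> eventually_K_N
      by eventually_elim (simp add: expectation_exceedance)
    from eventually_in_prob_sequentially[OF this]
    show "((\<lambda>z. D (fst z) (snd z) - ((\<Sum>i=1..N (fst z). ?\<phi> (fst z) (Xs i (snd z)))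
        - real (N (fst z)) * expectation (\<lambda>\<omega>. ?\<phi> (fst z) (X \<omega>))))
            \<longlongrightarrow> 0) in_prob"
      by (intro tendsto_eventually, elim eventually_mono)
        (simp add: D_def exceed_def diff_divide_distrib sum_divide_distrib del: sum_of_bool_eq)
  qed
qed

lemma T_le_iff:
  assumes "K n < N n"
  shows "T n \<omega> \<le> y \<longleftrightarrow> exceed n \<omega> y \<le> K n"
  unfolding T_def exceed_def by (rule order_stat_le_iff_exceedances[OF assms])

text \<open>Ghosh's argument for the Bahadur representation: compare on a finite grid of thresholds.\<close>
lemma quantile_linearization:
  "((\<lambda>z. sqrt (K (fst z)) * (T (fst z) (snd z) - \<tau> (fst z))
      - D (fst z) (snd z)) \<longlongrightarrow> 0) in_prob"
proof (rule tendstoI)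
  fix \<epsilon> :: real assume "\<epsilon> > 0"
  define \<delta> where "\<delta> = \<epsilon> / 4"
  have \<delta>: "\<delta> > 0" using \<open>\<epsilon> > 0\<close> by (simp add: \<delta>_def)
  let ?Y = "\<lambda>z. sqrt (K (fst z)) * (T (fst z) (snd z) - \<tau> (fst z))"
  show "\<forall>\<^sub>F z in in_prob. dist (?Y z - D (fst z) (snd z)) 0 < \<epsilon>"
  proof (rule eventually_in_prob_tight[OF D_tight])
    fix C :: real assume "C > 0"
    \<comment> \<open>The grid consists of integer multiples of \<open>\<delta>\<close>; the 3
      leaves room for the points i and j chosen below, which lie within two mesh widths of
      D.\<close>
    define J where "J = \<lceil>C / \<delta>\<rceil> + 3"
    let ?I = "\<lambda>z x. (exceed (fst z) (snd z) (\<tau> (fst z))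
      - exceed (fst z) (snd z) (\<tau> (fst z) + x / sqrt (K (fst z)))) / sqrt (K (fst z))"
    have "\<forall>\<^sub>F z in in_prob. \<forall>j\<in>{-J..J}. dist (?I z (of_int j
        * \<delta>)) (of_int j * \<delta>) < \<delta>"
      using \<delta> by (intro eventually_ball_finite ballI tendstoD[OF exceed_increment]) auto
    moreover have "\<forall>\<^sub>F z in in_prob. 0 < K (fst z) \<and> K (fst z) < N (fst z)"
      by (rule eventually_in_prob_sequentially[OF eventually_K_N])
    ultimately show "\<forall>\<^sub>F z in in_prob. \<bar>D (fst z) (snd z)\<bar>
        \<le> C \<longrightarrow> dist (?Y z - D (fst z) (snd z)) 0 < \<epsilon>"
    proof eventually_elim
      case (elim z)
      obtain n \<omega> where z: "z = (n, \<omega>)" by (cases z)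
      have K: "0 < K n" "K n < N n" and sq: "sqrt (K n) > 0" using elim z by auto
      \<comment> \<open>Inversion: a bound on the order statistic becomes a comparison of D with an
        increment of the exceedance count, and on the grid these increments are within
        \<open>\<delta>\<close> of their limit x.\<close>
      have Y_le: "sqrt (K n) * (T n \<omega> - \<tau> n) \<le> x \<longleftrightarrow> D n \<omega>
          \<le> ?I z x" for x
      proof -
        have "sqrt (K n) * (T n \<omega> - \<tau> n) \<le> x \<longleftrightarrow> T n \<omega>
            \<le> \<tau> n + x / sqrt (K n)"
          using sq by (simp add: field_simps)
        also have "\<dots> \<longleftrightarrow> exceed n \<omega> (\<tau> n + x / sqrt (K n)) \<le> K n"
            by (rule T_le_iff[OF K(2)])
        also have "\<dots> \<longleftrightarrow> D n \<omega> \<le> ?I z x"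
          unfolding D_def z fst_conv snd_conv using divide_le_cancel[of _ "sqrt (K n)"] sq
              by (simp add: divide_right_mono)
        finally show ?thesis .
      qed
      show ?case
      proof
        assume "\<bar>D (fst z) (snd z)\<bar> \<le> C"
        then have DC: "\<bar>D n \<omega> / \<delta>\<bar> \<le> C / \<delta>" using \<delta> z
            by (simp add: divide_right_mono abs_divide)
        \<comment> \<open>Grid points at a distance of one to two mesh widths on either side of D.
          The gap of one width absorbs the error of the increments; the bound of two widths gives
          the final error 2 \<open>\<delta>\<close>.\<close>
        define j where "j = \<lceil>D n \<omega> / \<delta>\<rceil> + 1"
        define i where "i = \<lfloor>D n \<omega> / \<delta>\<rfloor> - 1"
        have j1: "D n \<omega> / \<delta> + 1 \<le> of_int j" and j2: "of_int j
            \<le> D n \<omega> / \<delta> + 2" unfolding j_def by linarith+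
        have i1: "of_int i \<le> D n \<omega> / \<delta> - 1" and i2: "D n \<omega> / \<delta> - 2
            \<le> of_int i" unfolding i_def by linarith+
        have J: "C / \<delta> + 3 \<le> of_int J" unfolding J_def by linarith
        have "\<bar>real_of_int j\<bar> \<le> of_int J" "\<bar>real_of_int i\<bar> \<le> of_int J"
            using DC J j1 j2 i1 i2 by linarith+
        then have mem: "j \<in> {-J..J}" "i \<in> {-J..J}" by auto
        have sc: "D n \<omega> / \<delta> * \<delta> = D n \<omega>" using \<delta> by simp
        have j1': "D n \<omega> + \<delta> \<le> of_int j * \<delta>" and j2': "of_int j * \<delta>
            \<le> D n \<omega> + 2 * \<delta>"
          and i1': "of_int i * \<delta> \<le> D n \<omega> - \<delta>" and i2': "D n \<omega> - 2
              * \<delta> \<le> of_int i * \<delta>"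
          using mult_right_mono[OF j1, of \<delta>] mult_right_mono[OF j2, of \<delta>]
            mult_right_mono[OF i1, of \<delta>] mult_right_mono[OF i2, of \<delta>] \<delta> sc
          by (simp_all add: algebra_simps)
        have "\<bar>?I z (of_int j * \<delta>) - of_int j * \<delta>\<bar>
            < \<delta>" "\<bar>?I z (of_int i * \<delta>) - of_int i * \<delta>\<bar> < \<delta>"
          using elim(1) mem unfolding dist_real_def by blast+
        then have "D n \<omega> \<le> ?I z (of_int j * \<delta>)" "\<not> D n \<omega>
            \<le> ?I z (of_int i * \<delta>)"
          using j1' i1' by linarith+
        then have "sqrt (K n) * (T n \<omega> - \<tau> n) \<le> of_int j * \<delta>" "of_int i * \<delta>
            < sqrt (K n) * (T n \<omega> - \<tau> n)"
          using Y_le[of "of_int j * \<delta>"] Y_le[of "of_int i * \<delta>"] by linarith+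
        then have "\<bar>sqrt (K n) * (T n \<omega> - \<tau> n) - D n \<omega>\<bar> \<le> 2 * \<delta>"
          using j2' i2' by linarith
        then show "dist (?Y z - D (fst z) (snd z)) 0 < \<epsilon>"
          using \<open>\<epsilon> > 0\<close> by (simp add: z \<delta>_def dist_real_def)
      qed
    qed
  qed
qed

lemma T_tendsto: "((\<lambda>z. T (fst z) (snd z) - \<tau> (fst z)) \<longlongrightarrow> 0) in_prob"
proof -
  have inv: "(\<lambda>n. 1 / sqrt (K n)) \<longlonglongrightarrow> 0"
    by (rule tendsto_divide_0[OF tendsto_const filterlim_at_top_imp_at_infinity[OF sqrt_K_top]])
  have "((\<lambda>z. 1 / sqrt (K (fst z)) * (sqrt (K (fst z)) * (T (fst z) (snd z) - \<tau> (fst z))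
      - D (fst z) (snd z))
       + 1 / sqrt (K (fst z)) * D (fst z) (snd z)) \<longlongrightarrow> 0 * 0 + 0) in_prob"
    by (intro tendsto_add tendsto_mult tendsto_in_prob_const[OF inv] quantile_linearization
        tendsto_mult_tight[OF D_tight, of "\<lambda>n _. 1 / sqrt (K n)"])
  moreover have "\<forall>\<^sub>F z in in_prob. 1 / sqrt (K (fst z)) * (sqrt (K (fst z))
      * (T (fst z) (snd z) - \<tau> (fst z)) - D (fst z) (snd z))
       + 1 / sqrt (K (fst z)) * D (fst z) (snd z) = T (fst z) (snd z) - \<tau> (fst z)"
    by (rule eventually_mono[OF eventually_in_prob_sequentially[OF eventually_K_N]]) (simp add:
        right_diff_distrib)
  ultimately show ?thesis unfolding mult_zero_left add_0 by (rule Lim_transform_eventually)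
qed

lemma T_top: "filterlim (\<lambda>z. T (fst z) (snd z)) at_top in_prob"
proof -
  have "filterlim (\<lambda>z. \<tau> (fst z)) at_top in_prob"
    by (rule filterlim_compose[OF \<tau>_top filterlim_fst_in_prob])
  from filterlim_tendsto_add_at_top[OF T_tendsto this] show ?thesis by simp
qed

text \<open>Passing from the \<open>K n\<close> largest scores to the exceedances of
  \<open>\<tau>\<close> affects |\<open>exceed\<close> - K| terms, each at most B; after division by
  sqrt K this is |D| B. Since D is tight, B only has to vanish in probability, without a
  rate.\<close>

lemma top_sum_tendsto:
  assumes B: "\<And>z x. min (T (fst z) (snd z)) (\<tau> (fst z)) \<le> x \<Longrightarrow> x
      \<le> max (T (fst z) (snd z)) (\<tau> (fst z))
      \<Longrightarrow> \<bar>\<phi> (fst z) x\<bar> \<le> B (fst z) (snd z)"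
    and B0: "((\<lambda>z. B (fst z) (snd z)) \<longlongrightarrow> 0) in_prob"
  shows "((\<lambda>z. (top_sum (\<phi> (fst z)) (fst z) (snd z)
      - (\<Sum>i=1..N (fst z). \<phi> (fst z) (e (Xs i (snd z)))
          * of_bool (e (Xs i (snd z)) > \<tau> (fst z)))) / sqrt (K (fst z)))
          \<longlongrightarrow> 0) in_prob"
proof (rule Lim_null_comparison)
  have "((\<lambda>z. B (fst z) (snd z) * D (fst z) (snd z)) \<longlongrightarrow> 0) in_prob"
    by (rule tendsto_mult_tight[OF D_tight B0])
  then show "((\<lambda>z. \<bar>B (fst z) (snd z) * D (fst z) (snd z)\<bar>)
      \<longlongrightarrow> 0) in_prob"
    by (rule tendsto_rabs_zero)
  show "\<forall>\<^sub>F z in in_prob. norm ((top_sum (\<phi> (fst z)) (fst z) (snd z)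
      - (\<Sum>i=1..N (fst z). \<phi> (fst z) (e (Xs i (snd z)))
          * of_bool (e (Xs i (snd z)) > \<tau> (fst z)))) / sqrt (K (fst z)))
      \<le> \<bar>B (fst z) (snd z) * D (fst z) (snd z)\<bar>"
    using eventually_in_prob_sequentially[OF eventually_K_N]
  proof eventually_elim
    case (elim z)
    obtain n \<omega> where z: "z = (n, \<omega>)" by (cases z)
    have K: "0 < K n" "K n < N n" using elim z by auto
    have "\<bar>top_sum (\<phi> n) n \<omega> - (\<Sum>i=1..N n. \<phi> n (e (Xs i \<omega>))
        * of_bool (e (Xs i \<omega>) > \<tau> n))\<bar>
        \<le> \<bar>exceed n \<omega> (\<tau> n) - real (K n)\<bar> * B n \<omega>"
      unfolding top_sum_def exceed_def
      by (rule sum_top_vs_exceedances[OF K(2)]) (use B[of z] in \<open>simp add: z T_def\<close>)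
    then have "\<bar>top_sum (\<phi> n) n \<omega> - (\<Sum>i=1..N n. \<phi> n (e (Xs i \<omega>))
        * of_bool (e (Xs i \<omega>) > \<tau> n))\<bar> / sqrt (K n)
        \<le> (\<bar>exceed n \<omega> (\<tau> n) - real (K n)\<bar> * B n \<omega>) / sqrt (K n)"
      by (rule divide_right_mono) simp
    also have "\<dots> \<le> (\<bar>exceed n \<omega> (\<tau> n) - real (K n)\<bar>
        * \<bar>B n \<omega>\<bar>) / sqrt (K n)"
      by (intro divide_right_mono mult_left_mono) auto
    also have "\<dots> = \<bar>B n \<omega> * D n \<omega>\<bar>"
      unfolding D_def abs_mult abs_divide by simp
    finally show ?case by (simp add: z abs_divide)
  qed
qed

text \<open>The excess over the level, centred by the mean 1 that memorylessness gives to an excess.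
  It is therefore centred unconditionally, although it vanishes below the level.\<close>

definition \<zeta> :: "nat \<Rightarrow> 'b \<Rightarrow> real" where
  "\<zeta> n x = (e x - \<tau> n - 1) * of_bool (e x > \<tau> n)"

text \<open>Switching to the exceedances of \<open>\<tau>\<close> costs at most |T -
  \<open>\<tau>\<close>| |D|, which is negligible. After scaling, the subtracted threshold terms K
  (T - \<open>\<tau>\<close>) are D up to a vanishing error, and subtracting D together with the
  final K removes 1 for every exceedance: this is the origin of the centring in
  \<open>\<zeta>\<close>.\<close>

lemma exponential_hill_linearization:
  "((\<lambda>z. (top_sum (\<lambda>x. x) (fst z) (snd z) - K (fst z) * T (fst z) (snd z) - K (fst z))
      / sqrt (K (fst z))
      - (\<Sum>i=1..N (fst z). \<zeta> (fst z) (Xs i (snd z))) / sqrt (K (fst z)))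
          \<longlongrightarrow> 0) in_prob"
proof -
  let ?\<phi> = "\<lambda>n x. x - \<tau> n"
  let ?A = "\<lambda>z. (top_sum (?\<phi> (fst z)) (fst z) (snd z)
      - (\<Sum>i=1..N (fst z). ?\<phi> (fst z) (e (Xs i (snd z)))
          * of_bool (e (Xs i (snd z)) > \<tau> (fst z)))) / sqrt (K (fst z))"
  let ?Q = "\<lambda>z. sqrt (K (fst z)) * (T (fst z) (snd z) - \<tau> (fst z)) - D (fst z) (snd z)"
  have "((\<lambda>z. ?A z) \<longlongrightarrow> 0) in_prob"
    by (rule top_sum_tendsto[where B="\<lambda>n \<omega>. \<bar>T n \<omega> - \<tau> n\<bar>"])
      (auto intro!: tendsto_rabs_zero T_tendsto)
  from tendsto_diff[OF this quantile_linearization]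
  have "((\<lambda>z. ?A z - ?Q z) \<longlongrightarrow> 0) in_prob" by simp
  then show ?thesis
  proof (rule Lim_transform_eventually)
    show "\<forall>\<^sub>F z in in_prob. ?A z - ?Q z
        = (top_sum (\<lambda>x. x) (fst z) (snd z) - K (fst z) * T (fst z) (snd z) - K (fst z))
        / sqrt (K (fst z))
      - (\<Sum>i=1..N (fst z). \<zeta> (fst z) (Xs i (snd z))) / sqrt (K (fst z))"
      using eventually_in_prob_sequentially[OF eventually_K_N]
    proof eventually_elim
      case (elim z)
      obtain n \<omega> where z: "z = (n, \<omega>)" by (cases z)
      define s where "s = sqrt (K n)"
      have s: "s > 0" "real (K n) = s * s" using elim z by (auto simp: s_def)
      have ss: "sqrt (s * s) = s" using s by simp
      have 1: "top_sum (?\<phi> n) n \<omega> = top_sum (\<lambda>x. x) n \<omega> - K n * \<tau> n"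
        by (simp add: top_sum_def sum_subtractf)
      have 2: "(\<Sum>i=1..N n. \<zeta> n (Xs i \<omega>))
          = (\<Sum>i=1..N n. ?\<phi> n (e (Xs i \<omega>)) * of_bool (e (Xs i \<omega>) > \<tau> n))
          - exceed n \<omega> (\<tau> n)"
        by (simp add: \<zeta>_def exceed_def sum_subtractf[symmetric] algebra_simps del: sum_of_bool_eq
            sum_mult_of_bool_eq sum_of_bool_mult_eq)
      have "(a - s * s * t - S) / s - (s * (u - t) - (E - s * s) / s)
          = (a - s * s * u - s * s) / s - (S - E) / s"
        for a t S u E :: real using s(1) by (simp add: field_simps)
      then show ?case
        unfolding z fst_conv snd_conv 1 2 D_def s_def[symmetric] s(2) ss .
    qed
  qed
qed


lemma order_stat_ge_T:
  assumes "K n < N n" "i \<in> {1..K n}"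
  shows "T n \<omega> \<le> order_stat (N n - i + 1) (N n) (\<lambda>i. e (Xs i \<omega>))"
  unfolding T_def order_stat_def by (rule sorted_nth_mono) (use assms in auto)

lemma exp_T_tendsto:
  assumes "(\<lambda>n. sqrt (K n) * exp (r * \<tau> n)) \<longlonglongrightarrow> \<kappa>"
  shows "((\<lambda>z. sqrt (K (fst z)) * exp (r * T (fst z) (snd z)))
      \<longlongrightarrow> \<kappa>) in_prob"
proof -
  have "((\<lambda>z. (sqrt (K (fst z)) * exp (r * \<tau> (fst z))) * exp (r * (T (fst z) (snd z)
      - \<tau> (fst z))))
      \<longlongrightarrow> \<kappa> * exp (r * 0)) in_prob"
    by (intro tendsto_mult tendsto_exp tendsto_const T_tendsto tendsto_in_prob_const[OF assms])
  moreover have "(\<lambda>z. (sqrt (K (fst z)) * exp (r * \<tau> (fst z))) * exp (r * (T (fst z) (snd z)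
      - \<tau> (fst z))))
      = (\<lambda>z. sqrt (K (fst z)) * exp (r * T (fst z) (snd z)))"
  proof
    fix z
    have "exp (r * T (fst z) (snd z)) = exp (r * \<tau> (fst z)) * exp (r * (T (fst z) (snd z)
        - \<tau> (fst z)))"
      by (simp add: algebra_simps flip: exp_add)
    then show "(sqrt (K (fst z)) * exp (r * \<tau> (fst z))) * exp (r * (T (fst z) (snd z) - \<tau> (fst z)))
      = sqrt (K (fst z)) * exp (r * T (fst z) (snd z))" by simp
  qed
  ultimately show ?thesis by simp
qed

text \<open>By memorylessness exp (r E) has conditional mean exp (r \<open>\<tau>\<close>) / (1 - r)
  above \<open>\<tau>\<close>, and about K scores lie there. The scaled second moment is exp (2 r
  \<open>\<tau>\<close>) / (1 - 2 r), so fluctuations disappear.\<close>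

lemma top_sum_exp_tendsto:
  assumes r: "r < 0" and \<kappa>: "(\<lambda>n. sqrt (K n) * exp (r * \<tau> n))
      \<longlonglongrightarrow> \<kappa>"
  shows "((\<lambda>z. top_sum (\<lambda>x. exp (r * x)) (fst z) (snd z)
      / sqrt (K (fst z))) \<longlongrightarrow> \<kappa> / (1 - r)) in_prob"
proof -
  let ?h = "\<lambda>n y. exp (r * e y) * of_bool (e y > \<tau> n) / sqrt (K n)"
  have r1: "r < 1" "2 * r < 1" using r by auto
  have min_top: "filterlim (\<lambda>z. min (T (fst z) (snd z)) (\<tau> (fst z))) at_top in_prob"
    using T_top filterlim_compose[OF \<tau>_top filterlim_fst_in_prob]
    unfolding filterlim_at_top by (auto intro: eventually_conj)
  have 1: "((\<lambda>z. (top_sum (\<lambda>x. exp (r * x)) (fst z) (snd z)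
      - (\<Sum>i=1..N (fst z). exp (r * e (Xs i (snd z))) * of_bool (e (Xs i (snd z)) > \<tau> (fst z))))
          / sqrt (K (fst z))) \<longlongrightarrow> 0) in_prob"
  \<comment> \<open>The function decreases, so between the two thresholds it is largest at the
    smaller one; both thresholds tend to infinity, so this bound tends to 0.\<close>
  proof (rule top_sum_tendsto[where B="\<lambda>n \<omega>. exp (r * min (T n \<omega>) (\<tau> n))"])
    fix z x assume "min (T (fst z) (snd z)) (\<tau> (fst z)) \<le> x"
    then show "\<bar>exp (r * x)\<bar> \<le> exp (r * min (T (fst z) (snd z)) (\<tau> (fst z)))"
      using r by (simp add: mult_left_mono_neg)
  qed (rule exp_neg_mult_at_top[OF r min_top])
  have fac: "?h n y = exp (r * \<tau> n) / sqrt (K n) * (exp (r * (e y - \<tau> n))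
      * of_bool (e y > \<tau> n))" for n y
    by (simp add: algebra_simps flip: exp_add)
  have sq: "(?h n y)\<^sup>2 = exp (2 * r * \<tau> n) / K n * (exp (2 * r * (e y - \<tau> n))
      * of_bool (e y > \<tau> n))" for n y
  proof -
    have "(exp (r * e y))\<^sup>2 = exp (2 * r * \<tau> n) * exp (2 * r * (e y - \<tau> n))"
      by (simp add: algebra_simps power2_eq_square flip: exp_add)
    then show ?thesis by (simp add: power_mult_distrib power_divide of_bool_def)
  qed
  have "((\<lambda>z. \<Sum>i=1..N (fst z). ?h (fst z) (Xs i (snd z)))
      \<longlongrightarrow> \<kappa> / (1 - r)) in_prob"
  proof (rule iid_sum_tendsto)
    show "?h n \<in> borel_measurable borel" for n by measurable
    show "integrable M (\<lambda>\<omega>. (?h n (X \<omega>))\<^sup>2)" for n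
    proof (rule integrable_const_bound[where B="(exp (r * \<tau> n) / sqrt (K n))\<^sup>2"])
      have "\<bar>?h n y\<bar> \<le> \<bar>exp (r * \<tau> n) / sqrt (K n)\<bar>" for y
        using r by (auto simp: of_bool_def intro!: divide_right_mono)
      then show "AE \<omega> in M. norm ((?h n (X \<omega>))\<^sup>2)
          \<le> (exp (r * \<tau> n) / sqrt (K n))\<^sup>2"
        unfolding abs_le_square_iff by simp
    qed measurable
    have "\<forall>\<^sub>F n in sequentially. sqrt (K n) * exp (r * \<tau> n) / (1 - r)
        = real (N n) * expectation (\<lambda>\<omega>. ?h n (X \<omega>))"
      using \<tau>_pos exp_\<tau> eventually_K_N
    proof eventually_elim
      case (elim n)
      have "expectation (\<lambda>\<omega>. ?h n (X \<omega>))
          = exp (r * \<tau> n) / sqrt (K n) * (exp (- \<tau> n) * (1 / (1 - r)))"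
        unfolding fac using exponential_tail_shift(2)[OF e_distr, of "\<tau> n" "\<lambda>y. exp (r * y)"]
          exponential_exp_moment[OF e_distr r1(1)] elim by simp
      then have "real (N n) * expectation (\<lambda>\<omega>. ?h n (X \<omega>))
          = real (K n) / sqrt (K n) * (exp (r * \<tau> n) * (1 / (1 - r)))"
        using elim by simp
      then show ?case by (simp add: real_div_sqrt)
    qed
    moreover have "(\<lambda>n. sqrt (K n) * exp (r * \<tau> n) / (1 - r))
        \<longlonglongrightarrow> \<kappa> / (1 - r)"
      using r by (intro tendsto_divide \<kappa> tendsto_const) auto
    ultimately show "(\<lambda>n. real (N n) * expectation (\<lambda>\<omega>. ?h n (X \<omega>)))
        \<longlonglongrightarrow> \<kappa> / (1 - r)"
      by (rule Lim_transform_eventually[rotated])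
    have "\<forall>\<^sub>F n in sequentially. exp (2 * r * \<tau> n) / (1 - 2 * r)
        = real (N n) * expectation (\<lambda>\<omega>. (?h n (X \<omega>))\<^sup>2)"
      using \<tau>_pos exp_\<tau> eventually_K_N
    proof eventually_elim
      case (elim n)
      have "expectation (\<lambda>\<omega>. (?h n (X \<omega>))\<^sup>2)
          = exp (2 * r * \<tau> n) / K n * (exp (- \<tau> n) * (1 / (1 - 2 * r)))"
        unfolding sq using exponential_tail_shift(2)[OF e_distr, of "\<tau> n" "\<lambda>y. exp (2 * r * y)"]
          exponential_exp_moment[OF e_distr r1(2)] elim by simp
      then show ?case using elim by simp
    qed
    moreover have "(\<lambda>n. exp (2 * r * \<tau> n) / (1 - 2 * r))
        \<longlonglongrightarrow> 0 / (1 - 2 * r)"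
      using r by (intro tendsto_divide exp_neg_mult_at_top \<tau>_top tendsto_const) auto
    ultimately show "(\<lambda>n. real (N n) * expectation (\<lambda>\<omega>. (?h n (X \<omega>))\<^sup>2))
        \<longlonglongrightarrow> 0"
      unfolding div_0 by (rule Lim_transform_eventually[rotated])
  qed
  from tendsto_add[OF 1 this] show ?thesis
    by (simp add: sum_divide_distrib[symmetric] diff_divide_distrib del: sum_mult_of_bool_eq)
qed

text \<open>The constant \<open>L\<close> cancels against the subtracted threshold terms and the
  linear part is the exponential Hill statistic. The exponential part leaves \<open>\<kappa>\<close>
  / (1 - r) from the averaged scores and - \<open>\<kappa>\<close> from the threshold. The
  \<open>\<epsilon>\<close> part is uniformly small because all scores involved are at least T,
  which tends to infinity in probability.\<close>

lemma hill_expansion: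
  fixes f \<epsilon> :: "real \<Rightarrow> real" and r \<kappa> L \<gamma> a :: real
  assumes r: "r < 0" and \<kappa>: "(\<lambda>n. sqrt (K n) * exp (r * \<tau> n))
      \<longlonglongrightarrow> \<kappa>"
    and \<epsilon>: "(\<epsilon> \<longlongrightarrow> 0) at_top"
    and f: "\<forall>\<^sub>F x in at_top. f x = L + \<gamma> * x + exp (r * x) * (a + \<epsilon> x)"
  shows "((\<lambda>z. (top_sum f (fst z) (snd z) - K (fst z) * f (T (fst z) (snd z)) - \<gamma>
      * K (fst z)) / sqrt (K (fst z))
      - \<gamma> * ((\<Sum>i=1..N (fst z). \<zeta> (fst z) (Xs i (snd z)))
          / sqrt (K (fst z)))) \<longlongrightarrow> a * (\<kappa> / (1 - r) - \<kappa>)) in_prob"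
proof -
  let ?lin = "\<lambda>z. (top_sum (\<lambda>x. x) (fst z) (snd z) - K (fst z) * T (fst z) (snd z)
      - K (fst z)) / sqrt (K (fst z))
      - (\<Sum>i=1..N (fst z). \<zeta> (fst z) (Xs i (snd z))) / sqrt (K (fst z))"
  let ?b = "\<lambda>z. top_sum (\<lambda>x. exp (r * x)) (fst z) (snd z) / sqrt (K (fst z))
      - sqrt (K (fst z)) * exp (r * T (fst z) (snd z))"
  let ?tot = "\<lambda>z. (top_sum f (fst z) (snd z) - K (fst z) * f (T (fst z) (snd z)) - \<gamma>
      * K (fst z)) / sqrt (K (fst z))
      - \<gamma> * ((\<Sum>i=1..N (fst z). \<zeta> (fst z) (Xs i (snd z))) / sqrt (K (fst z)))"
  let ?main = "\<lambda>z. \<gamma> * ?lin z + a * ?b z"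
  have main: "(?main \<longlongrightarrow> \<gamma> * 0 + a * (\<kappa> / (1 - r) - \<kappa>)) in_prob"
    by (intro tendsto_add tendsto_mult tendsto_const tendsto_diff exponential_hill_linearization
        top_sum_exp_tendsto[OF r \<kappa>] exp_T_tendsto[OF \<kappa>])
  have rem: "((\<lambda>z. ?tot z - ?main z) \<longlongrightarrow> 0) in_prob"
  proof (rule tendstoI)
    fix \<delta> :: real assume \<delta>: "\<delta> > 0"
    \<comment> \<open>The remainder will be at most 2 \<open>\<eta>\<close> sqrt K exp (r T), and
      sqrt K exp (r T) is eventually below |\<open>\<kappa>\<close>| + 1; this choice leaves
      \<open>\<delta>\<close> / 2.\<close>
    define \<eta> where "\<eta> = \<delta> / (4 * (\<bar>\<kappa>\<bar> + 1))"
    have \<kappa>1: "\<bar>\<kappa>\<bar> + 1 > 0" by linarith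
    have \<eta>: "\<eta> > 0" using \<delta> \<kappa>1 by (simp add: \<eta>_def)
    have \<eta>\<kappa>: "2 * \<eta> * (\<bar>\<kappa>\<bar> + 1) = \<delta> / 2"
      using less_imp_neq[OF \<kappa>1] unfolding \<eta>_def by (simp add: field_simps)
    have "\<forall>\<^sub>F x in at_top. f x = L + \<gamma> * x + exp (r * x) * (a + \<epsilon> x)
        \<and> \<bar>\<epsilon> x\<bar> < \<eta>"
      using f tendstoD[OF \<epsilon> \<eta>] by eventually_elim simp
    then obtain x0 where x0: "\<And>x. x \<ge> x0 \<Longrightarrow> f x
        = L + \<gamma> * x + exp (r * x) * (a + \<epsilon> x) \<and> \<bar>\<epsilon> x\<bar> < \<eta>"
      unfolding eventually_at_top_linorder by blast
    have "\<forall>\<^sub>F z in in_prob. x0 \<le> T (fst z) (snd z)"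
      using T_top unfolding filterlim_at_top by blast
    moreover have "\<forall>\<^sub>F z in in_prob. sqrt (K (fst z)) * exp (r * T (fst z) (snd z))
        < \<bar>\<kappa>\<bar> + 1"
      by (rule order_tendstoD(2)[OF exp_T_tendsto[OF \<kappa>]]) linarith
    ultimately show "\<forall>\<^sub>F z in in_prob. dist (?tot z - ?main z) 0 < \<delta>"
      using eventually_in_prob_sequentially[OF eventually_K_N]
    proof eventually_elim
      case (elim z)
      obtain n \<omega> where z: "z = (n, \<omega>)" by (cases z)
      define s where "s = sqrt (K n)"
      have s: "s > 0" "real (K n) = s * s" using elim z by (auto simp: s_def)
      have K: "K n < N n" using elim z by simp
      let ?o = "\<lambda>i. order_stat (N n - i + 1) (N n) (\<lambda>i. e (Xs i \<omega>))"
      let ?g = "\<lambda>x. exp (r * x) * \<epsilon> x"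
      have oT: "T n \<omega> \<le> ?o i" if "i \<in> {1..K n}" for i by (rule order_stat_ge_T[OF K that])
      have T0: "x0 \<le> T n \<omega>" using elim z by simp
      have g: "\<bar>?g x\<bar> \<le> exp (r * T n \<omega>) * \<eta>" if "x \<ge> T n \<omega>" for x
        unfolding abs_mult using r that T0 x0[of x]
        by (intro mult_mono) (auto simp: mult_left_mono_neg)
      have "top_sum f n \<omega> = (\<Sum>i=1..K n. L + \<gamma> * ?o i + (a * exp (r * ?o i) + ?g (?o i)))"
        unfolding top_sum_def
      proof (rule sum.cong[OF refl])
        fix i assume "i \<in> {1..K n}"
        then have "x0 \<le> ?o i" using oT T0 by force
        then show "f (?o i) = L + \<gamma> * ?o i + (a * exp (r * ?o i) + ?g (?o i))"
          using x0[of "?o i"] by (simp add: algebra_simps)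
      qed
      also have "\<dots> = K n * L + \<gamma> * top_sum (\<lambda>x. x) n \<omega> + a
          * top_sum (\<lambda>x. exp (r * x)) n \<omega> + top_sum ?g n \<omega>"
        by (simp add: top_sum_def sum.distrib sum_distrib_left)
      finally have tf: "top_sum f n \<omega> = \<dots>" .
      have fT: "f (T n \<omega>) = L + \<gamma> * T n \<omega> + (a * exp (r * T n \<omega>)
          + ?g (T n \<omega>))"
        using x0[OF T0] by (simp add: algebra_simps)
      have gen: "(k_total * L + \<gamma> * t1 + a * t2 + t3 - k_total * (L + \<gamma> * u + (a * v + w))
          - \<gamma> * k_total) / s - \<gamma> * Z
          - (\<gamma> * ((t1 - k_total * u - k_total) / s - Z) + a * (t2 / s - s * v))
              = (t3 - k_total * w) / s"
        if "k_total = s * s" for k_total t1 t2 t3 u v w Z :: real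
        unfolding that using s(1) by (simp add: field_simps)
      have eq: "?tot z - ?main z = (top_sum ?g n \<omega> - K n * ?g (T n \<omega>)) / s"
        unfolding z fst_conv snd_conv tf fT s_def[symmetric] by (rule gen[OF s(2)])
      have "\<bar>top_sum ?g n \<omega>\<bar> \<le> (\<Sum>i=1..K n. exp (r * T n \<omega>) * \<eta>)"
        unfolding top_sum_def by (rule order_trans[OF sum_abs]) (intro sum_mono g oT)
      then have "\<bar>top_sum ?g n \<omega>\<bar> \<le> K n * (exp (r * T n \<omega>) * \<eta>)" by simp
      moreover have "\<bar>K n * ?g (T n \<omega>)\<bar> \<le> K n * (exp (r * T n \<omega>) * \<eta>)"
        using g[of "T n \<omega>"] by (simp add: abs_mult mult_left_mono)
      ultimately have "\<bar>top_sum ?g n \<omega> - K n * ?g (T n \<omega>)\<bar>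
          \<le> 2 * (K n * (exp (r * T n \<omega>) * \<eta>))"
        by linarith
      then have "\<bar>?tot z - ?main z\<bar> \<le> 2 * (K n * (exp (r * T n \<omega>) * \<eta>)) / s"
        unfolding eq abs_divide using s(1) by (simp add: divide_right_mono)
      also have "\<dots> = 2 * \<eta> * (s * exp (r * T n \<omega>))" using s by simp
      also have "\<dots> \<le> 2 * \<eta> * (\<bar>\<kappa>\<bar> + 1)"
        using elim(2) \<eta> by (intro mult_left_mono) (auto simp: z s_def)
      also have "\<dots> < \<delta>" unfolding \<eta>\<kappa> using \<delta> by simp
      finally show ?case by (simp only: dist_real_def diff_0_right)
    qed
  qed
  from tendsto_add[OF rem main] show ?thesis by simp
qed

section \<open>Moments and tightness of the centred excesses\<close>

lemma \<zeta>_measurable[measurable]: "\<zeta> n \<in> borel_measurable borel"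
  unfolding \<zeta>_def[abs_def] by measurable

lemma e_moments:
  "integrable M (\<lambda>\<omega>. e (X \<omega>))" "expectation (\<lambda>\<omega>. e (X \<omega>)) = 1"
  "integrable M (\<lambda>\<omega>. (e (X \<omega>))\<^sup>2)" "expectation (\<lambda>\<omega>. (e (X
      \<omega>))\<^sup>2) = 2"
  "integrable M (\<lambda>\<omega>. (e (X \<omega>)) ^ 3)"
  using exponential_power_moment[OF e_distr, of 1] exponential_power_moment[OF e_distr, of 2]
    exponential_power_moment[OF e_distr, of 3] by (simp_all add: fact_2)

lemma e_nonneg: "AE \<omega> in M. 0 \<le> e (X \<omega>)"
proof -
  have "expectation (\<lambda>\<omega>. of_bool (e (X \<omega>) > 0)) = (1::real)"
      using expectation_exceedance[of 0] by simp
  then have "expectation (\<lambda>\<omega>. 1 - of_bool (e (X \<omega>) > 0)) = (0::real)"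
      by (simp add: prob_space del: of_bool_eq)
  moreover have "integrable M (\<lambda>\<omega>. 1 - of_bool (e (X \<omega>) > 0) :: real)" by simp
  ultimately have "AE \<omega> in M. (1 - of_bool (e (X \<omega>) > 0) :: real) = 0"
    by (subst (asm) integral_nonneg_eq_0_iff_AE) auto
  then show ?thesis by eventually_elim (auto split: if_splits simp: of_bool_def)
qed

text \<open>Only its finiteness matters: the same constant serves every level, because
  memorylessness puts the whole dependence on n into the factor exp (- \<open>\<tau>\<close>
  n).\<close>

definition abs_moment3 :: real where "abs_moment3 = expectation (\<lambda>\<omega>. \<bar>e (X \<omega>)
    - 1\<bar> ^ 3)"

lemma integrable_abs_moment3: "integrable M (\<lambda>\<omega>. \<bar>e (X \<omega>) - 1\<bar> ^ 3)"
proof (rule Bochner_Integration.integrable_bound)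
  show "integrable M (\<lambda>\<omega>. (e (X \<omega>)) ^ 3 + 3 * (e (X \<omega>))\<^sup>2 + 3
      * e (X \<omega>) + 1)"
    using e_moments by simp
  show "AE \<omega> in M. norm (\<bar>e (X \<omega>) - 1\<bar> ^ 3)
      \<le> norm ((e (X \<omega>)) ^ 3 + 3 * (e (X \<omega>))\<^sup>2 + 3 * e (X \<omega>) + 1)"
    using e_nonneg
  proof eventually_elim
    case (elim \<omega>)
    have "\<bar>e (X \<omega>) - 1\<bar> ^ 3 \<le> (e (X \<omega>) + 1) ^ 3" using elim
        by (intro power_mono) auto
    also have "\<dots> = (e (X \<omega>)) ^ 3 + 3 * (e (X \<omega>))\<^sup>2 + 3 * e (X \<omega>) + 1"
      by (simp add: power2_eq_square power3_eq_cube algebra_simps)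
    finally show ?case using elim by simp
  qed
qed measurable

lemma \<zeta>_moments:
  assumes "0 \<le> \<tau> n"
  shows "expectation (\<lambda>\<omega>. \<zeta> n (X \<omega>)) = 0"
    and "expectation (\<lambda>\<omega>. (\<zeta> n (X \<omega>))\<^sup>2) = exp (- \<tau> n)"
    and "integrable M (\<lambda>\<omega>. \<bar>\<zeta> n (X \<omega>)\<bar> ^ 3)"
    and "expectation (\<lambda>\<omega>. \<bar>\<zeta> n (X \<omega>)\<bar> ^ 3)
        = exp (- \<tau> n) * abs_moment3"
proof -
  note sh = exponential_tail_shift[OF e_distr assms]
  show "expectation (\<lambda>\<omega>. \<zeta> n (X \<omega>)) = 0"
    using sh(2)[of "\<lambda>y. y - 1"] e_moments by (simp add: \<zeta>_def prob_space)
  have i2: "integrable M (\<lambda>\<omega>. (e (X \<omega>) - 1)\<^sup>2)" using e_moments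
      by (simp add: power2_diff)
  have "expectation (\<lambda>\<omega>. (e (X \<omega>) - 1)\<^sup>2) = 1"
    unfolding power2_diff using e_moments by (simp add: prob_space)
  moreover have "(\<zeta> n y)\<^sup>2 = (e y - \<tau> n - 1)\<^sup>2 * of_bool (e y > \<tau> n)" for y
    by (simp add: \<zeta>_def power_mult_distrib of_bool_def)
  ultimately show "expectation (\<lambda>\<omega>. (\<zeta> n (X \<omega>))\<^sup>2) = exp (- \<tau> n)"
    using sh(2)[of "\<lambda>y. (y - 1)\<^sup>2"] i2 by simp
  have "\<bar>\<zeta> n y\<bar> ^ 3 = \<bar>e y - \<tau> n - 1\<bar> ^ 3 * of_bool (e y > \<tau> n)" for y
    by (simp add: \<zeta>_def of_bool_def)
  then show "integrable M (\<lambda>\<omega>. \<bar>\<zeta> n (X \<omega>)\<bar> ^ 3)"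
    and "expectation (\<lambda>\<omega>. \<bar>\<zeta> n (X \<omega>)\<bar> ^ 3)
        = exp (- \<tau> n) * abs_moment3"
    using sh[of "\<lambda>y. \<bar>y - 1\<bar> ^ 3"] integrable_abs_moment3 by (simp_all add: abs_moment3_def)
qed

lemma integrable_\<zeta>_sq: "integrable M (\<lambda>\<omega>. (\<zeta> n (X \<omega>))\<^sup>2)"
proof (rule Bochner_Integration.integrable_bound)
  show "integrable M (\<lambda>\<omega>. (e (X \<omega>))\<^sup>2 + (\<tau> n + 1)\<^sup>2 - 2
      * e (X \<omega>) * (\<tau> n + 1))"
    using e_moments by simp
  show "AE \<omega> in M. norm ((\<zeta> n (X \<omega>))\<^sup>2)
      \<le> norm ((e (X \<omega>))\<^sup>2 + (\<tau> n + 1)\<^sup>2 - 2 * e (X \<omega>) * (\<tau> n + 1))"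
    unfolding power2_diff[symmetric] by (simp add: \<zeta>_def of_bool_def diff_diff_eq)
qed measurable

lemma integrable_\<zeta>: "integrable M (\<lambda>\<omega>. \<zeta> n (X \<omega>))"
  by (rule square_integrable_imp_integrable[OF _ integrable_\<zeta>_sq]) measurable

lemma \<zeta>_sum_tight: "tight_seq (\<lambda>n \<omega>. (\<Sum>i=1..N n. \<zeta> n (Xs i \<omega>))
    / sqrt (K n))"
proof -
  have "\<forall>\<^sub>F n in sequentially. real (N n)
      * expectation (\<lambda>\<omega>. (\<zeta> n (X \<omega>) / sqrt (K n))\<^sup>2) \<le> 1"
    using \<tau>_pos exp_\<tau> eventually_K_N
    by eventually_elim (simp add: power_divide \<zeta>_moments)
  then have "tight_seq (\<lambda>n \<omega>. (\<Sum>i=1..N n. \<zeta> n (Xs i \<omega>) / sqrt (K n))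
      - real (N n) * expectation (\<lambda>\<omega>. \<zeta> n (X \<omega>) / sqrt (K n)))"
    by (intro iid_sum_tight) (auto simp: power_divide integrable_\<zeta>_sq)
  then show ?thesis
  proof (rule tight_seq_add_tendsto)
    have "\<forall>\<^sub>F n in sequentially. expectation (\<lambda>\<omega>. \<zeta> n (X \<omega>)) = 0"
      using \<tau>_pos by eventually_elim (simp add: \<zeta>_moments)
    from eventually_in_prob_sequentially[OF this]
    show "((\<lambda>z. (\<Sum>i=1..N (fst z). \<zeta> (fst z) (Xs i (snd z))) / sqrt (K (fst z)) -
      ((\<Sum>i=1..N (fst z). \<zeta> (fst z) (Xs i (snd z)) / sqrt (K (fst z)))
        - real (N (fst z)) * expectation (\<lambda>\<omega>. \<zeta> (fst z) (X \<omega>)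
            / sqrt (K (fst z))))) \<longlongrightarrow> 0) in_prob"
      by (intro tendsto_eventually, elim eventually_mono) (simp add: sum_divide_distrib)
  qed
qed

end

section \<open>Second order regular variation\<close>

text \<open>Linearization of the logarithm: the normalized ratio is 1 + A g with g tending to c, and
  the quadratic error (A g)^2 is still negligible after division by A.\<close>

lemma second_order_log_increment:
  fixes U A :: "real \<Rightarrow> real"
  assumes x: "x > 0" and Upos: "\<forall>\<^sub>F t in at_top. U t > 0"
    and A0: "(A \<longlongrightarrow> 0) at_top" and Anz: "\<forall>\<^sub>F t in at_top. A t \<noteq> 0"
    and lim: "((\<lambda>t. 1 / A t * (U (t * x) / U t - x powr \<gamma>))
        \<longlongrightarrow> x powr \<gamma> * c) at_top"
  shows "((\<lambda>t. (ln (U (t * x)) - ln (U t) - \<gamma> * ln x) / A t) \<longlongrightarrow> c) at_top"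
proof -
  define g where "g t = 1 / A t * (U (t * x) / U t - x powr \<gamma>) / x powr \<gamma>" for t
  have xp: "x powr \<gamma> > 0" using x by simp
  have g: "(g \<longlongrightarrow> c) at_top"
    unfolding g_def using tendsto_divide[OF lim tendsto_const[of "x powr \<gamma>"]] xp by simp
  have Ag: "((\<lambda>t. A t * g t) \<longlongrightarrow> 0) at_top" using tendsto_mult[OF A0 g] by simp
  have small: "\<forall>\<^sub>F t in at_top. \<bar>A t * g t\<bar> < 1/2"
    using tendstoD[OF Ag, of "1/2"] by (simp add: dist_real_def)
  have tx: "filterlim (\<lambda>t. t * x) at_top at_top"
    using filterlim_tendsto_pos_mult_at_top[OF tendsto_const x filterlim_ident] by (simp add: mult.commute)
  have Upos': "\<forall>\<^sub>F t in at_top. U (t * x) > 0"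
    using tx Upos unfolding filterlim_iff by blast
  have eq: "\<forall>\<^sub>F t in at_top. \<bar>(ln (U (t * x)) - ln (U t) - \<gamma> * ln x) / A t
      - g t\<bar> \<le> 2 * (\<bar>A t\<bar> * (g t)\<^sup>2)"
    using small Upos Upos' Anz
  proof eventually_elim
    case (elim t)
    have r: "U (t * x) / (U t * x powr \<gamma>) = 1 + A t * g t"
      using elim xp by (simp add: g_def field_simps)
    have "ln (U (t * x)) - ln (U t) - \<gamma> * ln x = ln (U (t * x) / (U t * x powr \<gamma>))"
      using elim xp x by (simp add: ln_div ln_mult ln_powr)
    also have "\<dots> = ln (1 + A t * g t)" by (simp only: r)
    finally have l: "ln (U (t * x)) - ln (U t) - \<gamma> * ln x = ln (1 + A t * g t)" .
    have b: "\<bar>ln (1 + A t * g t) - A t * g t\<bar> \<le> 2 * (A t * g t)\<^sup>2"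
      using elim by (intro abs_ln_one_plus_x_minus_x_bound) auto
    have "\<bar>ln (1 + A t * g t) / A t - g t\<bar>
        = \<bar>ln (1 + A t * g t) - A t * g t\<bar> / \<bar>A t\<bar>"
      using elim by (simp add: diff_divide_distrib flip: abs_divide)
    also have "\<dots> \<le> 2 * (A t * g t)\<^sup>2 / \<bar>A t\<bar>"
      by (intro divide_right_mono b) auto
    also have "\<dots> = 2 * (\<bar>A t\<bar> * (g t)\<^sup>2)"
      using elim(4) by (cases "A t > 0") (simp_all add: power2_eq_square)
    finally show ?case unfolding l .
  qed
  have "((\<lambda>t. 2 * (\<bar>A t\<bar> * (g t)\<^sup>2))
      \<longlongrightarrow> 2 * (\<bar>0\<bar> * c\<^sup>2)) at_top"
    by (intro tendsto_intros A0 g)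
  then have "((\<lambda>t. 2 * (\<bar>A t\<bar> * (g t)\<^sup>2)) \<longlongrightarrow> 0) at_top" by simp
  then have "((\<lambda>t. (ln (U (t * x)) - ln (U t) - \<gamma> * ln x) / A t - g t)
      \<longlongrightarrow> 0) at_top"
    by (rule Lim_null_comparison[rotated]) (use eq in simp)
  from tendsto_add[OF this g] show ?thesis by simp
qed

text \<open>With \<open>p t = ln (U t) - \<gamma> ln t - A t / r\<close> the second order condition reads
  \<open>p (t x) - p t = o(A t)\<close> for each \<open>x\<close>. Since \<open>A\<close> decays
      geometrically along \<open>2\<^sup>n t\<close>,
  summing over dyadic steps gives \<open>p t = L + o(A t)\<close>, without any uniformity in
      \<open>x\<close>.\<close>
lemma second_order_expansion:
  fixes U A :: "real \<Rightarrow> real" and \<gamma> d r :: real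
  assumes \<gamma>: "\<gamma> > 0" and r: "r < 0" and d: "d \<noteq> 0"
    and A: "\<And>t. t > 0 \<Longrightarrow> A t = d * t powr r"
    and mono: "\<And>s t. 1 < s \<Longrightarrow> s \<le> t \<Longrightarrow> U s \<le> U t"
    and lim: "\<And>x. x > 0 \<Longrightarrow> ((\<lambda>t. 1 / A t * (U (t * x) / U t - x powr \<gamma>))
                \<longlongrightarrow> x powr \<gamma> * ((x powr r - 1) / r)) at_top"
  obtains L \<epsilon> where "(\<epsilon> \<longlongrightarrow> 0) at_top"
    "\<forall>\<^sub>F x in at_top. 0 < U (exp x) \<and> ln (U (exp x))
        = L + \<gamma> * x + exp (r * x) * (d / r + \<epsilon> x)"
proof -
  have A0: "(A \<longlongrightarrow> 0) at_top"
  proof -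
    have "((\<lambda>t. d * t powr r) \<longlongrightarrow> d * 0) at_top"
      by (intro tendsto_mult tendsto_const tendsto_neg_powr[OF r] filterlim_ident)
    moreover have "\<forall>\<^sub>F t in at_top. d * t powr r = A t"
      using eventually_gt_at_top[of 0] by eventually_elim (simp add: A)
    ultimately show ?thesis unfolding mult_zero_right by (rule Lim_transform_eventually)
  qed
  have Anz: "A t \<noteq> 0" if "t > 0" for t using that d by (simp add: A)
  have Anz_ev: "\<forall>\<^sub>F t in at_top. A t \<noteq> 0"
    using eventually_gt_at_top[of 0] by eventually_elim (rule Anz)
  \<comment> \<open>Positivity comes from the ratio U(2 t) / U(t), which tends to 2 powr
    \<open>\<gamma>\<close> > 1: if U(t) were negative, a ratio above 1 would force U(2 t) < U(t),
    against monotonicity.\<close>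
  have Upos: "\<forall>\<^sub>F t in at_top. U t > 0"
  proof -
    have "((\<lambda>t. A t * (1 / A t * (U (t * 2) / U t - 2 powr \<gamma>)) + 2 powr \<gamma>)
       \<longlongrightarrow> 0 * (2 powr \<gamma> * ((2 powr r - 1) / r)) + 2 powr \<gamma>) at_top"
      by (intro tendsto_add tendsto_mult A0 lim tendsto_const) simp
    moreover have "1 < 0 * (2 powr \<gamma> * ((2 powr r - 1) / r)) + 2 powr \<gamma>"
      using \<gamma> by simp
    ultimately have "\<forall>\<^sub>F t in at_top. 1
        < A t * (1 / A t * (U (t * 2) / U t - 2 powr \<gamma>)) + 2 powr \<gamma>"
      by (rule order_tendstoD(1))
    then show ?thesis using eventually_gt_at_top[of 1] Anz_ev
    proof eventually_elim
      case (elim t)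
      then have r1: "1 < U (t * 2) / U t" by simp
      have le: "U t \<le> U (t * 2)" using elim by (intro mono) auto
      show ?case
      proof (rule ccontr)
        assume "\<not> 0 < U t"
        then have "U t < 0" using r1 by (cases "U t = 0") auto
        then show False using r1 le by (simp add: less_divide_eq)
      qed
    qed
  qed
  define p where "p t = ln (U t) - \<gamma> * ln t - A t / r" for t
  \<comment> \<open>Subtracting A / r in p removes the second order limit exactly, since A(t x) =
    A(t) x powr r.\<close>
  have incr: "((\<lambda>t. (p (t * x) - p t) / A t) \<longlongrightarrow> 0) at_top" if x: "x > 0" for x
  proof -
    let ?c = "(x powr r - 1) / r"
    have "((\<lambda>t. (ln (U (t * x)) - ln (U t) - \<gamma> * ln x) / A t - ?c)
        \<longlongrightarrow> ?c - ?c) at_top"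
      by (intro tendsto_diff tendsto_const second_order_log_increment[OF x Upos A0 Anz_ev lim[OF x]])
    moreover have "\<forall>\<^sub>F t in at_top. (ln (U (t * x)) - ln (U t) - \<gamma> * ln x) / A t - ?c
        = (p (t * x) - p t) / A t"
      using eventually_gt_at_top[of 0]
    proof eventually_elim
      case (elim t)
      have At: "A (t * x) = A t * x powr r" using elim x by (simp add: A powr_mult)
      have l: "ln (t * x) = ln t + ln x" using elim x by (simp add: ln_mult)
      show ?case unfolding p_def At l using Anz[OF elim] r by (simp add: field_simps)
    qed
    ultimately show ?thesis unfolding diff_self by (rule Lim_transform_eventually)
  qed
  \<comment> \<open>The factor by which A shrinks when its argument doubles; r < 0 makes it less
    than 1, so dyadic increments are summable.\<close>
  define q where "q = (2::real) powr r"
  have q: "0 < q" "q < 1" using r by (auto simp: q_def powr_less_one)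
  have A_pow: "A (2 ^ i * t) = A t * q ^ i" if "t > 0" for t i
  proof -
    have "((2::real) ^ i) powr r = (2 powr real i) powr r" by (simp add: powr_realpow)
    also have "\<dots> = (2 powr r) powr real i" by (simp add: powr_powr mult.commute)
    also have "\<dots> = q ^ i" using q by (simp add: q_def powr_realpow)
    finally have "((2::real) ^ i) powr r = q ^ i" .
    then show ?thesis using that by (simp add: A powr_mult)
  qed
  have step: "\<exists>t0>0. \<forall>t\<ge>t0. \<bar>p (2 * t) - p t\<bar>
      \<le> \<eta> * \<bar>A t\<bar>" if \<eta>: "\<eta> > 0" for \<eta>
  proof -
    have "\<forall>\<^sub>F t in at_top. dist ((p (t * 2) - p t) / A t) 0 < \<eta>"
      by (rule tendstoD[OF incr \<eta>]) simp
    then have "\<forall>\<^sub>F t in at_top. \<bar>p (2 * t) - p t\<bar>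
        \<le> \<eta> * \<bar>A t\<bar> \<and> t > 0"
      using Anz_ev eventually_gt_at_top[of 0]
    proof eventually_elim
      case (elim t)
      then have "\<bar>p (2 * t) - p t\<bar> / \<bar>A t\<bar> < \<eta>"
          by (simp add: dist_real_def abs_divide mult.commute)
      then show ?case using elim by (simp add: divide_less_eq)
    qed
    then obtain t1 where t1: "\<And>t. t \<ge> t1 \<Longrightarrow> \<bar>p (2 * t) - p t\<bar>
        \<le> \<eta> * \<bar>A t\<bar> \<and> t > 0"
      unfolding eventually_at_top_linorder by blast
    show ?thesis by (rule exI[of _ "max t1 1"]) (use t1 in auto)
  qed
  have dyadic: "\<bar>p (2 ^ Suc i * t) - p (2 ^ i * t)\<bar> \<le> \<eta> * \<bar>A t\<bar> * q ^ i"
    if t0: "t0 > 0" "\<forall>t\<ge>t0. \<bar>p (2 * t) - p t\<bar>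
        \<le> \<eta> * \<bar>A t\<bar>" "t \<ge> t0" for t0 \<eta> t i
  proof -
    have tp: "t > 0" using t0 by linarith
    have "1 * t \<le> 2 ^ i * t" using tp by (intro mult_right_mono) auto
    then have "2 ^ i * t \<ge> t0" using t0(3) by linarith
    then have "\<bar>p (2 * (2 ^ i * t)) - p (2 ^ i * t)\<bar>
        \<le> \<eta> * \<bar>A (2 ^ i * t)\<bar>" using t0(2) by blast
    then show ?thesis using A_pow[OF tp, of i] q by (simp add: mult.assoc abs_mult)
  qed
  \<comment> \<open>The parameter \<open>\<eta>\<close> is kept free: the value 1 yields existence
    of the limit, and arbitrarily small values yield the rate o(A).\<close>
  have conv: "convergent (\<lambda>n. p (2 ^ n * t)) \<and> \<bar>lim (\<lambda>n. p (2 ^ n * t))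
      - p t\<bar> \<le> \<eta> * \<bar>A t\<bar> * (1 / (1 - q))"
    if t0: "t0 > 0" "\<forall>t\<ge>t0. \<bar>p (2 * t) - p t\<bar>
        \<le> \<eta> * \<bar>A t\<bar>" "t \<ge> t0" for t0 \<eta> t
  proof -
    let ?D = "\<lambda>i. p (2 ^ Suc i * t) - p (2 ^ i * t)"
    have geo: "(\<lambda>i. \<eta> * \<bar>A t\<bar> * q ^ i) sums (\<eta> * \<bar>A t\<bar> * (1 / (1 - q)))"
      using q by (intro sums_mult geometric_sums) auto
    have b: "norm (?D i) \<le> \<eta> * \<bar>A t\<bar> * q ^ i" for i
      using dyadic[OF t0, of i] by simp
    have sD: "summable (\<lambda>i. norm (?D i))"
      by (rule summable_comparison_test'[OF sums_summable[OF geo], of 0]) (use b in auto)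
    have part: "(\<Sum>i<n. ?D i) = p (2 ^ n * t) - p t" for n
      using sum_lessThan_telescope[of "\<lambda>i. p (2 ^ i * t)" n] by simp
    have "(\<lambda>n. \<Sum>i<n. ?D i) \<longlonglongrightarrow> suminf ?D"
      by (rule summable_LIMSEQ[OF summable_norm_cancel[OF sD]])
    then have "(\<lambda>n. p (2 ^ n * t) - p t + p t) \<longlonglongrightarrow> suminf ?D + p t"
      unfolding part by (intro tendsto_add tendsto_const)
    then have l: "(\<lambda>n. p (2 ^ n * t)) \<longlonglongrightarrow> suminf ?D + p t" by simp
    have "\<bar>suminf ?D\<bar> \<le> (\<Sum>i. norm (?D i))"
      using summable_norm[OF sD] by simp
    also have "\<dots> \<le> \<eta> * \<bar>A t\<bar> * (1 / (1 - q))"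
      unfolding sums_unique[OF geo] by (rule suminf_le[OF b sD sums_summable[OF geo]])
    finally show ?thesis using l limI[OF l] by (auto simp: convergent_def)
  qed
  obtain t0 where t0: "t0 > 0" "\<forall>t\<ge>t0. \<bar>p (2 * t) - p t\<bar>
      \<le> 1 * \<bar>A t\<bar>" using step[of 1] by auto
  define l where "l t = lim (\<lambda>n. p (2 ^ n * t))" for t
  have l: "(\<lambda>n. p (2 ^ n * t)) \<longlonglongrightarrow> l t" if "t \<ge> t0" for t
    unfolding l_def using conv[OF t0 that] by (simp add: convergent_LIMSEQ_iff)
  \<comment> \<open>The dyadic limit could still depend on the starting point. The increment
    condition with x = t / t0, used along 2^n t0, shows that it does not.\<close>
  have const: "l t = l t0" if t: "t \<ge> t0" for t
  proof -
    define x where "x = t / t0"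
    have x: "x > 0" "t0 * x = t" using t0(1) t by (auto simp: x_def)
    have pow: "filterlim (\<lambda>n. 2 ^ n * t0 :: real) at_top sequentially"
      by (rule filterlim_at_top_mult_tendsto_pos[OF tendsto_const t0(1)
            filterlim_at_infinity_imp_filterlim_at_top[OF filterlim_realpow_sequentially_gt1]]) auto
    have "(\<lambda>n. (p (2 ^ n * t0 * x) - p (2 ^ n * t0)) / A (2 ^ n * t0) * A (2 ^ n
        * t0)) \<longlonglongrightarrow> 0 * 0"
      by (intro tendsto_mult filterlim_compose[OF incr[OF x(1)] pow] filterlim_compose[OF A0 pow])
    moreover have "A (2 ^ n * t0) \<noteq> 0" for n using t0(1) by (intro Anz) simp
    ultimately have "(\<lambda>n. p (2 ^ n * t) - p (2 ^ n * t0)) \<longlonglongrightarrow> 0"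
      by (simp add: mult.assoc x(2))
    moreover have "(\<lambda>n. p (2 ^ n * t) - p (2 ^ n * t0)) \<longlonglongrightarrow> l t - l t0"
      by (intro tendsto_diff l t) simp
    ultimately show ?thesis using LIMSEQ_unique by fastforce
  qed
  define \<epsilon> where "\<epsilon> x = (p (exp x) - l t0) / exp (r * x)" for x
  have "(\<epsilon> \<longlongrightarrow> 0) at_top"
  proof (rule tendstoI)
    fix \<eta> :: real assume \<eta>: "\<eta> > 0"
    \<comment> \<open>Cancels the geometric factor 1 / (1 - q) and the constant |d| of A, leaving
      \<open>\<eta>\<close> / 2.\<close>
    define \<eta>' where "\<eta>' = \<eta> * (1 - q) / (2 * \<bar>d\<bar>)"
    have \<eta>': "\<eta>' > 0" using \<eta> q d by (simp add: \<eta>'_def)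
    obtain t1 where t1: "t1 > 0" "\<forall>t\<ge>t1. \<bar>p (2 * t) - p t\<bar>
        \<le> \<eta>' * \<bar>A t\<bar>" using step[OF \<eta>'] by auto
    have "\<forall>\<^sub>F x in at_top. max t0 t1 \<le> exp x"
      using exp_at_top unfolding filterlim_at_top by blast
    then show "\<forall>\<^sub>F x in at_top. dist (\<epsilon> x) 0 < \<eta>"
    proof eventually_elim
      case (elim x)
      have e0: "exp x \<ge> t0" "exp x \<ge> t1" using elim by auto
      have ex: "exp x powr r = exp (r * x)" by (simp add: powr_def)
      have "\<bar>l (exp x) - p (exp x)\<bar> \<le> \<eta>' * \<bar>A (exp x)\<bar> * (1 / (1 - q))"
        using conv[OF t1 e0(2)] unfolding l_def by blast
      also have "\<bar>A (exp x)\<bar> = \<bar>d\<bar> * exp (r * x)" by (simp add: A abs_mult ex)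
      also have "\<eta>' * (\<bar>d\<bar> * exp (r * x)) * (1 / (1 - q)) = \<eta> / 2 * exp (r * x)"
        unfolding \<eta>'_def using d q by (simp add: field_simps)
      finally have "\<bar>p (exp x) - l t0\<bar> \<le> \<eta> / 2 * exp (r * x)" unfolding const[OF e0(1)]
          by (simp add: abs_minus_commute)
      then have "\<bar>\<epsilon> x\<bar> \<le> \<eta> / 2"
          by (simp add: \<epsilon>_def abs_divide divide_le_eq)
      then show ?case using \<eta> by (simp add: dist_real_def)
    qed
  qed
  moreover have "\<forall>\<^sub>F x in at_top. 0 < U (exp x) \<and> ln (U (exp x))
      = l t0 + \<gamma> * x + exp (r * x) * (d / r + \<epsilon> x)"
  proof -
    have "\<forall>\<^sub>F x in at_top. 0 < U (exp x)" using exp_at_top Upos unfolding filterlim_iff by blast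
    then show ?thesis
    proof eventually_elim
      case (elim x)
      have ex: "exp x powr r = exp (r * x)" by (simp add: powr_def)
      have "exp (r * x) * \<epsilon> x = p (exp x) - l t0" by (simp add: \<epsilon>_def)
      then show ?case using elim by (simp add: p_def A ex distrib_left)
    qed
  qed
  ultimately show ?thesis by (rule that)
qed

section \<open>Order statistics under monotone maps\<close>

lemma sort_map_mono_on:
  fixes h :: "real \<Rightarrow> real"
  assumes "mono_on (set xs) h"
  shows "sort (map h xs) = map h (sort xs)"
proof (rule properties_for_sort)
  show "sorted (map h (sort xs))"
    unfolding sorted_map by (rule sorted_wrt_mono_rel[of _ "(\<le>)"]) (use assms in \<open>auto simp:
        mono_on_def\<close>)
qed (simp add: mset_map)

text \<open>Stated relative to a set S because the tail quantile function is known to be monotone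
  only for arguments above 1, that is, on positive scores.\<close>

lemma order_stat_map_mono_on:
  fixes h :: "real \<Rightarrow> real"
  assumes "mono_on S h" "\<And>i. i \<in> {1..n} \<Longrightarrow> y i \<in> S" "\<And>i. i \<in> {1..n}
      \<Longrightarrow> x i = h (y i)"
    and "1 \<le> i" "i \<le> n"
  shows "order_stat i n x = h (order_stat i n y)"
proof -
  have eq: "map x [1..<Suc n] = map h (map y [1..<Suc n])"
    unfolding map_map comp_def by (rule map_cong) (use assms(3) in auto)
  have "set (map y [1..<Suc n]) \<subseteq> S" using assms(2) by auto
  then have "mono_on (set (map y [1..<Suc n])) h" using assms(1) by (rule mono_on_subset[rotated])
  from sort_map_mono_on[OF this]
  show "order_stat i n x = h (order_stat i n y)"
    unfolding order_stat_def eq using assms(4,5) by (simp del: upt_Suc map_map)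
qed

section \<open>Marginal tails\<close>

lemma measurable_vec_nth[measurable (raw)]:
  fixes f :: "'a \<Rightarrow> real^'m"
  assumes "f \<in> borel_measurable M"
  shows "(\<lambda>x. f x $ j) \<in> borel_measurable M"
  by (rule measurable_compose[OF assms])
    (intro borel_measurable_continuous_onI continuous_on_component continuous_on_id)

locale continuous_marginal = prob_space M for M :: "'a measure" +
  fixes X :: "'a \<Rightarrow> real^'m" and j :: 'm
  assumes X_meas[measurable]: "X \<in> borel_measurable M"
    and cdf_cont: "continuous_on UNIV (marg_cdf M X j)"
begin

abbreviation "S \<equiv> marg_surv M X j"

interpretation D: real_distribution "distr M borel (\<lambda>\<omega>. X \<omega> $ j)"
  by (rule real_distribution_distr) measurable

lemma S_eq_prob: "S x = prob {\<omega>\<in>space M. x < X \<omega> $ j}"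
proof -
  have "marg_cdf M X j x = prob {\<omega>\<in>space M. X \<omega> $ j \<le> x}"
    by (auto simp: marg_cdf_def cdf_def measure_distr intro!: arg_cong[of _ _ prob])
  moreover have "prob {\<omega>\<in>space M. \<not> X \<omega> $ j \<le> x}
      = 1 - prob {\<omega>\<in>space M. X \<omega> $ j \<le> x}"
    by (rule prob_neg) measurable
  ultimately show ?thesis by (simp add: marg_surv_def not_le)
qed

lemma S_cont: "continuous_on UNIV S"
  unfolding marg_surv_def[abs_def] by (intro continuous_intros cdf_cont)

lemma S_measurable[measurable]: "S \<in> borel_measurable borel"
  by (rule borel_measurable_continuous_onI[OF S_cont])

lemma S_antimono: "x \<le> y \<Longrightarrow> S y \<le> S x"
  unfolding S_eq_prob by (rule finite_measure_mono) auto

lemma S_bounds: "0 \<le> S x" "S x \<le> 1"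
  unfolding S_eq_prob by auto

lemma S_at_top: "(S \<longlongrightarrow> 0) at_top"
  using tendsto_diff[OF tendsto_const[of 1] D.cdf_lim_at_top_prob]
  by (simp add: marg_surv_def[abs_def] marg_cdf_def[abs_def])

lemma S_at_bot: "(S \<longlongrightarrow> 1) at_bot"
  using tendsto_diff[OF tendsto_const[of 1] D.cdf_lim_at_bot]
  by (simp add: marg_surv_def[abs_def] marg_cdf_def[abs_def])

lemma S_le_ex: "0 < u \<Longrightarrow> \<exists>x. S x < u"
  using order_tendstoD(2)[OF S_at_top, of u] by (metis eventually_at_top_linorder order_refl)

lemma S_ge_ex: "u < 1 \<Longrightarrow> \<exists>x. u < S x"
  using order_tendstoD(1)[OF S_at_bot, of u] by (metis eventually_at_bot_linorder order_refl)

lemma S_surj: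
  assumes "0 < u" "u < 1"
  shows "\<exists>x. S x = u"
proof -
  obtain a b where ab: "S a < u" "u < S b" using S_le_ex[OF assms(1)] S_ge_ex[OF assms(2)] by blast
  then have "b \<le> a" using S_antimono[of a b] by linarith
  then show ?thesis
    using IVT2'[of S a u b] ab continuous_on_subset[OF S_cont] by fastforce
qed

text \<open>The tail function may be flat at the level u. For a point x with S x = u one only has
  that S (X) < u implies X > x, and that X > x implies S (X) \<le> u; each inclusion gives one
  inequality, and letting the level vary closes the gap afterwards.\<close>

lemma prob_S_less_aux:
  assumes "0 < u" "u < 1"
  shows "prob {\<omega>\<in>space M. S (X \<omega> $ j) < u} \<le> u" "u
      \<le> prob {\<omega>\<in>space M. S (X \<omega> $ j) \<le> u}"
proof -
  obtain x where x: "S x = u" using S_surj[OF assms] by blast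
  have "prob {\<omega>\<in>space M. S (X \<omega> $ j) < u} \<le> S x"
    unfolding S_eq_prob[of x]
    by (rule finite_measure_mono) (use S_antimono x in \<open>force simp: not_le[symmetric]\<close>,
        measurable)
  then show "prob {\<omega>\<in>space M. S (X \<omega> $ j) < u} \<le> u" by (simp add: x)
  have "S x \<le> prob {\<omega>\<in>space M. S (X \<omega> $ j) \<le> u}"
    unfolding S_eq_prob[of x]
    by (rule finite_measure_mono) (use S_antimono x in force, measurable)
  then show "u \<le> prob {\<omega>\<in>space M. S (X \<omega> $ j) \<le> u}" by (simp add: x)
qed

lemma prob_S_le:
  assumes "0 < u" "u < 1"
  shows "prob {\<omega>\<in>space M. S (X \<omega> $ j) \<le> u} = u"
proof (rule antisym)
  show "prob {\<omega>\<in>space M. S (X \<omega> $ j) \<le> u} \<le> u"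
  proof (rule dense_ge_bounded[OF assms(2)])
    fix v assume v: "u < v" "v < 1"
    have "prob {\<omega>\<in>space M. S (X \<omega> $ j) \<le> u}
        \<le> prob {\<omega>\<in>space M. S (X \<omega> $ j) < v}"
      by (rule finite_measure_mono) (use v in auto)
    also have "\<dots> \<le> v" using prob_S_less_aux(1)[of v] v assms by simp
    finally show "prob {\<omega>\<in>space M. S (X \<omega> $ j) \<le> u} \<le> v" .
  qed
qed (rule prob_S_less_aux(2)[OF assms])

lemma prob_S_less:
  assumes "0 < u" "u \<le> 1"
  shows "prob {\<omega>\<in>space M. S (X \<omega> $ j) < u} = u"
proof (rule antisym)
  show "prob {\<omega>\<in>space M. S (X \<omega> $ j) < u} \<le> u"
    using prob_S_less_aux(1)[of u] assms by (cases "u = 1") auto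
  show "u \<le> prob {\<omega>\<in>space M. S (X \<omega> $ j) < u}"
  proof (rule dense_le_bounded[OF assms(1)])
    fix v assume v: "0 < v" "v < u"
    then have "v = prob {\<omega>\<in>space M. S (X \<omega> $ j) \<le> v}" using prob_S_le[of v] assms
        by simp
    also have "\<dots> \<le> prob {\<omega>\<in>space M. S (X \<omega> $ j) < u}"
      by (rule finite_measure_mono) (use v in auto)
    finally show "v \<le> prob {\<omega>\<in>space M. S (X \<omega> $ j) < u}" .
  qed
qed

lemma prob_S_eq_0: "prob {\<omega>\<in>space M. S (X \<omega> $ j) \<le> 0} = 0"
proof (rule antisym)
  show "prob {\<omega>\<in>space M. S (X \<omega> $ j) \<le> 0} \<le> 0"
  proof (rule dense_ge_bounded[of 0 1])
    fix v :: real assume v: "0 < v" "v < 1"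
    have "prob {\<omega>\<in>space M. S (X \<omega> $ j) \<le> 0}
        \<le> prob {\<omega>\<in>space M. S (X \<omega> $ j) < v}"
      by (rule finite_measure_mono) (use v in auto)
    then show "prob {\<omega>\<in>space M. S (X \<omega> $ j) \<le> 0} \<le> v" using prob_S_less[of v] v
        by simp
  qed simp
qed simp

lemma AE_S_neq:
  assumes "0 < u" "u < 1"
  shows "AE \<omega> in M. S (X \<omega> $ j) \<noteq> u"
proof -
  have "{\<omega>\<in>space M. S (X \<omega> $ j) = u} = {\<omega>\<in>space M. S (X \<omega> $ j)
      \<le> u} - {\<omega>\<in>space M. S (X \<omega> $ j) < u}" by auto
  also have "prob \<dots> = prob {\<omega>\<in>space M. S (X \<omega> $ j)
      \<le> u} - prob {\<omega>\<in>space M. S (X \<omega> $ j) < u}"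
  proof (rule finite_measure_Diff)
    show "{\<omega>\<in>space M. S (X \<omega> $ j)
        < u} \<subseteq> {\<omega>\<in>space M. S (X \<omega> $ j) \<le> u}" by auto
  qed measurable
  finally have "prob {\<omega>\<in>space M. S (X \<omega> $ j) = u}
      = prob {\<omega>\<in>space M. S (X \<omega> $ j)
      \<le> u} - prob {\<omega>\<in>space M. S (X \<omega> $ j) < u}" .
  then have "prob {\<omega>\<in>space M. S (X \<omega> $ j) = u} = 0"
      using prob_S_le[OF assms] prob_S_less[of u] assms by simp
  then show ?thesis by (subst (asm) prob_eq_0) auto
qed

lemma AE_S_bounds: "AE \<omega> in M. 0 < S (X \<omega> $ j) \<and> S (X \<omega> $ j) < 1"
proof -
  have "AE \<omega> in M. \<not> S (X \<omega> $ j) \<le> 0" using prob_S_eq_0 by (subst (asm) prob_eq_0) auto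
  moreover have "AE \<omega> in M. S (X \<omega> $ j) < 1"
    using AE_prob_1[of "{\<omega>\<in>space M. S (X \<omega> $ j) < 1}"] prob_S_less[of 1] by simp
  ultimately show ?thesis by eventually_elim simp
qed

text \<open>Removes the extended reals: where S x = 0 the quotient is infinite, and both conditions
  hold.\<close>

lemma quantile_set:
  assumes "0 < t"
  shows "{x. 1 / ereal (S x) \<ge> ereal t} = {x. S x \<le> 1 / t}"
proof -
  have "1 / ereal s \<ge> ereal t \<longleftrightarrow> s \<le> 1 / t" if "0 \<le> s" for s
    using that assms by (cases "s = 0") (auto simp: divide_ereal_def field_simps one_ereal_def)
  then show ?thesis using S_bounds by auto
qed

text \<open>For 0 < t \<le> 1 the set is the whole line and its infimum carries no information; this
  is why quantiles are used only above 1.\<close>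

lemma quantile_set_bdd:
  assumes "1 < t"
  shows "{x. S x \<le> 1 / t} \<noteq> {}" "bdd_below {x. S x \<le> 1 / t}"
proof -
  obtain b where "S b < 1 / t" using S_le_ex[of "1 / t"] assms by auto
  then have "b \<in> {x. S x \<le> 1 / t}" by simp
  then show "{x. S x \<le> 1 / t} \<noteq> {}" by blast
  obtain a where a: "1 / t < S a" using S_ge_ex[of "1 / t"] assms by auto
  show "bdd_below {x. S x \<le> 1 / t}"
  proof (rule bdd_belowI)
    fix x assume "x \<in> {x. S x \<le> 1 / t}"
    then show "a \<le> x" using S_antimono[of x a] a by (cases "a \<le> x") auto
  qed
qed

lemma tail_quantile_mono:
  assumes "1 < s" "s \<le> t"
  shows "tail_quantile M X j s \<le> tail_quantile M X j t"
proof -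
  have "{x. S x \<le> 1 / t} \<subseteq> {x. S x \<le> 1 / s}"
  proof -
    have "1 / t \<le> 1 / s" using assms by (intro frac_le) auto
    then show ?thesis by auto
  qed
  then show ?thesis
    unfolding tail_quantile_def using assms quantile_set_bdd[of s] quantile_set_bdd[of t]
    by (simp add: quantile_set cInf_superset_mono)
qed

section \<open>Exponential scores and recovery of an observation from its score\<close>

definition logS :: "real \<Rightarrow> real" where "logS x = - ln (S x)"

lemma logS_measurable[measurable]: "logS \<in> borel_measurable borel"
  unfolding logS_def[abs_def] by measurable

text \<open>Says that y is the leftmost point at its own tail level, so the tail quantile returns y
  itself. Testing rationals only makes the exceptional set a countable union of events S (X) = S q,
  each null when S q lies strictly between 0 and 1.\<close>

definition regular :: "real \<Rightarrow> bool" where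
  "regular y \<longleftrightarrow> 0 < S y \<and> S y < 1 \<and> (\<forall>q::rat. of_rat q
      < y \<longrightarrow> S (of_rat q) \<noteq> S y)"

lemma regular_measurable[measurable]: "Measurable.pred borel regular"
  unfolding regular_def[abs_def] by measurable

lemma AE_regular: "AE \<omega> in M. regular (X \<omega> $ j)"
proof -
  have "AE \<omega> in M. \<forall>q::rat. 0 < S (of_rat q) \<and> S (of_rat q)
      < 1 \<longrightarrow> S (X \<omega> $ j) \<noteq> S (of_rat q)"
    unfolding AE_all_countable using AE_S_neq by (auto intro: AE_I2)
  then show ?thesis using AE_S_bounds
    by eventually_elim (metis regular_def)
qed

lemma regular_tail_quantile:
  assumes "regular y"
  shows "0 < logS y" and "tail_quantile M X j (exp (logS y)) = y"
proof -
  have y: "0 < S y" "S y < 1" using assms by (auto simp: regular_def)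
  then show "0 < logS y" by (simp add: logS_def)
  have "Inf {x. S x \<le> S y} = y"
  proof (rule cInf_eq_minimum)
    fix x assume "x \<in> {x. S x \<le> S y}"
    then have x: "S x \<le> S y" by simp
    show "y \<le> x"
    proof (rule ccontr)
      assume "\<not> y \<le> x"
      then obtain q where q: "x < of_rat q" "of_rat q < y"
        using of_rat_dense[of x y] by auto
      then have "S (of_rat q) = S y" using S_antimono[of x "of_rat q"] S_antimono[of "of_rat q" y] x
          by linarith
      then show False using assms q by (auto simp: regular_def)
    qed
  qed simp
  then have "tail_quantile M X j (1 / S y) = y" unfolding tail_quantile_def using y
      by (simp add: quantile_set)
  then show "tail_quantile M X j (exp (logS y)) = y" using y
      by (simp add: logS_def exp_minus inverse_eq_divide)
qed

text \<open>On regular points the score is injective as well as monotone, so counts of larger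
  observations, and with them ranks, may be computed from scores.\<close>

lemma regular_logS_less_iff:
  assumes "regular y" "regular y'"
  shows "logS y < logS y' \<longleftrightarrow> y < y'"
proof -
  have y: "0 < S y" "0 < S y'" using assms by (auto simp: regular_def)
  have le: "logS y \<le> logS y'" if "y \<le> y'"
    using S_antimono[OF that] y by (simp add: logS_def)
  have "y \<le> y'" if "logS y \<le> logS y'"
  proof -
    have "tail_quantile M X j (exp (logS y)) \<le> tail_quantile M X j (exp (logS y'))"
      by (rule tail_quantile_mono) (use regular_tail_quantile(1)[OF assms(1)] that in auto)
    then show ?thesis using regular_tail_quantile(2) assms by simp
  qed
  moreover have "logS y' \<le> logS y" if "y' \<le> y"
    using S_antimono[OF that] y by (simp add: logS_def)
  moreover have "y' \<le> y" if "logS y' \<le> logS y"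
  proof -
    have "tail_quantile M X j (exp (logS y')) \<le> tail_quantile M X j (exp (logS y))"
      by (rule tail_quantile_mono) (use regular_tail_quantile(1)[OF assms(2)] that in auto)
    then show ?thesis using regular_tail_quantile(2) assms by simp
  qed
  ultimately show ?thesis using le by (auto simp: not_le[symmetric])
qed

lemma AE_logS_gt_iff: "AE \<omega> in M. \<forall>a\<ge>0. logS (X \<omega> $ j) > a
    \<longleftrightarrow> S (X \<omega> $ j) < exp (- a)"
  using AE_S_bounds
proof eventually_elim
  case (elim \<omega>)
  then have "logS (X \<omega> $ j) > a \<longleftrightarrow> S (X \<omega> $ j) < exp (- a)" for a
    using ln_less_cancel_iff[of "S (X \<omega> $ j)" "exp (- a)"] by (simp add: logS_def) linarith
  then show ?case by blast
qed

lemma logS_distributed: "distributed M lborel (\<lambda>\<omega>. logS (X \<omega> $ j)) (exponential_density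
    1)"
proof (rule exponential_distributedI)
  fix a :: real assume a: "0 \<le> a"
  have "prob {\<omega>\<in>space M. logS (X \<omega> $ j) \<le> a}
      = 1 - prob {\<omega>\<in>space M. \<not> logS (X \<omega> $ j) \<le> a}"
    using prob_neg[of "\<lambda>\<omega>. logS (X \<omega> $ j) \<le> a"] by simp
  also have "prob {\<omega>\<in>space M. \<not> logS (X \<omega> $ j) \<le> a}
      = prob {\<omega>\<in>space M. S (X \<omega> $ j) < exp (- a)}"
  proof (rule finite_measure_eq_AE)
    show "AE \<omega> in M. \<omega> \<in> {\<omega>\<in>space M. \<not> logS (X \<omega> $ j)
        \<le> a} \<longleftrightarrow> \<omega> \<in> {\<omega>\<in>space M. S (X \<omega> $ j) < exp (- a)}"
      using AE_logS_gt_iff by eventually_elim (use a in \<open>auto simp: not_le\<close>)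
  qed measurable
  also have "\<dots> = exp (- a)" by (rule prob_S_less) (use a in auto)
  finally show "emeasure M {\<omega>\<in>space M. logS (X \<omega> $ j) \<le> a}
      = 1 - ennreal (exp (- a * 1))"
    using a by (simp add: emeasure_eq_measure ennreal_minus flip: ennreal_1)
qed auto

end

section \<open>Mixed moments from joint tails\<close>

lemma has_bochner_integral_exponential_density:
  "has_bochner_integral lborel (exponential_density 1) 1"
proof -
  interpret D: prob_space "density lborel (exponential_density 1)"
    by (rule prob_space_exponential_density) simp
  show ?thesis
    using D.emeasure_space_1 exponential_density_nonneg[of 1]
    by (intro has_bochner_integral_nn_integral) (auto simp: emeasure_density)
qed

lemma layer_cake_kernel:
  "has_bochner_integral lborel (\<lambda>u. indicator {0..} u * of_bool (u < y)) (max (y::real) 0)"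
proof (cases "0 \<le> y")
  case True
  have "(\<lambda>u. indicator {0..} u * of_bool (u < y)) = (indicator {0..<y} :: real \<Rightarrow> real)"
    by (auto simp: indicator_def fun_eq_iff)
  then show ?thesis using True by (auto simp: has_bochner_integral_iff)
next
  case False
  then have "(\<lambda>u. indicator {0..} u * of_bool (u < y)) = (\<lambda>u. 0::real)"
    by (auto simp: indicator_def fun_eq_iff)
  then show ?thesis using False by (simp add: has_bochner_integral_iff)
qed

text \<open>\<open>- (a - s) (b - s)\<close> is an antiderivative of \<open>(a - s) + (b - s)\<close>; this reduces the mixed
  moment to one-dimensional tail integrals.\<close>
lemma product_kernel:
  fixes a b :: real
  shows "has_bochner_integral lborel
    (\<lambda>s. indicator {0..} s * (max (a - s) 0 * of_bool (s < b) + max (b - s) 0 * of_bool (s < a)))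
    (max a 0 * max b 0)"
proof (cases "0 \<le> min a b")
  case True
  define m where "m = min a b"
  have m: "0 \<le> m" using True by (simp add: m_def)
  have "has_bochner_integral lborel (\<lambda>s. (a + b - 2 * s) * indicator {0..m} s)
     (- ((a - m) * (b - m)) - - ((a - 0) * (b - 0)))"
  proof (rule has_bochner_integral_FTC_Icc_real[OF m])
    show "((\<lambda>s. - ((a - s) * (b - s))) has_real_derivative (a + b - 2 * x)) (at x)" for x
      by (auto intro!: derivative_eq_intros)
    show "isCont (\<lambda>s. a + b - 2 * s) x" for x by (intro continuous_intros)
  qed
  also have "- ((a - m) * (b - m)) - - ((a - 0) * (b - 0)) = max a 0 * max b 0"
    using True by (auto simp: m_def min_def max_def)
  also have "has_bochner_integral lborel (\<lambda>s. (a + b - 2 * s) * indicator {0..m} s) (max a 0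
      * max b 0) \<longleftrightarrow> ?thesis"
  proof (rule has_bochner_integral_cong_AE)
    show "AE s in lborel. (a + b - 2 * s) * indicator {0..m} s
      = indicator {0..} s * (max (a - s) 0 * of_bool (s < b) + max (b - s) 0 * of_bool (s < a))"
      using AE_lborel_singleton[of m]
      by eventually_elim (auto simp: m_def indicator_def min_def split: if_splits)
  qed measurable
  finally show ?thesis .
next
  case False
  then have "(\<lambda>s. indicator {0..} s * (max (a - s) 0 * of_bool (s < b) + max (b - s) 0 * of_bool (s
      < a))) = (\<lambda>s. 0)"
    by (auto simp: indicator_def fun_eq_iff)
  moreover have "max a 0 * max b 0 = 0" using False by (auto simp: max_def min_def split: if_splits)
  ultimately show ?thesis by (simp add: has_bochner_integral_iff)
qed

context prob_space
begin

text \<open>Fubini in layer-cake form: pathwise, Y is the integral of a nonnegative kernel, whose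
  joint integrability therefore follows from integrability of Y alone.\<close>

lemma expectation_kernel:
  fixes k :: "'a \<Rightarrow> real \<Rightarrow> real"
  assumes meas[measurable]: "case_prod k \<in> borel_measurable (M \<Otimes>\<^sub>M lborel)"
    and nn: "\<And>\<omega> s. 0 \<le> k \<omega> s"
    and int: "\<And>\<omega>. \<omega> \<in> space M \<Longrightarrow> has_bochner_integral lborel (k
        \<omega>) (Y \<omega>)"
    and Y: "integrable M Y"
  shows "expectation Y = (\<integral>s. expectation (\<lambda>\<omega>. k \<omega> s) \<partial>lborel)"
    and "integrable lborel (\<lambda>s. expectation (\<lambda>\<omega>. k \<omega> s))"
proof -
  interpret P: pair_sigma_finite M lborel ..
  have i: "integral\<^sup>L lborel (k \<omega>) = Y \<omega>" "integrable lborel (k \<omega>)" if "\<omega>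
      \<in> space M" for \<omega>
    using int[OF that] by (auto simp: has_bochner_integral_iff)
  have I: "integrable (M \<Otimes>\<^sub>M lborel) (case_prod k)"
  proof (rule P.Fubini_integrable[OF meas])
    have "integrable M (\<lambda>\<omega>. \<integral>s. norm (k \<omega> s) \<partial>lborel)
        \<longleftrightarrow> integrable M Y"
      by (rule Bochner_Integration.integrable_cong[OF refl]) (simp add: nn i)
    then show "integrable M (\<lambda>\<omega>. \<integral>s. norm (case (\<omega>, s) of (\<omega>, s)
        \<Rightarrow> k \<omega> s) \<partial>lborel)" using Y by simp
    show "AE \<omega> in M. integrable lborel (\<lambda>s. case (\<omega>, s) of (\<omega>, s) \<Rightarrow>
        k \<omega> s)"
      by (rule AE_I2) (simp add: i)
  qed
  have "expectation Y = expectation (\<lambda>\<omega>. \<integral>s. k \<omega> s \<partial>lborel)"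
    by (rule Bochner_Integration.integral_cong[OF refl]) (simp add: i)
  also have "\<dots> = (\<integral>s. expectation (\<lambda>\<omega>. k \<omega> s) \<partial>lborel)"
    by (rule P.Fubini_integral[OF I, symmetric])
  finally show "expectation Y = (\<integral>s. expectation (\<lambda>\<omega>. k \<omega> s)
      \<partial>lborel)" .
  show "integrable lborel (\<lambda>s. expectation (\<lambda>\<omega>. k \<omega> s))"
    by (rule P.integrable_snd[OF I])
qed

lemma expectation_of_bool:
  assumes [measurable]: "Measurable.pred M P"
  shows "expectation (\<lambda>\<omega>. of_bool (P \<omega>)) = prob {\<omega>\<in>space M. P \<omega>}"
proof -
  have "expectation (\<lambda>\<omega>. of_bool (P \<omega>) :: real)
      = expectation (indicator {\<omega>\<in>space M. P \<omega>})"
    by (rule Bochner_Integration.integral_cong) (auto simp: indicator_def)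
  then show ?thesis by simp
qed

lemma integrable_pos_part_shift:
  fixes Y :: "'a \<Rightarrow> real"
  assumes [measurable]: "Y \<in> borel_measurable M" "Measurable.pred M P"
    and "integrable M (\<lambda>\<omega>. max (Y \<omega>) 0)" "0 \<le> s"
  shows "integrable M (\<lambda>\<omega>. max (Y \<omega> - s) 0 * of_bool (P \<omega>))"
  by (rule Bochner_Integration.integrable_bound[OF assms(3)])
    (use \<open>0 \<le> s\<close> in \<open>auto simp: of_bool_def\<close>)

text \<open>The mean is the integral over u \<ge> 0 of the probability that a > s + u and b > s.
  Dominated convergence with bound C exp (- s - u) gives the integral of r (s + u) s, and
  homogeneity extracts the factor exp (- s).\<close>

lemma tail_mean_limit:
  fixes a b :: "nat \<Rightarrow> 'a \<Rightarrow> real" and v :: "nat \<Rightarrow> real"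
      and r :: "real \<Rightarrow> real \<Rightarrow> real"
  assumes [measurable]: "\<And>n. a n \<in> borel_measurable M" "\<And>n. b n \<in> borel_measurable M"
    and int: "\<And>n. integrable M (\<lambda>\<omega>. max (a n \<omega>) 0)"
    and v: "\<And>n. 0 \<le> v n"
    and lim: "\<And>s t. 0 \<le> s \<Longrightarrow> 0
        \<le> t \<Longrightarrow> (\<lambda>n. v n * prob {\<omega>\<in>space M. s < a n \<omega> \<and> t
        < b n \<omega>}) \<longlonglongrightarrow> r s t"
    and bound: "\<And>n s t. 0 \<le> s \<Longrightarrow> 0
        \<le> t \<Longrightarrow> v n * prob {\<omega>\<in>space M. s < a n \<omega> \<and> t
        < b n \<omega>} \<le> C * exp (- s)"
    and homog: "\<And>s t h. 0 \<le> s \<Longrightarrow> 0 \<le> t \<Longrightarrow> 0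
        \<le> h \<Longrightarrow> r (s + h) (t + h) = exp (- h) * r s t"
    and s: "0 \<le> s"
  shows "(\<lambda>n. v n * expectation (\<lambda>\<omega>. max (a n \<omega> - s) 0 * of_bool (s
      < b n \<omega>)))
      \<longlonglongrightarrow> exp (- s) * (\<integral>u. indicator {0..} u * r u 0 \<partial>lborel)"
    and "v n * expectation (\<lambda>\<omega>. max (a n \<omega> - s) 0 * of_bool (s < b n \<omega>))
        \<le> C * exp (- s)"
proof -
  let ?f = "\<lambda>n u. indicator {0..} u * (v n * prob {\<omega>\<in>space M. s + u
      < a n \<omega> \<and> s < b n \<omega>})"
  let ?w = "\<lambda>u. C * exp (- s) * exponential_density 1 u"
  let ?k = "\<lambda>n \<omega> u. indicator {0..} u * of_bool (u < a n \<omega> - s) * of_bool (s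
      < b n \<omega>) :: real"
  have K: "has_bochner_integral lborel (?k n \<omega>) (max (a n \<omega> - s) 0 * of_bool (s
      < b n \<omega>))" for n \<omega>
    using has_bochner_integral_mult_left[OF layer_cake_kernel[of "a n \<omega> - s"], of "of_bool (s
        < b n \<omega>)"]
    by simp
  have iY: "integrable M (\<lambda>\<omega>. max (a n \<omega> - s) 0 * of_bool (s < b n \<omega>))" for n
    by (rule integrable_pos_part_shift[OF _ _ int s]) measurable
  have Ek: "expectation (\<lambda>\<omega>. ?k n \<omega> u)
      = indicator {0..} u * prob {\<omega>\<in>space M. s + u < a n \<omega> \<and> s < b n \<omega>}" for n u
  proof -
    have "(\<lambda>\<omega>. ?k n \<omega> u) = (\<lambda>\<omega>. indicator {0..} u * of_bool (s + u
        < a n \<omega> \<and> s < b n \<omega>))"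
      by (auto simp: fun_eq_iff of_bool_def)
    then show ?thesis by (simp add: expectation_of_bool)
  qed
  have eq: "v n * expectation (\<lambda>\<omega>. max (a n \<omega> - s) 0 * of_bool (s < b n \<omega>))
      = (\<integral>u. ?f n u \<partial>lborel)"
    and intf: "integrable lborel (?f n)" for n
  proof -
    note ek = expectation_kernel[OF _ _ K iY, of n]
    have "expectation (\<lambda>\<omega>. max (a n \<omega> - s) 0 * of_bool (s < b n \<omega>))
      = (\<integral>u. indicator {0..} u * prob {\<omega>\<in>space M. s + u < a n \<omega> \<and> s
          < b n \<omega>} \<partial>lborel)"
      and i: "integrable lborel (\<lambda>u. indicator {0..} u * prob {\<omega>\<in>space M. s + u
          < a n \<omega> \<and> s < b n \<omega>})"
      using ek unfolding Ek by (simp_all add: split_beta')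
    then show "v n * expectation (\<lambda>\<omega>. max (a n \<omega> - s) 0 * of_bool (s < b n \<omega>))
        = (\<integral>u. ?f n u \<partial>lborel)"
      by (simp add: mult.left_commute)
    show "integrable lborel (?f n)"
      using integrable_mult_right[OF i, of "v n"] by (simp add: mult.left_commute)
  qed
  have w: "has_bochner_integral lborel ?w (C * exp (- s) * 1)"
    by (intro has_bochner_integral_mult_right has_bochner_integral_exponential_density)
  have fw: "?f n u \<le> ?w u" "0 \<le> ?f n u" for n u
    using bound[of "s + u" s n] s v[of n]
    by (auto simp: indicator_def exponential_density_def mult.assoc simp flip: exp_add)
  show "v n * expectation (\<lambda>\<omega>. max (a n \<omega> - s) 0 * of_bool (s < b n \<omega>))
      \<le> C * exp (- s)" for n
  proof -
    have "(\<integral>u. ?f n u \<partial>lborel) \<le> (\<integral>u. ?w u \<partial>lborel)"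
      by (rule integral_mono[OF intf integrable.intros[OF w] fw(1)])
    then show ?thesis unfolding eq has_bochner_integral_integral_eq[OF w] by simp
  qed
  have "(\<lambda>n. \<integral>u. ?f n u \<partial>lborel)
      \<longlonglongrightarrow> (\<integral>u. exp (- s) * (indicator {0..} u * r u 0) \<partial>lborel)"
  proof (rule integral_dominated_convergence[where w="?w"])
    have lim_pt: "(\<lambda>n. ?f n u) \<longlonglongrightarrow> exp (- s) * (indicator {0..} u
        * r u 0)" for u
    proof (cases "0 \<le> u")
      case True
      then show ?thesis using lim[of "s + u" s] homog[of u 0 s] s by (simp add: add.commute)
    qed simp
    show "AE u in lborel. (\<lambda>n. ?f n u) \<longlonglongrightarrow> exp (- s) * (indicator {0..} u
        * r u 0)"
      using lim_pt by simp
    show m: "?f n \<in> borel_measurable lborel" for n using intf by (rule borel_measurable_integrable)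
    show "(\<lambda>u. exp (- s) * (indicator {0..} u * r u 0)) \<in> borel_measurable lborel"
      by (rule borel_measurable_LIMSEQ_real[OF lim_pt m])
    show "integrable lborel ?w" by (rule integrable.intros[OF w])
    show "AE u in lborel. norm (?f n u) \<le> ?w u" for n using fw by auto
  qed
  then show "(\<lambda>n. v n * expectation (\<lambda>\<omega>. max (a n \<omega> - s) 0 * of_bool (s
      < b n \<omega>)))
      \<longlonglongrightarrow> exp (- s) * (\<integral>u. indicator {0..} u * r u 0 \<partial>lborel)"
    unfolding eq by simp
qed

text \<open>Expanding (a - 1) (b - 1) on the joint exceedance gives the product of positive parts,
  minus two truncated means, plus the joint probability. By \<open>product_kernel\<close> the first
  is the integral over s of two truncated means with limits exp (- s) I and exp (- s) J, hence tends
  to I + J; the subtracted means tend to I and J. Neither integral has to be evaluated.\<close>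

lemma tail_covariance_limit:
  fixes a b :: "nat \<Rightarrow> 'a \<Rightarrow> real" and v :: "nat \<Rightarrow> real"
      and r :: "real \<Rightarrow> real \<Rightarrow> real"
  assumes a[measurable]: "\<And>n. a n \<in> borel_measurable M"
      and b[measurable]: "\<And>n. b n \<in> borel_measurable M"
    and ia: "\<And>n. integrable M (\<lambda>\<omega>. max (a n \<omega>) 0)"
        and ib: "\<And>n. integrable M (\<lambda>\<omega>. max (b n \<omega>) 0)"
    and iab: "\<And>n. integrable M (\<lambda>\<omega>. max (a n \<omega>) 0 * max (b n \<omega>) 0)"
    and v: "\<And>n. 0 \<le> v n"
    and lim: "\<And>s t. 0 \<le> s \<Longrightarrow> 0
        \<le> t \<Longrightarrow> (\<lambda>n. v n * prob {\<omega>\<in>space M. s < a n \<omega> \<and> t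
        < b n \<omega>}) \<longlonglongrightarrow> r s t"
    and bounda: "\<And>n s t. 0 \<le> s \<Longrightarrow> 0
        \<le> t \<Longrightarrow> v n * prob {\<omega>\<in>space M. s < a n \<omega> \<and> t
        < b n \<omega>} \<le> C * exp (- s)"
    and boundb: "\<And>n s t. 0 \<le> s \<Longrightarrow> 0
        \<le> t \<Longrightarrow> v n * prob {\<omega>\<in>space M. s < a n \<omega> \<and> t
        < b n \<omega>} \<le> C * exp (- t)"
    and homog: "\<And>s t h. 0 \<le> s \<Longrightarrow> 0 \<le> t \<Longrightarrow> 0
        \<le> h \<Longrightarrow> r (s + h) (t + h) = exp (- h) * r s t"
  shows "(\<lambda>n. v n * expectation (\<lambda>\<omega>. ((a n \<omega> - 1) * of_bool (0
      < a n \<omega>)) * ((b n \<omega> - 1) * of_bool (0 < b n \<omega>))))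
      \<longlonglongrightarrow> r 0 0"
proof -
  define I where "I = (\<integral>u. indicator {0..} u * r u 0 \<partial>lborel)"
  define J where "J = (\<integral>u. indicator {0..} u * r 0 u \<partial>lborel)"
  define P where "P n s = expectation (\<lambda>\<omega>. max (a n \<omega> - s) 0 * of_bool (s
      < b n \<omega>))" for n s
  define Q where "Q n s = expectation (\<lambda>\<omega>. max (b n \<omega> - s) 0 * of_bool (s
      < a n \<omega>))" for n s
  have limQ: "(\<lambda>n. v n * prob {\<omega>\<in>space M. s < b n \<omega> \<and> t
      < a n \<omega>}) \<longlonglongrightarrow> r t s" if "0 \<le> s" "0 \<le> t" for s t
    using lim[OF that(2,1)] by (simp add: conj_commute)
  have boundQ: "v n * prob {\<omega>\<in>space M. s < b n \<omega> \<and> t < a n \<omega>}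
      \<le> C * exp (- s)" if "0 \<le> s" "0 \<le> t" for s t n
    using boundb[OF that(2,1), of n] by (simp add: conj_commute)
  have homogQ: "r (t + h) (s + h) = exp (- h) * r t s" if "0 \<le> s" "0 \<le> t" "0 \<le> h" for s t h
    using homog[OF that(2,1,3)] .
  have P: "(\<lambda>n. v n * P n s) \<longlonglongrightarrow> exp (- s) * I" if "0 \<le> s" for s
    unfolding P_def I_def
    by (rule tail_mean_limit(1)[where C=C, OF a b ia v]) (assumption | rule lim bounda homog that)+
  have Q: "(\<lambda>n. v n * Q n s) \<longlonglongrightarrow> exp (- s) * J" if "0 \<le> s" for s
    unfolding Q_def J_def
    by (rule tail_mean_limit(1)[where C=C and r="\<lambda>s t. r t s", OF b a ib v]) (assumption | rule limQ
        boundQ homogQ that)+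
  have P_le: "v n * P n s \<le> C * exp (- s)" if "0 \<le> s" for s n
    unfolding P_def
    by (rule tail_mean_limit(2)[where r=r, OF a b ia v]) (assumption | rule lim bounda homog that)+
  have Q_le: "v n * Q n s \<le> C * exp (- s)" if "0 \<le> s" for s n
    unfolding Q_def
    by (rule tail_mean_limit(2)[where r="\<lambda>s t. r t s", OF b a ib v]) (assumption | rule limQ boundQ
        homogQ that)+
  have PQ0: "0 \<le> P n s" "0 \<le> Q n s" for n s unfolding P_def Q_def
      by (auto intro!: Bochner_Integration.integral_nonneg)
  let ?k = "\<lambda>n \<omega> s. indicator {0..} s * (max (a n \<omega> - s) 0 * of_bool (s
      < b n \<omega>) + max (b n \<omega> - s) 0 * of_bool (s < a n \<omega>))"
  let ?f = "\<lambda>n s. indicator {0..} s * (v n * P n s + v n * Q n s)"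
  have Ek: "expectation (\<lambda>\<omega>. ?k n \<omega> s) = indicator {0..} s * (P n s + Q n s)" for n s
  proof (cases "0 \<le> s")
    case True
    then show ?thesis
      using integrable_pos_part_shift[OF a _ ia True, of "\<lambda>\<omega>. s < b n \<omega>" n]
        integrable_pos_part_shift[OF b _ ib True, of "\<lambda>\<omega>. s < a n \<omega>" n]
      by (simp add: P_def Q_def)
  qed simp
  have eq: "v n * expectation (\<lambda>\<omega>. max (a n \<omega>) 0 * max (b n \<omega>) 0)
      = (\<integral>s. ?f n s \<partial>lborel)"
    and intf: "integrable lborel (?f n)" for n
  proof -
    have "expectation (\<lambda>\<omega>. max (a n \<omega>) 0 * max (b n \<omega>) 0)
        = (\<integral>s. expectation (\<lambda>\<omega>. ?k n \<omega> s) \<partial>lborel)"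
      "integrable lborel (\<lambda>s. expectation (\<lambda>\<omega>. ?k n \<omega> s))"
      by (rule expectation_kernel[OF _ _ product_kernel iab]; simp add: split_beta')+
    then have e: "expectation (\<lambda>\<omega>. max (a n \<omega>) 0 * max (b n \<omega>) 0)
        = (\<integral>s. indicator {0..} s * (P n s + Q n s) \<partial>lborel)"
      and i: "integrable lborel (\<lambda>s. indicator {0..} s * (P n s + Q n s))"
      unfolding Ek .
    have f: "?f n = (\<lambda>s. v n * (indicator {0..} s * (P n s + Q n s)))"
        by (simp add: fun_eq_iff algebra_simps)
    show "v n * expectation (\<lambda>\<omega>. max (a n \<omega>) 0 * max (b n \<omega>) 0)
        = (\<integral>s. ?f n s \<partial>lborel)"
      unfolding f e by (rule integral_mult_right_zero[symmetric])
    show "integrable lborel (?f n)" unfolding f by (rule integrable_mult_right[OF i])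
  qed
  have main: "(\<lambda>n. v n * expectation (\<lambda>\<omega>. max (a n \<omega>) 0
      * max (b n \<omega>) 0)) \<longlonglongrightarrow> I + J"
  proof -
    have "(\<lambda>n. \<integral>s. ?f n s \<partial>lborel)
        \<longlonglongrightarrow> (\<integral>s. (I + J) * exponential_density 1 s \<partial>lborel)"
    proof (rule integral_dominated_convergence[where w="\<lambda>s. 2 * C * exponential_density 1 s"])
      have "(\<lambda>n. ?f n s) \<longlonglongrightarrow> (I + J) * exponential_density 1 s" for s
      proof (cases "0 \<le> s")
        case True
        then show ?thesis using tendsto_add[OF P[OF True] Q[OF True]]
          by (simp add: exponential_density_def algebra_simps)
      qed (simp add: exponential_density_def)
      then show "AE s in lborel. (\<lambda>n. ?f n s)
          \<longlonglongrightarrow> (I + J) * exponential_density 1 s" by simp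
      show "?f n \<in> borel_measurable lborel" for n using intf by (rule borel_measurable_integrable)
      show "integrable lborel (\<lambda>s. 2 * C * exponential_density 1 s)"
        using has_bochner_integral_exponential_density
            by (intro integrable_mult_right) (simp add: has_bochner_integral_iff)
      show "AE s in lborel. norm (?f n s) \<le> 2 * C * exponential_density 1 s" for n
      proof (rule AE_I2)
        fix s :: real
        show "norm (?f n s) \<le> 2 * C * exponential_density 1 s"
        proof (cases "0 \<le> s")
          case True
          then show ?thesis using P_le[OF True, of n] Q_le[OF True, of n] PQ0[of n s] v[of n]
            by (simp add: exponential_density_def)
        qed (simp add: exponential_density_def)
      qed
    qed measurable
    also have "(\<integral>s. (I + J) * exponential_density 1 s \<partial>lborel) = I + J"
      using has_bochner_integral_mult_right[OF has_bochner_integral_exponential_density, of "I + J"]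
      by (simp add: has_bochner_integral_iff)
    finally show ?thesis unfolding eq .
  qed
  have "(\<lambda>n. v n * expectation (\<lambda>\<omega>. max (a n \<omega>) 0 * max (b n \<omega>) 0)
      - v n * P n 0 - v n * Q n 0
      + v n * prob {\<omega>\<in>space M. 0 < a n \<omega> \<and> 0 < b n \<omega>})
          \<longlonglongrightarrow> I + J - exp (- 0) * I - exp (- 0) * J + r 0 0"
    by (intro tendsto_add tendsto_diff main P Q lim) simp_all
  moreover have "v n * expectation (\<lambda>\<omega>. ((a n \<omega> - 1) * of_bool (0
      < a n \<omega>)) * ((b n \<omega> - 1) * of_bool (0 < b n \<omega>)))
     = v n * expectation (\<lambda>\<omega>. max (a n \<omega>) 0 * max (b n \<omega>) 0) - v n * P n 0
         - v n * Q n 0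
      + v n * prob {\<omega>\<in>space M. 0 < a n \<omega> \<and> 0 < b n \<omega>}" for n
  proof -
    let ?A = "\<lambda>\<omega>. max (a n \<omega>) 0 * max (b n \<omega>) 0" and ?B
        = "\<lambda>\<omega>. max (a n \<omega> - 0) 0 * of_bool (0 < b n \<omega>)"
      and ?C = "\<lambda>\<omega>. max (b n \<omega> - 0) 0 * of_bool (0 < a n \<omega>)" and ?D
          = "\<lambda>\<omega>. of_bool (0 < a n \<omega> \<and> 0 < b n \<omega>) :: real"
    have iB: "integrable M ?B" by (rule integrable_pos_part_shift[OF a _ ia]) simp_all
    have iC: "integrable M ?C" by (rule integrable_pos_part_shift[OF b _ ib]) simp_all
    have iD: "integrable M ?D" by (rule integrable_const_bound[where B=1]) simp_all
    have F: "(\<lambda>\<omega>. ((a n \<omega> - 1) * of_bool (0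
        < a n \<omega>)) * ((b n \<omega> - 1) * of_bool (0 < b n \<omega>)))
       = (\<lambda>\<omega>. ?A \<omega> - ?B \<omega> - ?C \<omega> + ?D \<omega>)"
      by (auto simp: fun_eq_iff of_bool_def algebra_simps max_def)
    note i1 = Bochner_Integration.integrable_diff[OF iab[of n] iB]
    note i2 = Bochner_Integration.integrable_diff[OF i1 iC]
    have E: "expectation (\<lambda>\<omega>. ((a n \<omega> - 1) * of_bool (0
        < a n \<omega>)) * ((b n \<omega> - 1) * of_bool (0 < b n \<omega>)))
       = expectation ?A - expectation ?B - expectation ?C + expectation ?D"
      unfolding F Bochner_Integration.integral_add[OF i2 iD] Bochner_Integration.integral_diff[OF i1 iC]
          Bochner_Integration.integral_diff[OF iab[of n] iB] ..
    have "Measurable.pred M (\<lambda>\<omega>. 0 < a n \<omega> \<and> 0 < b n \<omega>)"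
      by (intro pred_intros_logic borel_measurable_pred_less borel_measurable_const a b)
    then have D: "expectation ?D = prob {\<omega>\<in>space M. 0 < a n \<omega> \<and> 0 < b n \<omega>}"
        by (rule expectation_of_bool)
    show ?thesis unfolding P_def Q_def E D by (simp only: distrib_left right_diff_distrib)
  qed
  ultimately show ?thesis by simp
qed

end

section \<open>Tail dependence\<close>

text \<open>Collects what the linear parts and \<open>R_hat\<close> depend on; the second order
  condition and the bias enter only in \<open>hill_sample\<close>.\<close>

locale pooled_sample = iid_sample M X Xs
  for M :: "'a measure" and X :: "'a \<Rightarrow> real^('m::{finite,linorder})" and Xs +
  fixes \<gamma> :: real and b c :: "real^('m::{finite,linorder})"
    and R :: "'m::{finite,linorder} \<Rightarrow> 'm \<Rightarrow> ereal \<Rightarrow> ereal \<Rightarrow>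
        real" and N K :: "nat \<Rightarrow> 'm::{finite,linorder} \<Rightarrow> nat"
  assumes \<gamma>_pos: "\<gamma> > 0"
    and cdf_cont: "\<And>j. continuous_on UNIV (marg_cdf M X j)"
    and N_sum: "\<And>n. (\<Sum>j\<in>UNIV. N n j) = n"
    and N_at_top: "\<And>j. filterlim (\<lambda>n. N n j) at_top sequentially"
    and tail_dep: "tail_dependence_cond M X R"
    and N_mono: "\<And>n. mono (N n)"
    and K_at_top: "\<And>j. filterlim (\<lambda>n. K n j) at_top sequentially"
    and K_N_0: "\<And>j. (\<lambda>n. real (K n j) / real (N n j)) \<longlonglongrightarrow> 0"
    and b_pos: "\<And>j. 0 < b $ j"
    and N_ratio: "\<And>j. (\<lambda>n. real (N n (Min UNIV)) / real (N n j)) \<longlonglongrightarrow> b $ j"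
    and c_pos: "\<And>j. 0 < c $ j"
    and K_ratio: "\<And>j. (\<lambda>n. real (K n (Min UNIV)) / real (K n j)) \<longlonglongrightarrow> c $ j"
begin

sublocale marg: continuous_marginal M X j for j
  by unfold_locales (auto intro: cdf_cont)

text \<open>The observations stay whole vectors and only the score map depends on j, so products of
  centred excesses from two coordinates are functions of one observation.\<close>

sublocale tail: exp_tail M X Xs "\<lambda>x. marg.logS j (x $ j)" "\<lambda>n. N n j" "\<lambda>n. K n j" for
    j
proof unfold_locales
  show "(\<lambda>x. marg.logS j (x $ j)) \<in> borel_measurable borel"
    by (rule measurable_compose[OF measurable_vec_nth[OF measurable_ident] marg.logS_measurable, unfolded
        id_def])
qed (auto intro: marg.logS_distributed N_at_top K_at_top K_N_0)

definition copula :: "'m \<Rightarrow> 'm \<Rightarrow> real \<Rightarrow> real \<Rightarrow> real" where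
  "copula j l u v = prob {\<omega>\<in>space M. marg_surv M X j (X \<omega> $ j)
      \<le> u \<and> marg_surv M X l (X \<omega> $ l) \<le> v}"

abbreviation Rr :: "'m \<Rightarrow> 'm \<Rightarrow> real \<Rightarrow> real \<Rightarrow> real" where
  "Rr j l x y \<equiv> R j l (ereal x) (ereal y)"

lemma copula_mono:
  assumes "u \<le> u'" "v \<le> v'"
  shows "copula j l u v \<le> copula j l u' v'"
  unfolding copula_def by (rule finite_measure_mono) (use assms in auto)

lemma copula_commute: "copula j l u v = copula l j v u"
  unfolding copula_def by (simp add: conj_commute)

lemma copula_increment1:
  assumes "0 < u" "u \<le> u'" "u' < 1"
  shows "copula j l u' v \<le> copula j l u v + (u' - u)"
proof -
  let ?S = "\<lambda>j \<omega>. marg_surv M X j (X \<omega> $ j)"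
  have "copula j l u' v \<le> prob ({\<omega>\<in>space M. ?S j \<omega> \<le> u \<and> ?S l \<omega>
      \<le> v} \<union> ({\<omega>\<in>space M. ?S j \<omega>
      \<le> u'} - {\<omega>\<in>space M. ?S j \<omega> \<le> u}))"
    unfolding copula_def by (rule finite_measure_mono) auto
  also have "\<dots> \<le> copula j l u v + prob ({\<omega>\<in>space M. ?S j \<omega>
      \<le> u'} - {\<omega>\<in>space M. ?S j \<omega> \<le> u})"
    unfolding copula_def by (rule measure_Un_le) auto
  also have "prob ({\<omega>\<in>space M. ?S j \<omega>
      \<le> u'} - {\<omega>\<in>space M. ?S j \<omega> \<le> u}) = u' - u"
    using assms by (subst finite_measure_Diff) (auto simp: marg.prob_S_le)
  finally show ?thesis .
qed

text \<open>Margins are uniform, so moving one argument changes the probability by at most the width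
  of a strip. This is the uniformity that allows random-size ratios such as \<open>K n j\<close> /
  \<open>K n l\<close> inside a limit known only at fixed arguments.\<close>

lemma copula_lipschitz:
  assumes "0 < u" "u < 1" "0 < u'" "u' < 1" "0 < v" "v < 1" "0 < v'" "v' < 1"
  shows "\<bar>copula j l u v - copula j l u' v'\<bar> \<le> \<bar>u - u'\<bar> + \<bar>v - v'\<bar>"
proof -
  have 1: "\<bar>copula j l u v - copula j l u' v\<bar> \<le> \<bar>u - u'\<bar>"
    if "0 < u" "u < 1" "0 < u'" "u' < 1" for j l u u' v
  proof (cases "u \<le> u'")
    case True
    then show ?thesis using copula_increment1[of u u' j l v] copula_mono[of u u' v v j l] that by linarith
  next
    case False
    then show ?thesis using copula_increment1[of u' u j l v] copula_mono[of u' u v v j l] that by linarith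
  qed
  have "\<bar>copula j l u v - copula j l u' v\<bar> \<le> \<bar>u - u'\<bar>" using 1 assms by blast
  moreover have "\<bar>copula j l u' v - copula j l u' v'\<bar> \<le> \<bar>v - v'\<bar>"
    unfolding copula_commute[of j l u'] using 1[of v v' l j u'] assms by blast
  ultimately show ?thesis by linarith
qed

lemma copula_limit_fixed:
  assumes "j \<noteq> l" "0 \<le> x" "0 \<le> y"
  shows "((\<lambda>s. s * copula j l (x / s) (y / s)) \<longlongrightarrow> Rr j l x y) at_top"
proof (rule Lim_transform_eventually)
  show "((\<lambda>s. s * surv_copula M X j l (ereal x / ereal s) (ereal y / ereal s))
      \<longlongrightarrow> Rr j l x y) at_top"
    by (rule tail_dep[unfolded tail_dependence_cond_def, rule_format, OF assms(1)]) (use assms in auto)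
  show "\<forall>\<^sub>F s in at_top. s * surv_copula M X j l (ereal x / ereal s) (ereal y / ereal s)
      = s * copula j l (x / s) (y / s)"
    using eventually_gt_at_top[of 0]
    by eventually_elim (simp add: surv_copula_def copula_def)
qed

lemma copula_limit:
  assumes jl: "j \<noteq> l" and x: "0 < x" and y: "0 < y" and S: "filterlim S at_top F"
    and xn: "(xn \<longlongrightarrow> x) F" and yn: "(yn \<longlongrightarrow> y) F"
  shows "((\<lambda>n. S n * copula j l (xn n / S n) (yn n / S n)) \<longlongrightarrow> Rr j l x y) F"
proof -
  have base: "((\<lambda>n. S n * copula j l (x / S n) (y / S n)) \<longlongrightarrow> Rr j l x y) F"
    using filterlim_compose[OF copula_limit_fixed[OF jl, of x y] S] x y by simp
  have small: "\<forall>\<^sub>F n in F. 0 < z n / S n \<and> z n / S n < 1" if z: "(z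
      \<longlongrightarrow> w) F" "0 < w" for z w
  proof -
    have "((\<lambda>n. z n / S n) \<longlongrightarrow> 0) F"
      by (rule tendsto_divide_0[OF z(1) filterlim_at_top_imp_at_infinity[OF S]])
    then have "\<forall>\<^sub>F n in F. z n / S n < 1" by (rule order_tendstoD) simp
    moreover have "\<forall>\<^sub>F n in F. 0 < z n" by (rule order_tendstoD(1)[OF z])
    moreover have "\<forall>\<^sub>F n in F. 0 < S n" using S by (simp add: filterlim_at_top_dense)
    ultimately show ?thesis by eventually_elim simp
  qed
  have Spos: "\<forall>\<^sub>F n in F. 0 < S n" using S by (simp add: filterlim_at_top_dense)
  have "\<forall>\<^sub>F n in F. norm (S n * copula j l (xn n / S n) (yn n / S n) - S n * copula j l (x
      / S n) (y / S n))
      \<le> \<bar>xn n - x\<bar> + \<bar>yn n - y\<bar>"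
    using small[OF tendsto_const x] small[OF tendsto_const y] small[OF xn x] small[OF yn y] Spos
  proof eventually_elim
    case (elim n)
    have "\<bar>copula j l (xn n / S n) (yn n / S n) - copula j l (x / S n) (y / S n)\<bar>
       \<le> \<bar>xn n / S n - x / S n\<bar> + \<bar>yn n / S n - y / S n\<bar>"
      using elim by (intro copula_lipschitz) auto
    also have "\<dots> = (\<bar>xn n - x\<bar> + \<bar>yn n - y\<bar>) / S n"
      using elim by (simp add: add_divide_distrib flip: diff_divide_distrib)
    finally have "S n * \<bar>copula j l (xn n / S n) (yn n / S n) - copula j l (x / S n) (y / S n)\<bar>
       \<le> \<bar>xn n - x\<bar> + \<bar>yn n - y\<bar>" using elim
           by (simp add: pos_le_divide_eq mult.commute)
    then show ?case using elim by (simp add: abs_mult flip: right_diff_distrib)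
  qed
  moreover have "((\<lambda>n. \<bar>xn n - x\<bar> + \<bar>yn n - y\<bar>) \<longlongrightarrow> 0) F"
    using tendsto_add[OF tendsto_rabs_zero tendsto_rabs_zero, OF LIM_zero[OF xn] LIM_zero[OF yn]] by simp
  ultimately have "((\<lambda>n. S n * copula j l (xn n / S n) (yn n / S n) - S n * copula j l (x / S n) (y
      / S n)) \<longlongrightarrow> 0) F"
    by (rule Lim_null_comparison)
  from tendsto_add[OF this base] show ?thesis by simp
qed

text \<open>Substituting h s for s in the defining limit multiplies the expression by h and rescales
  both arguments.\<close>

lemma R_homogeneous:
  assumes jl: "j \<noteq> l" and "0 < x" "0 < y" and h: "0 < h"
  shows "Rr j l (h * x) (h * y) = h * Rr j l x y"
proof -
  have top: "filterlim (\<lambda>s. h * s) at_top at_top"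
    by (rule filterlim_tendsto_pos_mult_at_top[OF tendsto_const h filterlim_ident])
  have "((\<lambda>s. (h * s) * copula j l (h * x / (h * s)) (h * y / (h * s)))
      \<longlongrightarrow> Rr j l (h * x) (h * y)) at_top"
    by (rule copula_limit[OF jl _ _ top tendsto_const tendsto_const]) (use assms in auto)
  moreover have "((\<lambda>s. h * (s * copula j l (x / s) (y / s)))
      \<longlongrightarrow> h * Rr j l x y) at_top"
    by (intro tendsto_mult tendsto_const copula_limit_fixed) (use assms in auto)
  moreover have "(\<lambda>s. h * s * copula j l (h * x / (h * s)) (h * y / (h * s)))
      = (\<lambda>s. h * (s * copula j l (x / s) (y / s)))"
    using h by (simp add: fun_eq_iff mult.assoc)
  ultimately show ?thesis
    by (simp only:) (rule tendsto_unique[OF trivial_limit_at_top_linorder])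
qed

text \<open>The Lipschitz bound of the copula is invariant under the scaling by s and survives the
  limit. It closes the sandwich for the rank-based estimator.\<close>

lemma R_lipschitz:
  assumes jl: "j \<noteq> l" and pos: "0 < x" "0 < y" "0 < x'" "0 < y'"
  shows "\<bar>Rr j l x y - Rr j l x' y'\<bar> \<le> \<bar>x - x'\<bar> + \<bar>y - y'\<bar>"
proof (rule tendsto_le[OF trivial_limit_at_top_linorder tendsto_const])
  show "((\<lambda>s::real. \<bar>s * copula j l (x / s) (y / s) - s * copula j l (x' / s) (y'
      / s)\<bar>) \<longlongrightarrow> \<bar>Rr j l x y - Rr j l x' y'\<bar>) at_top"
    by (intro tendsto_intros copula_limit_fixed) (use assms in auto)
  show "\<forall>\<^sub>F s in at_top. \<bar>s * copula j l (x / s) (y / s) - s * copula j l (x' / s) (y'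
      / s)\<bar> \<le> \<bar>x - x'\<bar> + \<bar>y - y'\<bar>"
    \<comment> \<open>Beyond this point all four rescaled arguments lie strictly between 0 and 1, as
      the copula bound requires.\<close>
    using eventually_gt_at_top[of "x + y + x' + y'"]
  proof eventually_elim
    case (elim s)
    have s: "0 < s" using elim pos by linarith
    have "\<bar>copula j l (x / s) (y / s) - copula j l (x' / s) (y' / s)\<bar>
        \<le> \<bar>x / s - x' / s\<bar> + \<bar>y / s - y' / s\<bar>"
      using pos elim s by (intro copula_lipschitz) auto
    also have "\<dots> = (\<bar>x - x'\<bar> + \<bar>y - y'\<bar>) / s"
      using s by (simp add: add_divide_distrib flip: diff_divide_distrib)
    finally have "s * \<bar>copula j l (x / s) (y / s) - copula j l (x' / s) (y' / s)\<bar>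
        \<le> \<bar>x - x'\<bar> + \<bar>y - y'\<bar>"
      using s by (simp add: pos_le_divide_eq mult.commute)
    then show ?case using s by (simp add: abs_mult flip: right_diff_distrib)
  qed
qed

section \<open>Sample size ratios and limiting covariances of centred excesses\<close>

lemma eventually_good: "\<forall>\<^sub>F n in sequentially. \<forall>j. 0 < K n j \<and> K n j
    < N n j \<and> 0 < tail.\<tau> j n \<and> exp (- tail.\<tau> j n) = real (K n j) / real (N n j)"
proof -
  have "\<forall>\<^sub>F n in sequentially. 0 < K n j \<and> K n j < N n j \<and> 0
      < tail.\<tau> j n \<and> exp (- tail.\<tau> j n) = real (K n j) / real (N n j)" for j
    using tail.eventually_K_N[of j] tail.\<tau>_pos[of j] tail.exp_\<tau>[of j] by eventually_elim simp
  then show ?thesis by (simp add: eventually_all_finite)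
qed

lemma K_ratio2: "(\<lambda>n. real (K n j) / real (K n l)) \<longlonglongrightarrow> c $ l / c $ j"
proof (rule Lim_transform_eventually)
  show "(\<lambda>n. (real (K n (Min UNIV)) / real (K n l)) / (real (K n (Min UNIV))
      / real (K n j))) \<longlonglongrightarrow> c $ l / c $ j"
    by (intro tendsto_divide K_ratio) (use c_pos[of j] in simp)
  show "\<forall>\<^sub>F n in sequentially. (real (K n (Min UNIV)) / real (K n l))
      / (real (K n (Min UNIV)) / real (K n j)) = real (K n j) / real (K n l)"
    using eventually_good by eventually_elim (metis (no_types, lifting) divide_divide_eq_right
        less_numeral_extra(3) mult.commute nonzero_mult_div_cancel_left of_nat_eq_0_iff times_divide_eq_right
        divide_divide_eq_left)
qed

lemma N_ratio2: "(\<lambda>n. real (N n j) / real (N n l)) \<longlonglongrightarrow> b $ l / b $ j"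
proof (rule Lim_transform_eventually)
  show "(\<lambda>n. (real (N n (Min UNIV)) / real (N n l)) / (real (N n (Min UNIV))
      / real (N n j))) \<longlonglongrightarrow> b $ l / b $ j"
    by (intro tendsto_divide N_ratio) (use b_pos[of j] in simp)
  show "\<forall>\<^sub>F n in sequentially. (real (N n (Min UNIV)) / real (N n l))
      / (real (N n (Min UNIV)) / real (N n j)) = real (N n j) / real (N n l)"
    using eventually_good
  proof eventually_elim
    case (elim n)
    have "real (N n (Min UNIV)) \<noteq> 0" "real (N n j) \<noteq> 0" "real (N n l) \<noteq> 0"
      using elim by (metis gr_implies_not0 of_nat_eq_0_iff)+
    then show ?case by (simp add: field_simps)
  qed
qed

definition k_total :: "nat \<Rightarrow> real" where "k_total n = real (\<Sum>j\<in>UNIV. K n j)"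

definition c_inv_sum :: real where "c_inv_sum = (\<Sum>i\<in>UNIV. 1 / c $ i)"

lemma k_total_ratio: "(\<lambda>n. k_total n / real (K n j)) \<longlonglongrightarrow> c_inv_sum * c $ j"
proof -
  have "(\<lambda>n. \<Sum>i\<in>UNIV. real (K n i) / real (K n j))
      \<longlonglongrightarrow> (\<Sum>i\<in>UNIV. c $ j / c $ i)"
    by (intro tendsto_sum K_ratio2)
  then show ?thesis by (simp add: k_total_def c_inv_sum_def sum_divide_distrib sum_distrib_right)
qed

text \<open>Exceedance of a score is strict while the copula uses \<le>; the difference is a null
  event, because a marginal tail value hits a given level in (0, 1) with probability zero.\<close>

lemma prob_joint_exceedance:
  assumes "0 < a" "0 < a'"
  shows "prob {\<omega>\<in>space M. a < marg.logS j (X \<omega> $ j) \<and> a'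
      < marg.logS l (X \<omega> $ l)} = copula j l (exp (- a)) (exp (- a'))"
proof -
  have "AE \<omega> in M. marg_surv M X j (X \<omega> $ j) \<noteq> exp (- a)" using assms
      by (intro marg.AE_S_neq) auto
  moreover have "AE \<omega> in M. marg_surv M X l (X \<omega> $ l) \<noteq> exp (- a')" using assms
      by (intro marg.AE_S_neq) auto
  ultimately have "AE \<omega> in M. \<omega> \<in> {\<omega>\<in>space M. a
      < marg.logS j (X \<omega> $ j) \<and> a' < marg.logS l (X \<omega> $ l)} \<longleftrightarrow>
     \<omega> \<in> {\<omega>\<in>space M. marg_surv M X j (X \<omega> $ j)
         \<le> exp (- a) \<and> marg_surv M X l (X \<omega> $ l) \<le> exp (- a')}"
    using marg.AE_logS_gt_iff[of j] marg.AE_logS_gt_iff[of l]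
  proof eventually_elim
    case (elim \<omega>)
    have "a < marg.logS j (X \<omega> $ j) \<longleftrightarrow> marg_surv M X j (X \<omega> $ j)
        \<le> exp (- a)"
      using elim(1) elim(3)[rule_format, of a] assms by linarith
    moreover have "a' < marg.logS l (X \<omega> $ l)
        \<longleftrightarrow> marg_surv M X l (X \<omega> $ l) \<le> exp (- a')"
      using elim(2) elim(4)[rule_format, of a'] assms by linarith
    ultimately show ?case by simp
  qed
  then show ?thesis unfolding copula_def by (intro finite_measure_eq_AE) simp_all
qed

text \<open>An instance of \<open>tail_covariance_limit\<close> with the scores shifted by their
  levels. Shifting the levels by s and t multiplies the arguments of R by exp (- s) and exp (- t),
  which turns homogeneity of R into the exponential relation required there.\<close>

lemma \<zeta>_cov_limit:
  assumes jl: "j < l"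
  shows "(\<lambda>n. real (N n j) / real (K n l) * expectation (\<lambda>\<omega>. tail.\<zeta> j n (X
      \<omega>) * tail.\<zeta> l n (X \<omega>)))
     \<longlonglongrightarrow> Rr j l (c $ l / c $ j) (b $ l / b $ j)"
proof -
  define x where "x = c $ l / c $ j"
  define y where "y = b $ l / b $ j"
  have x: "x > 0" and y: "y > 0" using b_pos c_pos by (auto simp: x_def y_def)
  define E where "E = (\<lambda>j \<omega>. marg.logS j (X \<omega> $ j))"
  have E[measurable]: "E j \<in> borel_measurable M" for j
    unfolding E_def by measurable
  \<comment> \<open>The common scale: exp (- \<open>\<tau>\<close>) is (\<open>K n j\<close> /
    \<open>K n l\<close>) / S for coordinate j and (\<open>N n j\<close> / \<open>N n l\<close>) / S
    for coordinate l, so the two ratios become the arguments of R.\<close>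
  define S where "S n = real (N n j) / real (K n l)" for n
  \<comment> \<open>Strictly above both limiting ratios, hence an eventual bound for both.\<close>
  define C where "C = max x y + 1"
  define good where "good n \<longleftrightarrow> 0 < K n j \<and> 0 < K n l \<and> 0 < N n j \<and> 0
      < N n l \<and> 0 < tail.\<tau> j n \<and> 0 < tail.\<tau> l n
    \<and> exp (- tail.\<tau> j n) = real (K n j) / real (N n j) \<and> exp (- tail.\<tau> l n)
        = real (K n l) / real (N n l)
    \<and> real (K n j) / real (K n l) \<le> C \<and> real (N n j) / real (N n l) \<le> C" for n
  \<comment> \<open>Set to 0 off the good indices, because the bounds of
    \<open>tail_covariance_limit\<close> are demanded for every n.\<close>
  define v where "v n = (if good n then S n else 0)" for n
  have good: "\<forall>\<^sub>F n in sequentially. good n"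
  proof -
    have "\<forall>\<^sub>F n in sequentially. real (K n j) / real (K n l) < C"
      by (rule order_tendstoD(2)[OF K_ratio2]) (auto simp: C_def x_def)
    moreover have "\<forall>\<^sub>F n in sequentially. real (N n j) / real (N n l) < C"
      by (rule order_tendstoD(2)[OF N_ratio2]) (auto simp: C_def y_def)
    ultimately show ?thesis using eventually_good
    proof eventually_elim
      case (elim n)
      from elim(3)[rule_format, of j] elim(3)[rule_format, of l] show ?case
        using elim(1,2) by (simp add: good_def)
    qed
  qed
  have S_top: "filterlim S at_top sequentially"
  proof -
    have "filterlim (\<lambda>n. inverse (real (K n j) / real (N n j))) at_top sequentially"
      by (rule filterlim_inverse_at_top[OF K_N_0]) (rule eventually_mono[OF tail.eventually_K_N[of j]], auto)
    then have "filterlim (\<lambda>n. inverse (real (K n j) / real (N n j)) * (real (K n j)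
        / real (K n l))) at_top sequentially"
      using x by (intro filterlim_at_top_mult_tendsto_pos[OF K_ratio2]) (auto simp: x_def)
    moreover have "\<forall>\<^sub>F n in sequentially. inverse (real (K n j) / real (N n j))
        * (real (K n j) / real (K n l)) = S n"
      using good by eventually_elim (simp add: good_def S_def)
    ultimately show ?thesis using filterlim_cong[OF refl refl] by fastforce
  qed
  let ?P = "\<lambda>n s t. prob {\<omega>\<in>space M. s < E j \<omega> - tail.\<tau> j n \<and> t
      < E l \<omega> - tail.\<tau> l n}"
  have exceed: "prob {\<omega>\<in>space M. a < E i \<omega>} = exp (- a)" if "0 \<le> a" for a i
    using tail.expectation_exceedance[OF that, of i] expectation_of_bool[of "\<lambda>\<omega>. a
        < E i \<omega>"]
    unfolding E_def by simp
  have P_copula: "?P n s t = copula j l (exp (- tail.\<tau> j n - s)) (exp (- tail.\<tau> l n - t))"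
    if "good n" "0 \<le> s" "0 \<le> t" for n s t
  proof -
    have pos: "0 < tail.\<tau> j n + s" "0 < tail.\<tau> l n + t" using that by (auto simp: good_def)
    have ev: "{\<omega>\<in>space M. s < E j \<omega> - tail.\<tau> j n \<and> t
        < E l \<omega> - tail.\<tau> l n}
      = {\<omega>\<in>space M. tail.\<tau> j n + s < marg.logS j (X \<omega> $ j) \<and> tail.\<tau> l n
          + t < marg.logS l (X \<omega> $ l)}"
      unfolding E_def by (intro Collect_cong) linarith
    have ex: "- tail.\<tau> j n - s = - (tail.\<tau> j n + s)" "- tail.\<tau> l n - t
        = - (tail.\<tau> l n + t)" by simp_all
    show ?thesis unfolding ev ex by (rule prob_joint_exceedance[OF pos])
  qed
  have lim: "(\<lambda>n. v n * ?P n s t) \<longlonglongrightarrow> Rr j l (x * exp (- s)) (y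
      * exp (- t))" if st: "0 \<le> s" "0 \<le> t" for s t
  proof (rule Lim_transform_eventually)
    show "(\<lambda>n. S n * copula j l (real (K n j) / real (K n l) * exp (- s) / S n) (real (N n j)
        / real (N n l) * exp (- t) / S n))
        \<longlonglongrightarrow> Rr j l (x * exp (- s)) (y * exp (- t))"
      using jl x y K_ratio2[of j l, folded x_def] N_ratio2[of j l, folded y_def] S_top
      by (intro copula_limit tendsto_mult tendsto_const) auto
    show "\<forall>\<^sub>F n in sequentially. S n * copula j l (real (K n j) / real (K n l) * exp (- s)
        / S n) (real (N n j) / real (N n l) * exp (- t) / S n)
       = v n * ?P n s t"
      using good
    proof eventually_elim
      case (elim n)
      have "real (K n j) / real (K n l) * exp (- s) / S n = exp (- tail.\<tau> j n - s)"
        using elim by (simp add: good_def S_def exp_diff exp_minus field_simps)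
      moreover have "real (N n j) / real (N n l) * exp (- t) / S n = exp (- tail.\<tau> l n - t)"
        using elim by (simp add: good_def S_def exp_diff exp_minus field_simps)
      ultimately show ?case using P_copula[OF elim st] elim by (simp add: v_def)
    qed
  qed
  have bounda: "v n * ?P n s t \<le> C * exp (- s)" if st: "0 \<le> s" "0 \<le> t" for n s t
  proof (cases "good n")
    case True
    have "?P n s t \<le> prob {\<omega>\<in>space M. tail.\<tau> j n + s < E j \<omega>}"
        by (rule finite_measure_mono) auto
    also have "\<dots> = exp (- (tail.\<tau> j n + s))"
      using True st by (intro exceed) (auto simp: good_def)
    also have "\<dots> = exp (- tail.\<tau> j n) * exp (- s)" by (simp flip: exp_add)
    finally have "S n * ?P n s t \<le> S n * (exp (- tail.\<tau> j n) * exp (- s))"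
      by (intro mult_left_mono) (auto simp: S_def)
    then have "v n * ?P n s t \<le> S n * (exp (- tail.\<tau> j n) * exp (- s))"
      using True by (simp only: v_def if_True)
    also have "\<dots> = real (K n j) / real (K n l) * exp (- s)" using True by (simp add: S_def good_def)
    also have "\<dots> \<le> C * exp (- s)" using True by (intro mult_right_mono) (auto simp: good_def)
    finally show ?thesis .
  qed (use x y in \<open>simp add: v_def C_def\<close>)
  have boundb: "v n * ?P n s t \<le> C * exp (- t)" if st: "0 \<le> s" "0 \<le> t" for n s t
  proof (cases "good n")
    case True
    have "?P n s t \<le> prob {\<omega>\<in>space M. tail.\<tau> l n + t < E l \<omega>}"
        by (rule finite_measure_mono) auto
    also have "\<dots> = exp (- (tail.\<tau> l n + t))"
      using True st by (intro exceed) (auto simp: good_def)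
    also have "\<dots> = exp (- tail.\<tau> l n) * exp (- t)" by (simp flip: exp_add)
    finally have "S n * ?P n s t \<le> S n * (exp (- tail.\<tau> l n) * exp (- t))"
      by (intro mult_left_mono) (auto simp: S_def)
    then have "v n * ?P n s t \<le> S n * (exp (- tail.\<tau> l n) * exp (- t))"
      using True by (simp only: v_def if_True)
    also have "\<dots> = real (N n j) / real (N n l) * exp (- t)" using True by (simp add: S_def good_def)
    also have "\<dots> \<le> C * exp (- t)" using True by (intro mult_right_mono) (auto simp: good_def)
    finally show ?thesis .
  qed (use x y in \<open>simp add: v_def C_def\<close>)
  have homog: "Rr j l (x * exp (- (s + h))) (y * exp (- (t + h)))
      = exp (- h) * Rr j l (x * exp (- s)) (y * exp (- t))" for s t h
    using R_homogeneous[of j l "x * exp (- s)" "y * exp (- t)" "exp (- h)"] jl x y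
    by (simp add: exp_add exp_diff exp_minus field_simps)
  have intE: "integrable M (\<lambda>\<omega>. (E i \<omega> - a)\<^sup>2)" for i a
    using tail.e_moments(1,3)[of i] by (simp add: E_def power2_diff)
  have intE1: "integrable M (\<lambda>\<omega>. max (E i \<omega> - a) 0)" for i a
    by (rule Bochner_Integration.integrable_bound[of M "\<lambda>\<omega>. E i \<omega> - a"])
      (use tail.e_moments(1)[of i] in \<open>auto simp: E_def\<close>)
  have intEE: "integrable M (\<lambda>\<omega>. max (E j \<omega> - a) 0 * max (E l \<omega>
      - a') 0)" for a a'
  proof (rule Bochner_Integration.integrable_bound)
    show "integrable M (\<lambda>\<omega>. (E j \<omega> - a)\<^sup>2 + (E l \<omega> - a')\<^sup>2)"
        by (intro Bochner_Integration.integrable_add intE)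
    have "\<bar>max p 0 * max q 0\<bar> \<le> p\<^sup>2 + q\<^sup>2" for p q :: real
    proof -
      have "\<bar>max p 0 * max q 0\<bar> \<le> \<bar>p\<bar> * \<bar>q\<bar>" unfolding abs_mult
          by (intro mult_mono) auto
      also have "\<dots> \<le> p\<^sup>2 + q\<^sup>2" 
        using sum_squares_bound[of "\<bar>p\<bar>" "\<bar>q\<bar>"] mult_nonneg_nonneg[OF abs_ge_zero[of p]
            abs_ge_zero[of q]]
        unfolding power2_abs by linarith
      finally show ?thesis .
    qed
    then show "AE \<omega> in M. norm (max (E j \<omega> - a) 0 * max (E l \<omega> - a') 0)
        \<le> norm ((E j \<omega> - a)\<^sup>2 + (E l \<omega> - a')\<^sup>2)"
      by simp
  qed measurable
  have "(\<lambda>n. v n * expectation (\<lambda>\<omega>. ((E j \<omega> - tail.\<tau> j n - 1)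
      * of_bool (0 < E j \<omega> - tail.\<tau> j n))
      * ((E l \<omega> - tail.\<tau> l n - 1) * of_bool (0
          < E l \<omega> - tail.\<tau> l n)))) \<longlonglongrightarrow> Rr j l (x * exp (- 0)) (y
          * exp (- 0))"
    by (rule tail_covariance_limit[where C=C and r="\<lambda>s t. Rr j l (x * exp (- s)) (y * exp (- t))",
          OF _ _ intE1 intE1 intEE _ lim bounda boundb homog])
      (auto simp: v_def S_def)
  moreover have "\<forall>\<^sub>F n in sequentially. v n * expectation (\<lambda>\<omega>. ((E j \<omega>
      - tail.\<tau> j n - 1) * of_bool (0 < E j \<omega> - tail.\<tau> j n))
      * ((E l \<omega> - tail.\<tau> l n - 1) * of_bool (0 < E l \<omega> - tail.\<tau> l n)))
     = real (N n j) / real (K n l) * expectation (\<lambda>\<omega>. tail.\<zeta> j n (X \<omega>)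
         * tail.\<zeta> l n (X \<omega>))"
    using good by eventually_elim (simp add: v_def S_def tail.\<zeta>_def E_def)
  ultimately show ?thesis unfolding x_def y_def by (simp add: Lim_transform_eventually)
qed

end

section \<open>Central limit theorem for the linear parts\<close>

lemma sum_abs_power3_le:
  fixes x :: "'i::finite \<Rightarrow> real"
  shows "\<bar>\<Sum>j\<in>UNIV. x j\<bar> ^ 3 \<le> real CARD('i) ^ 3
      * (\<Sum>j\<in>UNIV. \<bar>x j\<bar> ^ 3)"
proof -
  define m where "m = Max (range (\<lambda>j. \<bar>x j\<bar>))"
  have "m \<in> range (\<lambda>j. \<bar>x j\<bar>)" unfolding m_def by (rule Max_in) auto
  then obtain k where k: "m = \<bar>x k\<bar>" by auto
  have le: "\<bar>x j\<bar> \<le> m" for j unfolding m_def by (rule Max_ge) auto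
  have "\<bar>\<Sum>j\<in>UNIV. x j\<bar> \<le> (\<Sum>j\<in>(UNIV::'i set). m)"
    by (rule order_trans[OF sum_abs]) (intro sum_mono le)
  then have "\<bar>\<Sum>j\<in>UNIV. x j\<bar> ^ 3 \<le> (real CARD('i) * m) ^ 3" by (intro power_mono) auto
  also have "\<dots> = real CARD('i) ^ 3 * \<bar>x k\<bar> ^ 3" by (simp add: power_mult_distrib k)
  also have "\<dots> \<le> real CARD('i) ^ 3 * (\<Sum>j\<in>UNIV. \<bar>x j\<bar> ^ 3)"
    by (intro mult_left_mono member_le_sum) auto
  finally show ?thesis .
qed

lemma sum_of_bool_le_index:
  assumes "m \<le> (n::nat)"
  shows "(\<Sum>i=1..n. of_bool (i \<le> m)) = real m"
proof -
  have "{1..n} \<inter> {i. i \<le> m} = {1..m}" using assms by auto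
  then show ?thesis by simp
qed

context pooled_sample
begin

lemma N_le: "N n j \<le> n"
  using member_le_sum[of j UNIV "N n"] N_sum[of n] by simp

lemma V_asym_nth:
  "V_asym \<gamma> R c b $ j $ j = c_inv_sum * \<gamma>\<^sup>2 * c $ j"
  "j < l \<Longrightarrow> V_asym \<gamma> R c b $ j $ l
      = c_inv_sum * \<gamma>\<^sup>2 * c $ j * Rr j l (c $ l / c $ j) (b $ l / b $ j)"
  "l < j \<Longrightarrow> V_asym \<gamma> R c b $ j $ l
      = c_inv_sum * \<gamma>\<^sup>2 * c $ l * Rr l j (c $ j / c $ l) (b $ j / b $ l)"
  by (simp_all add: V_asym_def c_inv_sum_def Let_def)

lemma integrable_\<zeta>_prod: "integrable M (\<lambda>\<omega>. tail.\<zeta> j n (X \<omega>)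
    * tail.\<zeta> l n (X \<omega>))"
proof (rule Bochner_Integration.integrable_bound)
  show "integrable M (\<lambda>\<omega>. (tail.\<zeta> j n (X \<omega>))\<^sup>2
      + (tail.\<zeta> l n (X \<omega>))\<^sup>2)"
    by (intro Bochner_Integration.integrable_add tail.integrable_\<zeta>_sq)
  have "\<bar>p * q\<bar> \<le> p\<^sup>2 + q\<^sup>2" for p q :: real
    using sum_squares_bound[of "\<bar>p\<bar>" "\<bar>q\<bar>"] mult_nonneg_nonneg[OF abs_ge_zero[of p]
        abs_ge_zero[of q]]
    unfolding power2_abs abs_mult by linarith
  then show "AE \<omega> in M. norm (tail.\<zeta> j n (X \<omega>) * tail.\<zeta> l n (X \<omega>))
      \<le> norm ((tail.\<zeta> j n (X \<omega>))\<^sup>2 + (tail.\<zeta> l n (X \<omega>))\<^sup>2)"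
    by simp
qed measurable

text \<open>Exchanging the sums over coordinates and observations gives independent summands.
  Diagonal variances come from memorylessness, off-diagonal ones from
  \<open>\<zeta>_cov_limit\<close>. Third moments are of order K to the power - 1 / 2, since the
  sample sizes cancel against the exceedance probabilities.\<close>

lemma pooled_linear_clt:
  "(\<lambda>n. char (distr M borel (\<lambda>\<omega>. \<Sum>j\<in>UNIV. w $ j * (sqrt (k_total n)
      / real (K n j) * \<gamma>) * (\<Sum>i=1..N n j. tail.\<zeta> j n (Xs i \<omega>)))) t)
     \<longlonglongrightarrow> complex_of_real (exp (- (t\<^sup>2
         * (w \<bullet> (V_asym \<gamma> R c b *v w)) / 2)))"
proof -
  define \<alpha> where "\<alpha> n j = w $ j * (sqrt (k_total n) / real (K n j) * \<gamma>)" for n j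
  define m where "m n j l = expectation (\<lambda>\<omega>. tail.\<zeta> j n (X \<omega>)
      * tail.\<zeta> l n (X \<omega>))" for n j l
  \<comment> \<open>The contribution of observation i; the indicator drops the coordinates whose
    sample ends before i.\<close>
  let ?\<psi> = "\<lambda>n i x. \<Sum>j\<in>UNIV. of_bool (i
      \<le> N n j) * \<alpha> n j * tail.\<zeta> j n x"
  have k_total_nonneg: "0 \<le> k_total n" for n by (simp add: k_total_def sum_nonneg)
  have inner: "w \<bullet> (V_asym \<gamma> R c b *v w)
      = (\<Sum>j\<in>UNIV. \<Sum>l\<in>UNIV. w $ j * w $ l * V_asym \<gamma> R c b $ j $ l)"
    by (simp add: inner_vec_def matrix_vector_mult_def sum_distrib_left mult_ac)
  have eq: "(\<Sum>j\<in>UNIV. \<alpha> n j * (\<Sum>i=1..N n j. tail.\<zeta> j n (Xs i \<omega>)))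
      = (\<Sum>i=1..n. ?\<psi> n i (Xs i \<omega>))" for n \<omega>
  proof -
    have "(\<Sum>i=1..N n j. tail.\<zeta> j n (Xs i \<omega>)) = (\<Sum>i=1..n. of_bool (i
        \<le> N n j) * tail.\<zeta> j n (Xs i \<omega>))" for j
    proof -
      have "{1..n} \<inter> {i. i \<le> N n j} = {1..N n j}" using N_le[of n j] by auto
      then show ?thesis by simp
    qed
    then have "(\<Sum>j\<in>UNIV. \<alpha> n j * (\<Sum>i=1..N n j. tail.\<zeta> j n (Xs i \<omega>)))
      = (\<Sum>j\<in>UNIV. \<Sum>i=1..n. of_bool (i
          \<le> N n j) * \<alpha> n j * tail.\<zeta> j n (Xs i \<omega>))"
      by (simp add: sum_distrib_left mult_ac del: sum_of_bool_mult_eq sum_mult_of_bool_eq)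
    also have "\<dots> = (\<Sum>i=1..n. ?\<psi> n i (Xs i \<omega>))" by (rule sum.swap)
    finally show ?thesis .
  qed
  have sq: "(?\<psi> n i x)\<^sup>2 = (\<Sum>j\<in>UNIV. \<Sum>l\<in>UNIV. of_bool (i
      \<le> N n j) * of_bool (i \<le> N n l) * (\<alpha> n j * \<alpha> n l)
       * (tail.\<zeta> j n x * tail.\<zeta> l n x))" for n i x
    unfolding power2_eq_square sum_product by (intro sum.cong refl) (simp only: mult_ac)
  have E2: "expectation (\<lambda>\<omega>. (?\<psi> n i (X \<omega>))\<^sup>2)
      = (\<Sum>j\<in>UNIV. \<Sum>l\<in>UNIV. of_bool (i \<le> N n j) * of_bool (i
      \<le> N n l) * (\<alpha> n j * \<alpha> n l) * m n j l)" for n i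
    unfolding sq m_def
    by (subst Bochner_Integration.integral_sum
        | intro Bochner_Integration.integrable_sum integrable_mult_right integrable_\<zeta>_prod
        | rule sum.cong[OF refl] integral_mult_right_zero)+
  \<comment> \<open>Only observations present in both samples produce a covariance. For j < l
    monotonicity of \<open>N n\<close> makes this number \<open>N n j\<close>, matching the
    normalization in \<open>\<zeta>_cov_limit\<close>.\<close>
  have cnt: "(\<Sum>i=1..n. of_bool (i \<le> N n j) * of_bool (i \<le> N n l))
      = real (min (N n j) (N n l))" for n j l
    using sum_of_bool_le_index[of "min (N n j) (N n l)" n] N_le[of n j] by (simp flip: of_bool_conj)
  have S2: "(\<Sum>i=1..n. expectation (\<lambda>\<omega>. (?\<psi> n i (X \<omega>))\<^sup>2))
      = (\<Sum>j\<in>UNIV. \<Sum>l\<in>UNIV. real (min (N n j) (N n l)) * (\<alpha> n j * \<alpha> n l)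
      * m n j l)" for n
  proof -
    have "(\<Sum>i=1..n. expectation (\<lambda>\<omega>. (?\<psi> n i (X \<omega>))\<^sup>2))
      = (\<Sum>j\<in>UNIV. \<Sum>l\<in>UNIV. \<Sum>i=1..n. of_bool (i \<le> N n j) * of_bool (i
          \<le> N n l) * (\<alpha> n j * \<alpha> n l) * m n j l)"
      unfolding E2 by (subst sum.swap, rule sum.cong[OF refl], rule sum.swap)
    also have "\<dots> = (\<Sum>j\<in>UNIV. \<Sum>l\<in>UNIV. real (min (N n j) (N n l)) * (\<alpha> n j
        * \<alpha> n l) * m n j l)"
      unfolding cnt[symmetric] sum_distrib_right ..
    finally show ?thesis .
  qed
  have mdiag: "\<forall>\<^sub>F n in sequentially. m n j j = real (K n j) / real (N n j)" for j
    using eventually_good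
  proof eventually_elim
    case (elim n)
    then have "0 \<le> tail.\<tau> j n" "exp (- tail.\<tau> j n) = real (K n j) / real (N n j)"
        using less_imp_le by blast+
    then show ?case using tail.\<zeta>_moments(2)[of j n] by (simp add: m_def power2_eq_square)
  qed
  then have mdiag_all: "\<forall>\<^sub>F n in sequentially. \<forall>j. m n j j
      = real (K n j) / real (N n j)"
    by (simp add: eventually_all_finite)
  have upper: "(\<lambda>n. real (min (N n j) (N n l)) * (\<alpha> n j * \<alpha> n l)
      * m n j l) \<longlonglongrightarrow> w $ j * w $ l * V_asym \<gamma> R c b $ j $ l"
    if jl: "j < l" for j l
  proof (rule Lim_transform_eventually)
    show "(\<lambda>n. w $ j * w $ l * (k_total n / real (K n j) * \<gamma>\<^sup>2 * (real (N n j)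
        / real (K n l) * m n j l))) \<longlonglongrightarrow> w $ j * w $ l * V_asym \<gamma> R c b $ j $ l"
      using tendsto_mult[OF tendsto_const[of "w $ j
          * w $ l"] tendsto_mult[OF tendsto_mult[OF k_total_ratio[of j] tendsto_const[of "\<gamma>\<^sup>2"]]
          \<zeta>_cov_limit[OF jl]]]
      by (simp add: V_asym_nth(2)[OF jl] m_def mult_ac)
    show "\<forall>\<^sub>F n in sequentially. w $ j * w $ l * (k_total n / real (K n j) * \<gamma>\<^sup>2
        * (real (N n j) / real (K n l) * m n j l))
      = real (min (N n j) (N n l)) * (\<alpha> n j * \<alpha> n l) * m n j l"
    proof (rule always_eventually, rule allI)
      fix n
      have "N n j \<le> N n l" using N_mono[of n] jl by (simp add: mono_def)
      moreover have "sqrt (k_total n) * sqrt (k_total n) = k_total n" using k_total_nonneg by simp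
      ultimately show "w $ j * w $ l * (k_total n / real (K n j) * \<gamma>\<^sup>2 * (real (N n j)
          / real (K n l) * m n j l))
        = real (min (N n j) (N n l)) * (\<alpha> n j * \<alpha> n l) * m n j l"
        unfolding \<alpha>_def by (cases "K n j = 0"; cases "K n l
            = 0") (simp_all add: min_absorb1 field_simps power2_eq_square)
    qed
  qed
  have sum2: "(\<lambda>n. \<Sum>i=1..n. expectation (\<lambda>\<omega>. (?\<psi> n i (X \<omega>))\<^sup>2))
      \<longlonglongrightarrow> w \<bullet> (V_asym \<gamma> R c b *v w)"
    unfolding S2 inner
  proof (intro tendsto_sum)
    fix j l :: 'm
    consider "j < l" | "j = l" | "l < j" by fastforce
    then show "(\<lambda>n. real (min (N n j) (N n l)) * (\<alpha> n j * \<alpha> n l)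
        * m n j l) \<longlonglongrightarrow> w $ j * w $ l * V_asym \<gamma> R c b $ j $ l"
    proof cases
      case 1
      then show ?thesis by (rule upper)
    next
      case 3
      have "V_asym \<gamma> R c b $ j $ l = V_asym \<gamma> R c b $ l $ j" using 3 by (simp add: V_asym_nth)
      moreover have "m n j l = m n l j" for n by (simp add: m_def mult.commute)
      ultimately show ?thesis using upper[OF 3] by (simp add: mult_ac min.commute)
    next
      case 2
      have "(\<lambda>n. w $ j * w $ j * (k_total n / real (K n j)
          * \<gamma>\<^sup>2)) \<longlonglongrightarrow> w $ j * w $ j * (c_inv_sum * c $ j
          * \<gamma>\<^sup>2)"
        by (intro tendsto_mult tendsto_const k_total_ratio)
      moreover have "\<forall>\<^sub>F n in sequentially. w $ j * w $ j * (k_total n / real (K n j)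
          * \<gamma>\<^sup>2) = real (min (N n j) (N n j)) * (\<alpha> n j * \<alpha> n j) * m n j j"
        using mdiag[of j] eventually_good
      proof eventually_elim
        case (elim n)
        have K: "real (K n j) \<noteq> 0" "real (N n j) \<noteq> 0" using elim(2)
            by (metis gr_implies_not0 of_nat_eq_0_iff)+
        have "sqrt (k_total n) * sqrt (k_total n) = k_total n" using k_total_nonneg by simp
        then have "(sqrt (k_total n))\<^sup>2 = k_total n" by (simp add: power2_eq_square)
        then show ?case unfolding elim(1) \<alpha>_def using K by (simp add: field_simps power2_eq_square)
      qed
      ultimately have "(\<lambda>n. real (min (N n j) (N n j)) * (\<alpha> n j * \<alpha> n j)
          * m n j j) \<longlonglongrightarrow> w $ j * w $ j * (c_inv_sum * c $ j * \<gamma>\<^sup>2)"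
        by (rule Lim_transform_eventually)
      then show ?thesis by (simp add: 2 V_asym_nth mult_ac)
    qed
  qed
  \<comment> \<open>A bound on the variance of a summand that does not depend on i, obtained from
    the fact that a mixed moment is at most the sum of the two second moments.\<close>
  define v where "v n = (\<Sum>j\<in>UNIV. \<Sum>l\<in>UNIV. \<bar>\<alpha> n j * \<alpha> n l\<bar>
      * (real (K n j) / real (N n j) + real (K n l) / real (N n l)))" for n
  have mle: "\<bar>m n j l\<bar> \<le> m n j j + m n l l" for n j l
  proof -
    have "\<bar>m n j l\<bar> \<le> expectation (\<lambda>\<omega>. \<bar>tail.\<zeta> j n (X \<omega>)
        * tail.\<zeta> l n (X \<omega>)\<bar>)" unfolding m_def by (rule integral_abs_bound)
    also have "\<dots> \<le> expectation (\<lambda>\<omega>. tail.\<zeta> j n (X \<omega>)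
        * tail.\<zeta> j n (X \<omega>) + tail.\<zeta> l n (X \<omega>) * tail.\<zeta> l n (X \<omega>))"
    proof (intro integral_mono Bochner_Integration.integrable_add integrable_abs integrable_\<zeta>_prod)
      have "\<bar>p * q\<bar> \<le> p * p + q * q" for p q :: real
        using sum_squares_bound[of "\<bar>p\<bar>" "\<bar>q\<bar>"] mult_nonneg_nonneg[OF abs_ge_zero[of p]
            abs_ge_zero[of q]]
        unfolding power2_abs abs_mult power2_eq_square by linarith
      then show "\<bar>tail.\<zeta> j n (X \<omega>) * tail.\<zeta> l n (X \<omega>)\<bar>
          \<le> tail.\<zeta> j n (X \<omega>) * tail.\<zeta> j n (X \<omega>)
          + tail.\<zeta> l n (X \<omega>) * tail.\<zeta> l n (X \<omega>)" for \<omega> .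
    qed
    also have "\<dots> = m n j j + m n l l" unfolding m_def
        by (intro Bochner_Integration.integral_add integrable_\<zeta>_prod)
    finally show ?thesis .
  qed
  have vlim: "v \<longlonglongrightarrow> 0"
  proof -
    have \<alpha>K: "(\<lambda>n. \<bar>\<alpha> n j * \<alpha> n l\<bar>)
        \<longlonglongrightarrow> 0" for j l
    proof -
      have z: "(\<lambda>n. \<alpha> n j) \<longlonglongrightarrow> 0" for j
      proof -
        have "(\<lambda>n. w $ j * (sqrt (k_total n / real (K n j)) * (1 / sqrt (real (K n j)))
            * \<gamma>)) \<longlonglongrightarrow> w $ j * (sqrt (c_inv_sum * c $ j) * 0 * \<gamma>)"
          by (intro tendsto_mult tendsto_const tendsto_real_sqrt k_total_ratio
              tendsto_divide_0[OF tendsto_const filterlim_at_top_imp_at_infinity[OF tail.sqrt_K_top]])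
        then show ?thesis unfolding \<alpha>_def by (simp add: real_sqrt_divide)
      qed
      show ?thesis using tendsto_rabs_zero[OF tendsto_mult_zero[OF z z]] .
    qed
    have "v \<longlonglongrightarrow> (\<Sum>j\<in>(UNIV::'m set). \<Sum>l\<in>(UNIV::'m set). 0 * (0 + 0))"
      unfolding v_def by (intro tendsto_sum tendsto_mult \<alpha>K tendsto_add K_N_0)
    then show ?thesis by simp
  qed
  have third_le: "\<forall>\<^sub>F n in sequentially. (\<forall>i. integrable M (\<lambda>\<omega>.
      \<bar>?\<psi> n i (X \<omega>)\<bar> ^ 3) \<and>
     expectation (\<lambda>\<omega>. \<bar>?\<psi> n i (X \<omega>)\<bar> ^ 3)
         \<le> real CARD('m) ^ 3 * (\<Sum>j\<in>UNIV. of_bool (i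
         \<le> N n j) * \<bar>\<alpha> n j\<bar> ^ 3 * (real (K n j) / real (N n j) * tail.abs_moment3 j)))"
    using eventually_good
  proof eventually_elim
    case (elim n)
    show ?case
    proof
      fix i
      have \<tau>: "0 \<le> tail.\<tau> j n" and e\<tau>: "exp (- tail.\<tau> j n)
          = real (K n j) / real (N n j)" for j
        using elim less_imp_le by blast+
      let ?B = "\<lambda>\<omega>. real CARD('m) ^ 3 * (\<Sum>j\<in>UNIV. of_bool (i
          \<le> N n j) * \<bar>\<alpha> n j\<bar> ^ 3 * \<bar>tail.\<zeta> j n (X \<omega>)\<bar> ^ 3)"
      have le: "\<bar>?\<psi> n i (X \<omega>)\<bar> ^ 3 \<le> ?B \<omega>" for \<omega>
        using sum_abs_power3_le[of "\<lambda>j. of_bool (i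
            \<le> N n j) * \<alpha> n j * tail.\<zeta> j n (X \<omega>)"]
        by (simp add: abs_mult power_mult_distrib of_bool_def if_distrib[of "\<lambda>x. x ^ 3"] cong:
            if_cong)
      have iB: "integrable M ?B"
        by (intro integrable_mult_right Bochner_Integration.integrable_sum tail.\<zeta>_moments(3) \<tau>)
      have i3: "integrable M (\<lambda>\<omega>. \<bar>?\<psi> n i (X \<omega>)\<bar> ^ 3)"
        by (rule Bochner_Integration.integrable_bound[OF iB])
          (auto intro!: AE_I2 order_trans[OF le] abs_ge_self)
      have "expectation (\<lambda>\<omega>. \<bar>?\<psi> n i (X \<omega>)\<bar> ^ 3) \<le> expectation ?B"
        by (rule integral_mono[OF i3 iB le])
      also have "\<dots> = real CARD('m) ^ 3 * (\<Sum>j\<in>UNIV. of_bool (i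
          \<le> N n j) * \<bar>\<alpha> n j\<bar> ^ 3 * (real (K n j) / real (N n j) * tail.abs_moment3 j))"
        unfolding integral_mult_right_zero
        by (subst Bochner_Integration.integral_sum)
          (auto simp: tail.\<zeta>_moments(4)[OF \<tau>] e\<tau> intro!: integrable_mult_right
              tail.\<zeta>_moments(3) \<tau> simp del: sum_of_bool_mult_eq)
      finally show "integrable M (\<lambda>\<omega>. \<bar>?\<psi> n i (X \<omega>)\<bar> ^ 3) \<and>
        expectation (\<lambda>\<omega>. \<bar>?\<psi> n i (X \<omega>)\<bar> ^ 3)
            \<le> real CARD('m) ^ 3 * (\<Sum>j\<in>UNIV. of_bool (i
            \<le> N n j) * \<bar>\<alpha> n j\<bar> ^ 3 * (real (K n j) / real (N n j) * tail.abs_moment3 j))"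
        using i3 by blast
    qed
  qed
  have "(\<lambda>n. char (distr M borel (\<lambda>\<omega>. \<Sum>i=1..n. ?\<psi> n i (Xs i \<omega>))) t)
     \<longlonglongrightarrow> complex_of_real (exp (- (t\<^sup>2
         * (w \<bullet> (V_asym \<gamma> R c b *v w)) / 2)))"
  proof (rule lyapunov_clt[OF _ _ vlim sum2])
    show "?\<psi> n i \<in> borel_measurable borel" for n i
      by (intro borel_measurable_sum borel_measurable_times borel_measurable_const tail.\<zeta>_measurable)
    show "\<forall>\<^sub>F n in sequentially. \<forall>i\<in>{1..n}. integrable M (\<lambda>\<omega>.
        \<bar>?\<psi> n i (X \<omega>)\<bar> ^ 3) \<and>
          expectation (\<lambda>\<omega>. ?\<psi> n i (X \<omega>))
              = 0 \<and> expectation (\<lambda>\<omega>. (?\<psi> n i (X \<omega>))\<^sup>2) \<le> v n"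
      using third_le eventually_good mdiag_all
    proof eventually_elim
      case (elim n)
      show ?case
      proof (intro ballI conjI)
        fix i
        show "integrable M (\<lambda>\<omega>. \<bar>?\<psi> n i (X \<omega>)\<bar> ^ 3)" using elim(1)
            by blast
        have "expectation (\<lambda>\<omega>. tail.\<zeta> j n (X \<omega>)) = 0" for j
          using elim(2) less_imp_le by (intro tail.\<zeta>_moments(1)) blast
        then show "expectation (\<lambda>\<omega>. ?\<psi> n i (X \<omega>)) = 0"
          by (subst Bochner_Integration.integral_sum) (auto intro!: integrable_mult_right
              tail.integrable_\<zeta> simp del: sum_of_bool_mult_eq)
        show "expectation (\<lambda>\<omega>. (?\<psi> n i (X \<omega>))\<^sup>2) \<le> v n"
          unfolding E2 v_def
        proof (intro sum_mono)
          fix j l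
          have "of_bool (i \<le> N n j) * of_bool (i
              \<le> N n l) * (\<alpha> n j * \<alpha> n l) * m n j l \<le> \<bar>of_bool (i
              \<le> N n j) * of_bool (i \<le> N n l) * (\<alpha> n j * \<alpha> n l) * m n j l\<bar>"
            by (rule abs_ge_self)
          also have "\<dots> \<le> \<bar>\<alpha> n j * \<alpha> n l\<bar> * \<bar>m n j l\<bar>"
              by (simp add: abs_mult of_bool_def)
          also have "\<dots> \<le> \<bar>\<alpha> n j * \<alpha> n l\<bar> * (real (K n j) / real (N n j)
              + real (K n l) / real (N n l))"
            using mle[of n j l] elim(3) by (intro mult_left_mono) auto
          finally show "of_bool (i \<le> N n j) * of_bool (i
              \<le> N n l) * (\<alpha> n j * \<alpha> n l) * m n j l \<le> \<dots>" .
        qed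
      qed
    qed
    show "(\<lambda>n. \<Sum>i=1..n. expectation (\<lambda>\<omega>. \<bar>?\<psi> n i (X \<omega>)\<bar> ^
        3)) \<longlonglongrightarrow> 0"
    proof (rule tendsto_sandwich[OF _ _ tendsto_const])
      show "\<forall>\<^sub>F n in sequentially. 0 \<le> (\<Sum>i=1..n. expectation (\<lambda>\<omega>.
          \<bar>?\<psi> n i (X \<omega>)\<bar> ^ 3))"
        by (intro always_eventually allI sum_nonneg Bochner_Integration.integral_nonneg) simp
      \<comment> \<open>In N |alpha|^3 (K / N) the sizes N cancel, and the remaining powers of K are
        arranged as convergent ratios \<open>k_total\<close> / K times the vanishing factor 1 / sqrt
        K.\<close>
      let ?U = "\<lambda>n. real CARD('m) ^ 3 * (\<Sum>j\<in>UNIV. \<bar>w $ j\<bar> ^ 3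
          * ((sqrt (k_total n / real (K n j))) ^ 3 * \<gamma> ^ 3 * (1 / sqrt (real (K n j))))
          * tail.abs_moment3 j)"
      show "\<forall>\<^sub>F n in sequentially. (\<Sum>i=1..n. expectation (\<lambda>\<omega>. \<bar>?\<psi>
          n i (X \<omega>)\<bar> ^ 3)) \<le> ?U n"
        using third_le eventually_good
      proof eventually_elim
        case (elim n)
        have "(\<Sum>i=1..n. expectation (\<lambda>\<omega>. \<bar>?\<psi> n i (X \<omega>)\<bar> ^ 3))
          \<le> (\<Sum>i=1..n. real CARD('m) ^ 3 * (\<Sum>j\<in>UNIV. of_bool (i
              \<le> N n j) * \<bar>\<alpha> n j\<bar> ^ 3 * (real (K n j) / real (N n j)
              * tail.abs_moment3 j)))"
          using elim(1) by (intro sum_mono) blast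
        also have "\<dots> = real CARD('m) ^ 3 * (\<Sum>j\<in>UNIV. \<Sum>i=1..n. of_bool (i
            \<le> N n j) * \<bar>\<alpha> n j\<bar> ^ 3 * (real (K n j) / real (N n j) * tail.abs_moment3 j))"
          unfolding sum_distrib_left[symmetric] by (subst sum.swap) (rule refl)
        also have "\<dots> = real CARD('m) ^ 3 * (\<Sum>j\<in>UNIV. real (N n j)
            * \<bar>\<alpha> n j\<bar> ^ 3 * (real (K n j) / real (N n j) * tail.abs_moment3 j))"
          unfolding sum_distrib_right[symmetric] sum_of_bool_le_index[OF N_le] ..
        also have "\<dots> = ?U n"
        proof (intro arg_cong[where f="\<lambda>x. real CARD('m) ^ 3 * x"] sum.cong refl)
          fix j
          define s where "s = sqrt (real (K n j))"
          have K: "0 < K n j" "0 < N n j" using elim(2) by (metis, metis gr0I not_less0)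
          then have s: "s > 0" "real (K n j) = s * s" by (simp_all add: s_def)
          have sq: "sqrt (k_total n / real (K n j)) = sqrt (k_total n) / s"
              by (simp add: s_def real_sqrt_divide)
          have \<alpha>3: "\<bar>\<alpha> n j\<bar> ^ 3
              = \<bar>w $ j\<bar> ^ 3 * (sqrt (k_total n) / (s * s)) ^ 3 * \<gamma> ^ 3"
            unfolding \<alpha>_def s(2) abs_mult power_mult_distrib
                using \<gamma>_pos k_total_nonneg[of n] s(1) by simp
          show "real (N n j) * \<bar>\<alpha> n j\<bar> ^ 3 * (real (K n j) / real (N n j)
              * tail.abs_moment3 j)
            = \<bar>w $ j\<bar> ^ 3 * ((sqrt (k_total n / real (K n j))) ^ 3 * \<gamma> ^ 3 * (1
                / sqrt (real (K n j)))) * tail.abs_moment3 j"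
            unfolding \<alpha>3 sq unfolding s_def[symmetric] s(2) using K s(1)
                by (simp add: field_simps power3_eq_cube)
        qed
        finally show ?case .
      qed
      have "?U \<longlonglongrightarrow> real CARD('m) ^ 3 * (\<Sum>j\<in>UNIV. \<bar>w $ j\<bar> ^ 3
          * ((sqrt (c_inv_sum * c $ j)) ^ 3 * \<gamma> ^ 3 * 0) * tail.abs_moment3 j)"
        by (intro tendsto_mult tendsto_const tendsto_sum tendsto_power tendsto_real_sqrt k_total_ratio
            tendsto_divide_0[OF tendsto_const filterlim_at_top_imp_at_infinity[OF tail.sqrt_K_top]])
      then show "?U \<longlonglongrightarrow> 0" by simp
    qed
  qed
  then show ?thesis unfolding \<alpha>_def eq[unfolded \<alpha>_def] .
qed

end

section \<open>Empirical tail dependence\<close>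

context iid_sample
begin

text \<open>Weak law for counts of order k: indicators are idempotent, so the scaled second moment
  is the scaled mean divided by k.\<close>

lemma count_limit:
  fixes P :: "nat \<Rightarrow> 'b \<Rightarrow> bool"
  assumes [measurable]: "\<And>n. Measurable.pred borel (P n)"
    and k: "filterlim k at_top sequentially"
    and lim: "(\<lambda>n. real (N' n) * prob {\<omega>\<in>space M. P n (X \<omega>)}
        / real (k n)) \<longlonglongrightarrow> r"
  shows "((\<lambda>z. (\<Sum>i=1..N' (fst z). of_bool (P (fst z) (Xs i (snd z))))
      / real (k (fst z))) \<longlongrightarrow> r) in_prob"
proof -
  let ?\<phi> = "\<lambda>n x. of_bool (P n x) / real (k n)"
  have k': "filterlim (\<lambda>n. real (k n)) at_top sequentially"
    by (rule filterlim_compose[OF filterlim_real_sequentially k])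
  have Eb: "expectation (\<lambda>\<omega>. of_bool (P n (X \<omega>)))
      = prob {\<omega>\<in>space M. P n (X \<omega>)}" for n
    by (rule expectation_of_bool) measurable
  have sq: "(?\<phi> n x)\<^sup>2 = ?\<phi> n x / real (k n)" for n x
    by (simp add: power2_eq_square of_bool_def)
  have "((\<lambda>z. \<Sum>i=1..N' (fst z). ?\<phi> (fst z) (Xs i (snd z))) \<longlongrightarrow> r) in_prob"
  proof (rule iid_sum_tendsto)
    show "?\<phi> n \<in> borel_measurable borel" for n by measurable
    show "integrable M (\<lambda>\<omega>. (?\<phi> n (X \<omega>))\<^sup>2)" for n
      by (rule integrable_const_bound[where B="(1 / real (k n))\<^sup>2"]) (auto simp: of_bool_def intro!:
          AE_I2)
    show "(\<lambda>n. real (N' n) * expectation (\<lambda>\<omega>. ?\<phi> n (X \<omega>)))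
        \<longlonglongrightarrow> r"
      using lim by (simp add: Eb)
    have "(\<lambda>n. (real (N' n) * prob {\<omega>\<in>space M. P n (X \<omega>)} / real (k n)) * (1
        / real (k n))) \<longlonglongrightarrow> r * 0"
      by (intro tendsto_mult lim tendsto_divide_0[OF tendsto_const filterlim_at_top_imp_at_infinity[OF k']])
    then show "(\<lambda>n. real (N' n) * expectation (\<lambda>\<omega>. (?\<phi> n (X \<omega>))\<^sup>2))
        \<longlonglongrightarrow> 0"
      unfolding sq by (simp add: Eb mult.assoc)
  qed
  then show ?thesis by (simp add: sum_divide_distrib del: sum_of_bool_eq)
qed

end


text \<open>No distinctness of the observations is needed: an observation whose rank from the top is at most
  \<open>\<xi>\<close> lies above any level with at least \<open>\<xi>\<close> exceedances,
      and conversely.\<close>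
lemma top_rank_sandwich:
  fixes y :: "nat \<Rightarrow> real"
  assumes i: "i \<in> {1..n}"
  shows "\<xi> \<le> (\<Sum>l=1..n. of_bool (y l > \<theta>)) \<Longrightarrow> real (card {l\<in>{1..n}. y l
      > y i}) + 1 \<le> \<xi> \<Longrightarrow> y i > \<theta>"
    and "(\<Sum>l=1..n. of_bool (y l > \<theta>)) \<le> \<xi> \<Longrightarrow> y i > \<theta>
        \<Longrightarrow> real (card {l\<in>{1..n}. y l > y i}) + 1 \<le> \<xi>"
proof -
  have s: "(\<Sum>l=1..n. of_bool (y l > \<theta>)) = real (card {l\<in>{1..n}. y l > \<theta>})"
    by (simp add: Int_def)
  show "y i > \<theta>" if "\<xi> \<le> (\<Sum>l=1..n. of_bool (y l > \<theta>))" "real (card {l\<in>{1..n}.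
      y l > y i}) + 1 \<le> \<xi>"
  proof (rule ccontr)
    assume "\<not> y i > \<theta>"
    then have "card {l\<in>{1..n}. y l > \<theta>} \<le> card {l\<in>{1..n}. y l > y i}"
        by (intro card_mono) auto
    then show False using that unfolding s by linarith
  qed
  show "real (card {l\<in>{1..n}. y l > y i}) + 1 \<le> \<xi>" if "(\<Sum>l=1..n. of_bool (y l > \<theta>))
      \<le> \<xi>" "y i > \<theta>"
  proof -
    have "card (insert i {l\<in>{1..n}. y l > y i}) \<le> card {l\<in>{1..n}. y l > \<theta>}"
      using that i by (intro card_mono) auto
    then have "card {l\<in>{1..n}. y l > y i} + 1 \<le> card {l\<in>{1..n}. y l > \<theta>}" by simp
    then show ?thesis using that unfolding s by linarith
  qed
qed

text \<open>\<open>sample_rank\<close> counts values up to and including y i, so n minus the rank is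
  the number of strictly larger values, ties or not. The correction (n + 1) / n moves into the
  cut-off as the factor 1 + 1 / n.\<close>

lemma rank_condition_iff:
  assumes n: "0 < n" "0 < k"
  shows "(real n + 1 - real (sample_rank n i y)) / (real k * (real n + 1) / real n) \<le> u
    \<longleftrightarrow> real (card {l\<in>{1..n}. y l > y i}) + 1 \<le> u * real k * (1 + 1 / real n)"
proof -
  have "{1..n} = {l\<in>{1..n}. y l \<le> y i} \<union> {l\<in>{1..n}. y l > y i}" by auto
  then have "n = card ({l\<in>{1..n}. y l \<le> y i} \<union> {l\<in>{1..n}. y l > y i})"
      by (metis card_atLeastAtMost diff_Suc_1)
  also have "\<dots> = card {l\<in>{1..n}. y l \<le> y i} + card {l\<in>{1..n}. y l > y i}"
      by (rule card_Un_disjoint) auto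
  finally have "real n - real (sample_rank n i y) = real (card {l\<in>{1..n}. y l > y i})"
    unfolding sample_rank_def by linarith
  moreover have "real k * (real n + 1) / real n = real k * (1 + 1 / real n)" using n
      by (simp add: field_simps)
  moreover have "0 < real k * (1 + 1 / real n)" using n by (simp add: add_pos_nonneg)
  ultimately show ?thesis by (simp add: pos_divide_le_eq mult.assoc) linarith
qed

context pooled_sample
begin

text \<open>Rank cut-offs are random levels. Marginal counts locate them between deterministic
  levels for u - \<open>\<delta>\<close> and u + \<open>\<delta>\<close>, and likewise for v; joint
  counts at deterministic levels obey the weak law, and continuity of R lets \<open>\<delta>\<close>
  shrink.\<close>

lemma R_hat_consistent:
  assumes jl: "j < l"
  shows "((\<lambda>z. R_hat (\<lambda>i. Xs i (snd z)) (N (fst z)) (K (fst z)) j l (real (K (fst z) j)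
      / real (K (fst z) l)) (real (N (fst z) j) / real (N (fst z) l)))
     \<longlongrightarrow> Rr j l (c $ l / c $ j) (b $ l / b $ j)) in_prob"
proof -
  define u where "u = c $ l / c $ j"
  define v where "v = b $ l / b $ j"
  have u: "u > 0" and v: "v > 0" using b_pos c_pos by (auto simp: u_def v_def)
  \<comment> \<open>When the two sample sizes coincide the estimator uses the effective size of l
    instead of j. Both cases are covered, because from here on only k \<longlonglongrightarrow>
    \<infinity> and k / N' \<longlonglongrightarrow> 0 are used about the choice.\<close>
  define k where "k n = (if N n j < N n l then K n j else K n l)" for n
  define N' where "N' n = N n j" for n
  have minN: "min (N n j) (N n l) = N' n" for n
    using N_mono[of n] jl by (simp add: N'_def mono_def min_absorb1)
  have Njl: "N n j \<le> N n l" for n using N_mono[of n] jl by (simp add: mono_def)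
  have k_top: "filterlim k at_top sequentially"
  proof -
    have "\<forall>\<^sub>F n in sequentially. Z \<le> k n" for Z
      using K_at_top[of j, unfolded filterlim_at_top, rule_format, of Z] K_at_top[of l, unfolded
          filterlim_at_top, rule_format, of Z]
      by eventually_elim (simp add: k_def)
    then show ?thesis by (simp add: filterlim_at_top)
  qed
  have k_pos: "\<forall>\<^sub>F n in sequentially. 0 < k n \<and> 0 < N' n"
    using eventually_good
  proof eventually_elim
    case (elim n)
    have "0 < K n j" "0 < K n l" "K n j < N n j" using elim by blast+
    then show ?case by (simp add: k_def N'_def)
  qed
  have kN: "(\<lambda>n. real (k n) / real (N' n)) \<longlonglongrightarrow> 0"
  proof (rule tendsto_sandwich[OF _ _ tendsto_const])
    show "\<forall>\<^sub>F n in sequentially. real (k n) / real (N' n)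
        \<le> real (K n j) / real (N n j) + real (K n l) / real (N n l)"
    proof (intro always_eventually allI)
      fix n
      show "real (k n) / real (N' n) \<le> real (K n j) / real (N n j) + real (K n l) / real (N n l)"
        using Njl[of n] by (auto simp: k_def N'_def)
    qed
    show "(\<lambda>n. real (K n j) / real (N n j) + real (K n l) / real (N n l)) \<longlonglongrightarrow> 0"
      using tendsto_add[OF K_N_0[of j] K_N_0[of l]] by simp
  qed simp
  define S where "S n = real (N' n) / real (k n)" for n
  have S_top: "filterlim S at_top sequentially"
  proof -
    have "filterlim (\<lambda>n. inverse (real (k n) / real (N' n))) at_top sequentially"
      by (rule filterlim_inverse_at_top[OF kN], rule eventually_mono[OF k_pos]) simp
    then show ?thesis by (simp add: S_def[abs_def])
  qed
  \<comment> \<open>The level with expected count y k among N' scores: its exceedance probability is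
    y / S = y k / N'.\<close>
  define \<theta> where "\<theta> n y = - ln (y / S n)" for n y
  have \<theta>_ev: "\<forall>\<^sub>F n in sequentially. 0 < \<theta> n y \<and> exp (- \<theta> n y)
      = y / S n" if "y > 0" for y
  proof -
    have "\<forall>\<^sub>F n in sequentially. y < S n" using S_top by (simp add: filterlim_at_top_dense)
    then show ?thesis
    proof eventually_elim
      case (elim n)
      then have "0 < y / S n" "y / S n < 1" using that by auto
      then show ?case by (simp add: \<theta>_def)
    qed
  qed
  let ?e = "\<lambda>h x. marg.logS h (x $ h)"
  define cnt where "cnt h y z = (\<Sum>i=1..N' (fst z). of_bool (?e h (Xs i (snd z)) > \<theta> (fst z) y))
      / real (k (fst z))" for h y and z :: "nat \<times> 'a"
  define joint where "joint y y' z = (\<Sum>i=1..N' (fst z). of_bool (?e j (Xs i (snd z)) > \<theta> (fst z)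
      y \<and> ?e l (Xs i (snd z)) > \<theta> (fst z) y')) / real (k (fst z))" for y y'
      and z :: "nat \<times> 'a"
  have em[measurable]: "(\<lambda>x. ?e h x) \<in> borel_measurable borel" for h by (rule tail.e_measurable)
  have cnt: "(cnt h y \<longlongrightarrow> y) in_prob" if y: "y > 0" for h y
    unfolding cnt_def
  proof (rule count_limit[OF _ k_top])
    have "\<forall>\<^sub>F n in sequentially. y = real (N' n)
        * prob {\<omega>\<in>space M. ?e h (X \<omega>) > \<theta> n y} / real (k n)"
      using \<theta>_ev[OF y] k_pos
    proof eventually_elim
      case (elim n)
      have "prob {\<omega>\<in>space M. ?e h (X \<omega>) > \<theta> n y} = y / S n"
        using tail.expectation_exceedance[of "\<theta> n y" h] expectation_of_bool[of "\<lambda>\<omega>. ?e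
            h (X \<omega>) > \<theta> n y"] elim by simp
      then show ?case using elim by (simp add: S_def)
    qed
    then show "(\<lambda>n. real (N' n) * prob {\<omega>\<in>space M. ?e h (X \<omega>) > \<theta> n y}
        / real (k n)) \<longlonglongrightarrow> y"
      by (rule Lim_transform_eventually[OF tendsto_const])
  qed measurable
  have joint: "(joint y y' \<longlongrightarrow> Rr j l y y') in_prob" if y: "y > 0" "y' > 0" for y y'
    unfolding joint_def
  proof (rule count_limit[OF _ k_top])
    have "\<forall>\<^sub>F n in sequentially. S n * copula j l (y / S n) (y' / S n)
      = real (N' n) * prob {\<omega>\<in>space M. ?e j (X \<omega>) > \<theta> n y
          \<and> ?e l (X \<omega>) > \<theta> n y'} / real (k n)"
      using \<theta>_ev[OF y(1)] \<theta>_ev[OF y(2)]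
      by eventually_elim (simp add: prob_joint_exceedance S_def)
    moreover have "(\<lambda>n. S n * copula j l (y / S n) (y' / S n)) \<longlonglongrightarrow> Rr j l y y'"
      using jl y S_top by (intro copula_limit tendsto_const) auto
    ultimately show "(\<lambda>n. real (N' n) * prob {\<omega>\<in>space M. ?e j (X \<omega>) > \<theta> n y
        \<and> ?e l (X \<omega>) > \<theta> n y'} / real (k n)) \<longlonglongrightarrow> Rr j l y y'"
      by (rule Lim_transform_eventually[rotated])
  qed measurable
  \<comment> \<open>The cut-off of \<open>rank_condition_iff\<close>; after division by k it has the
    same limit as a, because the correction 1 + 1 / N' disappears.\<close>
  define \<xi> where "\<xi> a n = a n * real (k n) * (1 + 1
      / real (N' n))" for a :: "nat \<Rightarrow> real" and n
  have \<xi>: "((\<lambda>z. \<xi> a (fst z) / real (k (fst z)))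
      \<longlongrightarrow> r) in_prob" if a: "a \<longlonglongrightarrow> r" for a r
  proof (rule tendsto_in_prob_const)
    have "filterlim (\<lambda>n. real (N' n)) at_top sequentially"
      unfolding N'_def by (rule filterlim_compose[OF filterlim_real_sequentially N_at_top])
    then have "(\<lambda>n. a n * (1 + 1 / real (N' n))) \<longlonglongrightarrow> r * (1 + 0)"
      by (intro tendsto_mult a tendsto_add tendsto_const tendsto_divide_0[OF tendsto_const]
          filterlim_at_top_imp_at_infinity)
    moreover have "\<forall>\<^sub>F n in sequentially. a n * (1 + 1 / real (N' n)) = \<xi> a n / real (k n)"
      using k_pos by eventually_elim (simp add: \<xi>_def)
    ultimately show "(\<lambda>n. \<xi> a n / real (k n)) \<longlonglongrightarrow> r"
        by (simp add: Lim_transform_eventually)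
  qed
  let ?un = "\<lambda>n. real (K n j) / real (K n l)" and ?vn = "\<lambda>n. real (N n j) / real (N n l)"
  have un: "?un \<longlonglongrightarrow> u" unfolding u_def by (rule K_ratio2)
  have vn: "?vn \<longlonglongrightarrow> v" unfolding v_def by (rule N_ratio2)
  let ?Rh = "\<lambda>z. R_hat (\<lambda>i. Xs i (snd z)) (N (fst z)) (K (fst z)) j l (?un (fst z)) (?vn (fst
      z))"
  have reg: "\<forall>\<^sub>F z in in_prob. \<forall>h. \<forall>i\<in>{1..N' (fst z)}. marg.regular h (Xs i
      (snd z) $ h)"
  proof (rule eventually_in_prob_AE[where Q="\<lambda>n \<omega>. \<forall>h. \<forall>i\<in>{1..N' n}.
      marg.regular h (Xs i \<omega> $ h)"])
    fix n
    have "AE \<omega> in M. marg.regular h (Xs i \<omega> $ h)" if "i \<in> {1..N' n}" for h i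
    proof (rule AE_Xs)
      show "Measurable.pred borel (\<lambda>x. marg.regular h (x $ h))"
        by (rule measurable_compose[OF measurable_vec_nth[OF measurable_ident] marg.regular_measurable,
            unfolded id_def])
    qed (use that marg.AE_regular in auto)
    then have "AE \<omega> in M. \<forall>h\<in>UNIV. \<forall>i\<in>{1..N' n}. marg.regular h (Xs i \<omega>
        $ h)"
      by (intro AE_finite_allI) auto
    then show "AE \<omega> in M. \<forall>h. \<forall>i\<in>{1..N' n}. marg.regular h (Xs i \<omega> $ h)"
        by simp
  qed
  \<comment> \<open>Once the four marginal counts are ordered correctly against the cut-offs, the
    comparison of rank conditions with level conditions holds for all observations simultaneously,
    so the joint sums are ordered.\<close>
  have sandwich: "\<forall>\<^sub>F z in in_prob. joint (u - \<delta>) (v - \<delta>) z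
      \<le> ?Rh z \<and> ?Rh z \<le> joint (u + \<delta>) (v + \<delta>) z"
    if \<delta>: "0 < \<delta>" "\<delta> < u" "\<delta> < v" for \<delta>
  proof -
    have lt: "\<forall>\<^sub>F z in in_prob. f z < g z" if "(f
        \<longlongrightarrow> p) in_prob" "(g \<longlongrightarrow> q) in_prob" "p
        < q" for f g :: "nat \<times> 'a \<Rightarrow> real" and p q
    proof -
      have "\<forall>\<^sub>F z in in_prob. 0 < g z - f z"
        by (rule order_tendstoD(1)[OF tendsto_diff[OF that(2,1)]]) (use that(3) in simp)
      then show ?thesis by eventually_elim simp
    qed
    have "\<forall>\<^sub>F z in in_prob. cnt j (u - \<delta>) z < \<xi> ?un (fst z) / real (k (fst z))"
      "\<forall>\<^sub>F z in in_prob. \<xi> ?un (fst z) / real (k (fst z)) < cnt j (u + \<delta>) z"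
      "\<forall>\<^sub>F z in in_prob. cnt l (v - \<delta>) z < \<xi> ?vn (fst z) / real (k (fst z))"
      "\<forall>\<^sub>F z in in_prob. \<xi> ?vn (fst z) / real (k (fst z)) < cnt l (v + \<delta>) z"
      using \<delta> u v by (rule_tac [!] lt[OF cnt \<xi>[OF un]] lt[OF \<xi>[OF un] cnt] lt[OF cnt \<xi>[OF
          vn]] lt[OF \<xi>[OF vn] cnt]; simp)+
    then show ?thesis using reg eventually_in_prob_sequentially[OF k_pos]
    proof eventually_elim
      case (elim z)
      obtain n \<omega> where z: "z = (n, \<omega>)" by (cases z)
      have kp: "0 < k n" "0 < N' n" using elim z by auto
      let ?q = "\<lambda>i h a. (real (N' n) + 1 - real (sample_rank (N' n) i (\<lambda>i'. Xs i' \<omega> $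
          h))) / (real (k n) * (real (N' n) + 1) / real (N' n)) \<le> a"
      have Rh: "?Rh z = (\<Sum>i=1..N' n. of_bool (?q i j (?un n) \<and> ?q i l (?vn n))) / real (k n)"
        unfolding R_hat_def Let_def z fst_conv snd_conv minN k_def[symmetric] by simp
      have q: "?q i h (a n) \<longleftrightarrow> real (card {l'\<in>{1..N' n}. ?e h (Xs l' \<omega>) > ?e h
          (Xs i \<omega>)}) + 1 \<le> \<xi> a n"
        if "i \<in> {1..N' n}" for i h a
      proof -
        have "{l'\<in>{1..N' n}. ?e h (Xs l' \<omega>) > ?e h (Xs i \<omega>)}
            = {l'\<in>{1..N' n}. Xs l' \<omega> $ h > Xs i \<omega> $ h}"
          using elim(5) that marg.regular_logS_less_iff[of h] z by auto
        then show ?thesis unfolding rank_condition_iff[OF kp(2,1)] \<xi>_def by simp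
      qed
      have c: "(\<Sum>i=1..N' n. of_bool (?e j (Xs i \<omega>) > \<theta> n (u - \<delta>)))
          \<le> \<xi> ?un n"
        "\<xi> ?un n \<le> (\<Sum>i=1..N' n. of_bool (?e j (Xs i \<omega>) > \<theta> n (u + \<delta>)))"
        "(\<Sum>i=1..N' n. of_bool (?e l (Xs i \<omega>) > \<theta> n (v - \<delta>))) \<le> \<xi> ?vn n"
        "\<xi> ?vn n \<le> (\<Sum>i=1..N' n. of_bool (?e l (Xs i \<omega>) > \<theta> n (v + \<delta>)))"
        using elim(1-4) kp unfolding z fst_conv snd_conv cnt_def
            by (simp_all add: divide_less_cancel del: sum_of_bool_eq)
      show ?case
        unfolding Rh unfolding joint_def z fst_conv snd_conv
      proof (intro conjI divide_right_mono sum_mono)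
        fix i assume i: "i \<in> {1..N' n}"
        note up = top_rank_sandwich(1)[OF i, where y="\<lambda>i. ?e j (Xs i \<omega>)", OF c(2)]
            top_rank_sandwich(1)[OF i, where y="\<lambda>i. ?e l (Xs i \<omega>)", OF c(4)]
        note lo = top_rank_sandwich(2)[OF i, where y="\<lambda>i. ?e j (Xs i \<omega>)", OF c(1)]
            top_rank_sandwich(2)[OF i, where y="\<lambda>i. ?e l (Xs i \<omega>)", OF c(3)]
        show "of_bool (?e j (Xs i \<omega>) > \<theta> n (u - \<delta>)
            \<and> ?e l (Xs i \<omega>) > \<theta> n (v - \<delta>))
            \<le> (of_bool (?q i j (?un n) \<and> ?q i l (?vn n)) :: real)"
          unfolding q[OF i, of j ?un] q[OF i, of l ?vn] using lo by simp
        show "(of_bool (?q i j (?un n) \<and> ?q i l (?vn n)) :: real)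
            \<le> of_bool (?e j (Xs i \<omega>) > \<theta> n (u + \<delta>)
            \<and> ?e l (Xs i \<omega>) > \<theta> n (v + \<delta>))"
          unfolding q[OF i, of j ?un] q[OF i, of l ?vn] using up by simp
      qed simp_all
    qed
  qed
  have "(?Rh \<longlongrightarrow> Rr j l u v) in_prob"
  proof (rule tendstoI)
    fix \<epsilon> :: real assume \<epsilon>: "\<epsilon> > 0"
    \<comment> \<open>The Lipschitz bound moves R by at most 2 \<open>\<delta>\<close> \<le>
      \<open>\<epsilon>\<close> / 4, and the joint counts err by less than \<open>\<epsilon>\<close>
      / 4; the halves of u and v keep the lower arguments positive.\<close>
    define \<delta> where "\<delta> = min (\<epsilon> / 8) (min (u / 2) (v / 2))"
    have \<delta>: "0 < \<delta>" "\<delta> < u" "\<delta> < v" "\<delta> \<le> \<epsilon> / 8"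
        using \<epsilon> u v by (auto simp: \<delta>_def)
    have lip: "\<bar>Rr j l (u - \<delta>) (v - \<delta>) - Rr j l u v\<bar>
        \<le> \<epsilon> / 4" "\<bar>Rr j l (u + \<delta>) (v + \<delta>) - Rr j l u v\<bar>
        \<le> \<epsilon> / 4"
      using R_lipschitz[OF less_imp_neq[OF jl], of "u - \<delta>" "v - \<delta>" u v]
        R_lipschitz[OF less_imp_neq[OF jl], of "u + \<delta>" "v + \<delta>" u v] u v \<delta> by auto
    have near: "\<forall>\<^sub>F z in in_prob. dist (joint y y' z) (Rr j l y y')
        < \<epsilon> / 4" if "y > 0" "y' > 0" for y y'
      by (rule tendstoD[OF joint[OF that]]) (use \<epsilon> in simp)
    have pos: "0 < u - \<delta>" "0 < v - \<delta>" "0 < u + \<delta>" "0 < v + \<delta>"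
        using \<delta> u v by auto
    from sandwich[OF \<delta>(1-3)] near[OF pos(1,2)] near[OF pos(3,4)]
    show "\<forall>\<^sub>F z in in_prob. dist (?Rh z) (Rr j l u v) < \<epsilon>"
    proof eventually_elim
      case (elim z)
      then show ?case using lip \<epsilon> unfolding dist_real_def by linarith
    qed
  qed
  then show ?thesis unfolding u_def v_def .
qed

end

section \<open>Weights and normal laws\<close>

text \<open>\<open>matrix_inv\<close> is a choice from the set of two-sided inverses; for singular
  matrices this set is always empty, so the choice is one and the same matrix. This gives
  measurability of the estimated weights on the singular event.\<close>

lemma matrix_inv_singular:
  fixes A B :: "real^'n^'n"
  assumes "\<not> invertible A" "\<not> invertible B"
  shows "matrix_inv A = matrix_inv B"
proof -
  have "(\<lambda>A'. A ** A' = mat 1 \<and> A' ** A = mat 1) = (\<lambda>A'. B ** A'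
      = mat 1 \<and> A' ** B = mat 1)"
    using assms unfolding invertible_def by (auto simp: fun_eq_iff)
  then show ?thesis unfolding matrix_inv_def by simp
qed

lemma matrix_inv_mult_right:
  fixes A :: "real^'n^'n"
  assumes "invertible A"
  shows "A *v (matrix_inv A *v y) = y"
proof -
  have "A ** matrix_inv A = mat 1"
    using assms unfolding invertible_def matrix_inv_def by (metis (mono_tags, lifting) someI_ex)
  then show ?thesis by (simp add: matrix_vector_mul_assoc)
qed

text \<open>Makes the inverse a rational function of the entries: limits and measurability of the
  weights then reduce to those of determinants.\<close>

lemma matrix_inv_cramer:
  fixes A :: "real^'n^'n"
  assumes "det A \<noteq> 0"
  shows "matrix_inv A *v y = (\<chi> k. det (\<chi> i j. if j = k then y $ i else A $ i $ j) / det A)"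
  using cramer[OF assms, of "matrix_inv A *v y" y] matrix_inv_mult_right[of A y] assms
  by (simp add: invertible_det_nz)

lemma tendsto_det:
  fixes A :: "'z \<Rightarrow> real^'n^'n"
  assumes "\<And>i j. ((\<lambda>z. A z $ i $ j) \<longlongrightarrow> V $ i $ j) F"
  shows "((\<lambda>z. det (A z)) \<longlongrightarrow> det V) F"
  unfolding det_def by (intro tendsto_sum tendsto_mult tendsto_prod tendsto_const assms)

lemma tendsto_matrix_inv_mult:
  fixes A :: "'z \<Rightarrow> real^'n^'n"
  assumes A: "\<And>i j. ((\<lambda>z. A z $ i $ j) \<longlongrightarrow> V $ i $ j) F"
    and y: "\<And>i. ((\<lambda>z. y z $ i) \<longlongrightarrow> y0 $ i) F" and V: "det V \<noteq> 0"
  shows "((\<lambda>z. (matrix_inv (A z) *v y z) $ k) \<longlongrightarrow> (matrix_inv V *v y0) $ k) F"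
proof (rule Lim_transform_eventually)
  have "((\<lambda>z. (if j = k then y z $ i else A z $ i $ j)) \<longlongrightarrow> (if j
      = k then y0 $ i else V $ i $ j)) F" for i j
    using A y by simp
  then have "((\<lambda>z. det (\<chi> i j. if j = k then y z $ i else A z $ i $ j))
      \<longlongrightarrow> det (\<chi> i j. if j = k then y0 $ i else V $ i $ j)) F"
    by (intro tendsto_det) simp
  then show "((\<lambda>z. det (\<chi> i j. if j = k then y z $ i else A z $ i $ j)
      / det (A z)) \<longlongrightarrow> (matrix_inv V *v y0) $ k) F"
    unfolding matrix_inv_cramer[OF V] using V by (simp add: tendsto_divide tendsto_det[OF A])
  have "\<forall>\<^sub>F z in F. det (A z) \<noteq> 0"
      by (rule tendsto_imp_eventually_ne[OF tendsto_det[OF A] V])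
  then show "\<forall>\<^sub>F z in F. det (\<chi> i j. if j = k then y z $ i else A z $ i $ j) / det (A z)
      = (matrix_inv (A z) *v y z) $ k"
    by eventually_elim (simp add: matrix_inv_cramer)
qed

lemma borel_measurable_det:
  fixes A :: "'a \<Rightarrow> real^'n^'n"
  assumes [measurable]: "\<And>i j. (\<lambda>\<omega>. A \<omega> $ i $ j) \<in> borel_measurable M"
  shows "(\<lambda>\<omega>. det (A \<omega>)) \<in> borel_measurable M"
  unfolding det_def by measurable

lemma borel_measurable_matrix_inv_mult:
  fixes A :: "'a \<Rightarrow> real^'n^'n"
  assumes A: "\<And>i j. (\<lambda>\<omega>. A \<omega> $ i $ j) \<in> borel_measurable M"
    and y: "\<And>i. (\<lambda>\<omega>. y \<omega> $ i) \<in> borel_measurable M"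
  shows "(\<lambda>\<omega>. (matrix_inv (A \<omega>) *v y \<omega>) $ k) \<in> borel_measurable M"
proof -
  note A[measurable] y[measurable] borel_measurable_det[OF A, measurable]
  \<comment> \<open>The common value of all singular inverses, represented by the zero matrix; with
    it the function is explicit on the event of vanishing determinant.\<close>
  let ?C = "matrix_inv (0 :: real^'n^'n)"
  have "\<not> invertible (0 :: real^'n^'n)"
    using matrix_inv_mult_right[of "0 :: real^'n^'n" 1] by (auto simp: vec_eq_iff)
  then have sing: "matrix_inv (A \<omega>) = ?C" if "det (A \<omega>) = 0" for \<omega>
    using matrix_inv_singular[of "A \<omega>" 0] that unfolding invertible_det_nz by blast
  have eq: "(\<lambda>\<omega>. (matrix_inv (A \<omega>) *v y \<omega>) $ k)
      = (\<lambda>\<omega>. if det (A \<omega>) \<noteq> 0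
      then det (\<chi> i j. if j = k then y \<omega> $ i else A \<omega> $ i $ j)
          / det (A \<omega>) else (\<Sum>j\<in>UNIV. ?C $ k $ j * y \<omega> $ j))"
  proof
    fix \<omega>
    show "(matrix_inv (A \<omega>) *v y \<omega>) $ k = (if det (A \<omega>) \<noteq> 0
      then det (\<chi> i j. if j = k then y \<omega> $ i else A \<omega> $ i $ j)
          / det (A \<omega>) else (\<Sum>j\<in>UNIV. ?C $ k $ j * y \<omega> $ j))"
    proof (cases "det (A \<omega>) = 0")
      case True
      then show ?thesis by (simp only: sing) (simp add: True matrix_vector_mult_def)
    next
      case False
      then show ?thesis by (simp add: matrix_inv_cramer)
    qed
  qed
  have [measurable]: "(\<lambda>\<omega>. det (\<chi> i j. if j
      = k then y \<omega> $ i else A \<omega> $ i $ j)) \<in> borel_measurable M"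
    by (rule borel_measurable_det) (simp add: A y)
  show ?thesis unfolding eq by measurable
qed

section \<open>Convergence and measurability of the weights\<close>

lemma inner_one_vec: "1 \<bullet> x = (\<Sum>k\<in>UNIV. x $ k)" for x :: "real^'n"
  by (simp add: inner_vec_def)

lemma tendsto_inner_vec:
  fixes x y :: "'z \<Rightarrow> real^'n"
  assumes "\<And>i. ((\<lambda>z. x z $ i) \<longlongrightarrow> x0 $ i) F" "\<And>i. ((\<lambda>z. y z $ i)
      \<longlongrightarrow> y0 $ i) F"
  shows "((\<lambda>z. x z \<bullet> y z) \<longlongrightarrow> x0 \<bullet> y0) F"
  unfolding inner_vec_def using assms by (intro tendsto_sum) (simp add: tendsto_mult)

lemma borel_measurable_inner_vec:
  fixes x y :: "'a \<Rightarrow> real^'n"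
  assumes "\<And>i. (\<lambda>z. x z $ i) \<in> borel_measurable M" "\<And>i. (\<lambda>z. y z $ i) \<in>
      borel_measurable M"
  shows "(\<lambda>z. x z \<bullet> y z) \<in> borel_measurable M"
  unfolding inner_vec_def using assms by (intro borel_measurable_sum) simp

text \<open>That the weights sum to one is only an eventual statement: where the denominator
  vanishes, division by zero makes all weights 0.\<close>

lemma tendsto_var_weights:
  fixes A :: "'z \<Rightarrow> real^'n^'n"
  assumes A: "\<And>i j. ((\<lambda>z. A z $ i $ j)
      \<longlongrightarrow> V $ i $ j) F" and V: "det V \<noteq> 0"
    and p: "1 \<bullet> (matrix_inv V *v 1) \<noteq> 0"
  shows "((\<lambda>z. var_weights (A z) $ k) \<longlongrightarrow> var_weights V $ k) F"
    and "\<forall>\<^sub>F z in F. 1 \<bullet> var_weights (A z) = 1"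
proof -
  have i: "((\<lambda>z. (matrix_inv (A z) *v 1) $ k) \<longlongrightarrow> (matrix_inv V *v 1) $ k) F" for k
    by (rule tendsto_matrix_inv_mult[OF A _ V]) simp
  have d: "((\<lambda>z. 1 \<bullet> (matrix_inv (A z) *v 1))
      \<longlongrightarrow> 1 \<bullet> (matrix_inv V *v 1)) F"
    by (rule tendsto_inner_vec[OF _ i]) simp
  show "((\<lambda>z. var_weights (A z) $ k) \<longlongrightarrow> var_weights V $ k) F"
    unfolding var_weights_def using tendsto_mult[OF tendsto_divide[OF tendsto_const[of 1] d p] i] by simp
  show "\<forall>\<^sub>F z in F. 1 \<bullet> var_weights (A z) = 1"
    using tendsto_imp_eventually_ne[OF d p]
    by eventually_elim (simp add: var_weights_def)
qed

definition amse_denom :: "real^'n \<Rightarrow> real^'n^'n \<Rightarrow> real" where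
  "amse_denom B V = (1 + B \<bullet> (matrix_inv V *v B)) * (1 \<bullet> (matrix_inv V *v 1))
      - (1 \<bullet> (matrix_inv V *v B))\<^sup>2"

lemma one_inner_amse_weights:
  assumes "amse_denom B V \<noteq> 0"
  shows "1 \<bullet> amse_weights B V = 1"
  using assms unfolding amse_weights_def amse_denom_def[symmetric] inner_scaleR_right inner_diff_right
  by (simp add: amse_denom_def power2_eq_square)

lemma tendsto_amse_weights:
  fixes A :: "'z \<Rightarrow> real^'n^'n"
  assumes A: "\<And>i j. ((\<lambda>z. A z $ i $ j)
      \<longlongrightarrow> V $ i $ j) F" and V: "det V \<noteq> 0"
    and C: "\<And>i. ((\<lambda>z. C z $ i) \<longlongrightarrow> B $ i) F"
    and p: "amse_denom B V \<noteq> 0"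
  shows "((\<lambda>z. amse_weights (C z) (A z) $ k) \<longlongrightarrow> amse_weights B V $ k) F"
    and "\<forall>\<^sub>F z in F. 1 \<bullet> amse_weights (C z) (A z) = 1"
proof -
  have i: "((\<lambda>z. (matrix_inv (A z) *v 1) $ k) \<longlongrightarrow> (matrix_inv V *v 1) $ k) F" for k
    by (rule tendsto_matrix_inv_mult[OF A _ V]) simp
  have iB: "((\<lambda>z. (matrix_inv (A z) *v C z) $ k)
      \<longlongrightarrow> (matrix_inv V *v B) $ k) F" for k
    by (rule tendsto_matrix_inv_mult[OF A C V])
  have l11: "((\<lambda>z. 1 \<bullet> (matrix_inv (A z) *v 1))
      \<longlongrightarrow> 1 \<bullet> (matrix_inv V *v 1)) F"
    by (rule tendsto_inner_vec[OF _ i]) simp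
  have l1B: "((\<lambda>z. 1 \<bullet> (matrix_inv (A z) *v C z))
      \<longlongrightarrow> 1 \<bullet> (matrix_inv V *v B)) F"
    by (rule tendsto_inner_vec[OF _ iB]) simp
  have lBB: "((\<lambda>z. C z \<bullet> (matrix_inv (A z) *v C z))
      \<longlongrightarrow> B \<bullet> (matrix_inv V *v B)) F"
    by (rule tendsto_inner_vec[OF C iB])
  have d: "((\<lambda>z. amse_denom (C z) (A z)) \<longlongrightarrow> amse_denom B V) F"
    unfolding amse_denom_def by (intro tendsto_intros l11 l1B lBB)
  have "((\<lambda>z. 1 / amse_denom (C z) (A z) * ((1 + C z \<bullet> (matrix_inv (A z) *v C z))
      * (matrix_inv (A z) *v 1) $ k
      - (1 \<bullet> (matrix_inv (A z) *v C z)) * (matrix_inv (A z) *v C z) $ k)) \<longlongrightarrow>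
    1 / amse_denom B V * ((1 + B \<bullet> (matrix_inv V *v B)) * (matrix_inv V *v 1) $ k
      - (1 \<bullet> (matrix_inv V *v B)) * (matrix_inv V *v B) $ k)) F"
    by (intro tendsto_mult tendsto_diff tendsto_add tendsto_const tendsto_divide d p i iB l1B lBB)
  then show "((\<lambda>z. amse_weights (C z) (A z) $ k) \<longlongrightarrow> amse_weights B V $ k) F"
    unfolding amse_weights_def amse_denom_def[symmetric] by simp
  show "\<forall>\<^sub>F z in F. 1 \<bullet> amse_weights (C z) (A z) = 1"
    using tendsto_imp_eventually_ne[OF d p] by eventually_elim (rule one_inner_amse_weights)
qed

lemma borel_measurable_var_weights:
  fixes A :: "'a \<Rightarrow> real^'n^'n"
  assumes A: "\<And>i j. (\<lambda>\<omega>. A \<omega> $ i $ j) \<in> borel_measurable M"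
  shows "(\<lambda>\<omega>. var_weights (A \<omega>) $ k) \<in> borel_measurable M"
proof -
  have [measurable]: "(\<lambda>\<omega>. (matrix_inv (A \<omega>) *v 1) $ k) \<in> borel_measurable M" for k
    by (rule borel_measurable_matrix_inv_mult[OF A]) simp
  have [measurable]: "(\<lambda>\<omega>. 1 \<bullet> (matrix_inv (A \<omega>) *v 1)) \<in> borel_measurable
      M"
    by (rule borel_measurable_inner_vec) auto
  show ?thesis unfolding var_weights_def by simp
qed

lemma borel_measurable_amse_weights:
  fixes A :: "'a \<Rightarrow> real^'n^'n"
  assumes A: "\<And>i j. (\<lambda>\<omega>. A \<omega> $ i $ j) \<in> borel_measurable M"
    and C: "\<And>i. (\<lambda>\<omega>. C \<omega> $ i) \<in> borel_measurable M"
  shows "(\<lambda>\<omega>. amse_weights (C \<omega>) (A \<omega>) $ k) \<in> borel_measurable M"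
proof -
  have [measurable]: "(\<lambda>\<omega>. (matrix_inv (A \<omega>) *v 1) $ k) \<in> borel_measurable M" for k
    by (rule borel_measurable_matrix_inv_mult[OF A]) simp
  have [measurable]: "(\<lambda>\<omega>. (matrix_inv (A \<omega>) *v C \<omega>) $ k) \<in> borel_measurable
      M" for k
    by (rule borel_measurable_matrix_inv_mult[OF A C])
  have [measurable]: "(\<lambda>\<omega>. 1 \<bullet> (matrix_inv (A \<omega>) *v 1)) \<in> borel_measurable
      M"
    "(\<lambda>\<omega>. 1 \<bullet> (matrix_inv (A \<omega>) *v C \<omega>)) \<in> borel_measurable M"
    by (rule borel_measurable_inner_vec; auto)+
  have [measurable]: "(\<lambda>\<omega>. C \<omega> \<bullet> (matrix_inv (A \<omega>) *v C \<omega>)) \<in>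
      borel_measurable M"
    by (rule borel_measurable_inner_vec[OF C]) auto
  show ?thesis unfolding amse_weights_def by simp
qed

section \<open>Algebra of the optimal weights\<close>

lemma pos_def_matrix_facts:
  fixes V :: "real^'n^'n"
  assumes "pos_def_matrix V"
  shows "invertible V" "det V \<noteq> 0" "x \<bullet> (V *v y) = y \<bullet> (V *v x)"
    "0 \<le> x \<bullet> (V *v x)" "x \<noteq> 0 \<Longrightarrow> 0 < x \<bullet> (V *v x)"
proof -
  have pos: "x \<noteq> 0 \<Longrightarrow> 0 < x \<bullet> (V *v x)" for x using assms
      by (simp add: pos_def_matrix_def)
  then show "x \<noteq> 0 \<Longrightarrow> 0 < x \<bullet> (V *v x)" .
  show "0 \<le> x \<bullet> (V *v x)" using pos[of x] by (cases "x = 0") auto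
  have "x = 0" if "V *v x = 0" for x using pos[of x] that by (cases "x = 0") auto
  then show inv: "invertible V"
    unfolding invertible_left_inverse matrix_left_invertible_ker by blast
  then show "det V \<noteq> 0" by (simp add: invertible_det_nz)
  have "x \<bullet> (V *v y) = (transpose V *v x) \<bullet> y" by (simp add: dot_lmul_matrix[symmetric])
  also have "\<dots> = y \<bullet> (V *v x)" using assms by (simp add: pos_def_matrix_def inner_commute)
  finally show "x \<bullet> (V *v y) = y \<bullet> (V *v x)" .
qed

text \<open>Positivity of the denominator is the Cauchy-Schwarz inequality for the inner product
  \<open>(x, y) \<mapsto> x \<bullet> V y\<close>.\<close>
lemma weights_identities:
  fixes V :: "real^'n^'n" and B :: "real^'n"
  assumes V: "pos_def_matrix V"
  defines "w \<equiv> var_weights V" and "w' \<equiv> amse_weights B V"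
  shows "0 < 1 \<bullet> (matrix_inv V *v 1)" and "0 < amse_denom B V"
    and "w \<bullet> B = (1 \<bullet> (matrix_inv V *v B)) / (1 \<bullet> (matrix_inv V *v 1))"
    and "w \<bullet> (V *v w) = 1 / (1 \<bullet> (matrix_inv V *v 1))"
    and "0 < w' \<bullet> (V *v w')"
    and "(w' \<bullet> B)\<^sup>2 + w' \<bullet> (V *v w')
        = (1 + B \<bullet> (matrix_inv V *v B)) / amse_denom B V"
proof -
  note pd = pos_def_matrix_facts[OF V]
  define x where "x = matrix_inv V *v 1"
  define y where "y = matrix_inv V *v B"
  have Vx: "V *v x = 1" and Vy: "V *v y = B" by (simp_all add: x_def y_def matrix_inv_mult_right[OF pd(1)])
  define p where "p = 1 \<bullet> x"
  define q where "q = 1 \<bullet> y"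
  define r where "r = B \<bullet> y"
  have xVx: "x \<bullet> (V *v x) = p" by (simp add: Vx p_def inner_commute)
  have yVy: "y \<bullet> (V *v y) = r" by (simp add: Vy r_def inner_commute)
  have yVx: "y \<bullet> (V *v x) = q" by (simp add: Vx q_def inner_commute)
  have xVy: "x \<bullet> (V *v y) = q" using pd(3)[of x y] yVx by simp
  have xB: "x \<bullet> B = q" using xVy by (simp add: Vy)
  have yB: "y \<bullet> B = r" by (simp add: r_def inner_commute)
  have "x \<noteq> 0"
  proof
    assume "x = 0"
    then have "(1 :: real^'n) = 0" using Vx by simp
    then show False by (simp add: vec_eq_iff)
  qed
  then have p: "p > 0" using pd(5)[of x] xVx by simp
  have r: "r \<ge> 0" using pd(4)[of y] yVy by simp
  \<comment> \<open>Used twice. At (s, t) = (q, p) the vector is, up to a scalar, y minus its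
    projection on x, and nonnegativity gives q^2 \<le> p r. At (s, t) = (1 + r, q) it gives the
    variance belonging to \<open>w'\<close>.\<close>
  have bil: "(s *\<^sub>R x - t *\<^sub>R y) \<bullet> (V *v (s *\<^sub>R x - t *\<^sub>R y))
      = s\<^sup>2 * p - 2 * s * t * q + t\<^sup>2 * r" for s t
    by (simp add: matrix_vector_mult_diff_distrib matrix_vector_mult_scaleR inner_diff_left inner_diff_right
        xVx yVy yVx xVy power2_eq_square algebra_simps)
  have "0 \<le> q\<^sup>2 * p - 2 * q * p * q + p\<^sup>2 * r"
      using pd(4)[of "q *\<^sub>R x - p *\<^sub>R y"] unfolding bil .
  then have "0 \<le> p * (p * r - q\<^sup>2)" by (simp add: power2_eq_square algebra_simps)
  then have cs: "q\<^sup>2 \<le> p * r" using p by (simp add: zero_le_mult_iff)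
  define D where "D = (1 + r) * p - q\<^sup>2"
  have D: "D > 0" using cs p by (simp add: D_def algebra_simps)
  have D_eq: "amse_denom B V = D"
    by (simp add: amse_denom_def D_def x_def[symmetric] y_def[symmetric] p_def[symmetric] q_def[symmetric]
        r_def[symmetric])
  show "0 < 1 \<bullet> (matrix_inv V *v 1)" using p by (simp add: p_def x_def)
  show "0 < amse_denom B V" using D D_eq by simp
  have w: "w = (1 / p) *\<^sub>R x" by (simp add: w_def var_weights_def p_def x_def)
  show "w \<bullet> B = (1 \<bullet> (matrix_inv V *v B)) / (1 \<bullet> (matrix_inv V *v 1))"
    by (simp add: w xB q_def p_def x_def[symmetric] y_def[symmetric])
  show "w \<bullet> (V *v w) = 1 / (1 \<bullet> (matrix_inv V *v 1))"
    unfolding w x_def[symmetric] p_def[symmetric] using p by (simp add: matrix_vector_mult_scaleR xVx)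
  have w': "w' = (1 / D) *\<^sub>R ((1 + r) *\<^sub>R x - q *\<^sub>R y)"
    by (simp add: w'_def amse_weights_def D_def x_def[symmetric] y_def[symmetric] p_def[symmetric]
        q_def[symmetric] r_def[symmetric])
  have wVw: "w' \<bullet> (V *v w') = ((1 + r)\<^sup>2 * p - 2 * (1 + r) * q * q + q\<^sup>2 * r) / D\<^sup>2"
    unfolding w' matrix_vector_mult_scaleR inner_scaleR_left inner_scaleR_right bil
        by (simp add: power2_eq_square)
  have wB: "w' \<bullet> B = q / D" unfolding w' inner_scaleR_left inner_diff_left xB yB
      by (simp add: algebra_simps)
  have "w' \<noteq> 0"
  proof
    assume "w' = 0"
    moreover have "1 \<bullet> w' = 1" unfolding w'_def by (rule one_inner_amse_weights) (use D D_eq in simp)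
    ultimately show False by simp
  qed
  then show "0 < w' \<bullet> (V *v w')" by (rule pd(5))
  have "(w' \<bullet> B)\<^sup>2 + w' \<bullet> (V *v w') = (1 + r) * D / D\<^sup>2"
    unfolding wB wVw power_divide add_divide_distrib[symmetric] D_def
        by (simp add: power2_eq_square algebra_simps)
  also have "\<dots> = (1 + r) / D" using D by (simp add: power2_eq_square)
  finally show "(w' \<bullet> B)\<^sup>2 + w' \<bullet> (V *v w')
      = (1 + B \<bullet> (matrix_inv V *v B)) / amse_denom B V"
    unfolding D_eq by (simp add: r_def y_def)
qed

section \<open>Measurability of order statistics and of the Hill estimator\<close>

lemma nth_beyond_length:
  "length xs = length ys \<Longrightarrow> length xs \<le> i \<Longrightarrow> xs ! i = ys ! i"
proof (induction xs ys arbitrary: i rule: list_induct2)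
  case (Cons x xs y ys)
  then show ?case by (cases i) auto
qed simp

text \<open>Needed for all indices, since for small n the effective size may exceed the sample size.
  Index 0 reads the same list entry as index 1, by truncated subtraction; an index past the end
  gives a value depending only on the length of the list, hence a constant.\<close>

lemma borel_measurable_order_stat:
  assumes y: "\<And>i. i \<ge> 1 \<Longrightarrow> y i \<in> borel_measurable M"
  shows "(\<lambda>\<omega>. order_stat i n (\<lambda>l. y l \<omega>)) \<in> borel_measurable M"
proof (cases "i - 1 < n")
  case True
  have eq: "order_stat i n z = order_stat (max 1 i) n z" for z by (simp add: order_stat_def max_def)
  have r: "1 \<le> max 1 i" "max 1 i \<le> n" using True by auto
  have "(\<lambda>\<omega>. order_stat (max 1 i) n (\<lambda>l. y l \<omega>)) \<in> borel_measurable M"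
    unfolding borel_measurable_iff_le
  proof
    fix a
    have "order_stat (max 1 i) n (\<lambda>l. y l \<omega>) \<le> a
        \<longleftrightarrow> real (max 1 i) \<le> (\<Sum>l=1..n. of_bool (y l \<omega>
        \<le> a))" for \<omega>
      unfolding order_stat_le_iff[OF r] by (simp add: Int_def)
    moreover have "{\<omega>\<in>space M. real (max 1 i) \<le> (\<Sum>l=1..n. of_bool (y l \<omega>
        \<le> a))} \<in> sets M"
    proof -
      have "(\<lambda>\<omega>. \<Sum>l=1..n. of_bool (y l \<omega>
          \<le> a) :: real) \<in> borel_measurable M"
      proof (rule borel_measurable_sum)
        fix l assume "l \<in> {1..n}"
        then have [measurable]: "y l \<in> borel_measurable M" using y by simp
        show "(\<lambda>\<omega>. of_bool (y l \<omega> \<le> a) :: real) \<in> borel_measurable M"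
            by measurable
      qed
      then show ?thesis by (rule borel_measurable_le[OF borel_measurable_const, simplified])
    qed
    ultimately show "{\<omega>\<in>space M. order_stat (max 1 i) n (\<lambda>l. y l \<omega>)
        \<le> a} \<in> sets M" by simp
  qed
  then show ?thesis using eq by simp
next
  case False
  have "order_stat i n z = order_stat i n (\<lambda>_. 0)" for z
    unfolding order_stat_def by (rule nth_beyond_length) (use False in auto)
  then have "(\<lambda>\<omega>. order_stat i n (\<lambda>l. y l \<omega>))
      = (\<lambda>_. order_stat i n (\<lambda>_. 0))" by blast
  then show ?thesis by simp
qed

lemma borel_measurable_hill:
  assumes "\<And>i. i \<ge> 1 \<Longrightarrow> y i \<in> borel_measurable M"
  shows "(\<lambda>\<omega>. hill n k (\<lambda>l. y l \<omega>)) \<in> borel_measurable M"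
  unfolding hill_def
  by (intro borel_measurable_times borel_measurable_const borel_measurable_sum borel_measurable_ln
      borel_measurable_divide borel_measurable_order_stat assms)

section \<open>Characteristic functions of normal laws and of shifted variables\<close>

lemma char_normal_law:
  assumes s: "s > 0"
  shows "char (normal_law m s) t = iexp (t * m) * complex_of_real (exp (- (t\<^sup>2 * s / 2)))"
    and "real_distribution (normal_law m s)"
proof -
  interpret prob_space std_normal_distribution by (rule prob_space_normal_density) simp
  have "distributed std_normal_distribution lborel (\<lambda>x. x) std_normal_density"
    by (auto simp: distributed_def distr_id2)
  from normal_density_affine[OF this, of "sqrt s" m]
  have "distributed std_normal_distribution lborel (\<lambda>x. m + sqrt s * x) (normal_density m (sqrt s))"
    using s by simp
  then have eq: "normal_law m s = distr std_normal_distribution borel (\<lambda>x. m + sqrt s * x)"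
    unfolding normal_law_def by (subst distributed_distr_eq_density[symmetric]) (auto intro!: distr_cong)
  show "real_distribution (normal_law m s)"
    unfolding eq by (rule real_distribution_distr) measurable
  have "char (normal_law m s) t = (CLINT x|std_normal_distribution. iexp (t * m) * iexp ((t * sqrt s) * x))"
    unfolding char_def eq by (subst integral_distr) (auto simp: algebra_simps simp flip: exp_add)
  also have "\<dots> = iexp (t * m) * char std_normal_distribution (t * sqrt s)"
    unfolding char_def by simp
  also have "\<dots> = iexp (t * m) * complex_of_real (exp (- (t\<^sup>2 * s / 2)))"
    unfolding char_std_normal_distribution using s by (simp add: power_mult_distrib)
  finally show "char (normal_law m s) t = iexp (t * m) * complex_of_real (exp (- (t\<^sup>2 * s / 2)))" .
qed

lemma (in prob_space) char_distr_shift: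
  assumes [measurable]: "Y \<in> borel_measurable M"
  shows "char (distr M borel (\<lambda>\<omega>. Y \<omega> + m)) t = iexp (t * m) * char (distr M borel Y) t"
proof -
  have "char (distr M borel (\<lambda>\<omega>. Y \<omega> + m)) t
      = (CLINT \<omega>|M. iexp (t * m) * iexp (t * Y \<omega>))"
    unfolding char_def by (subst integral_distr) (auto simp: algebra_simps simp flip: exp_add)
  also have "\<dots> = iexp (t * m) * char (distr M borel Y) t"
    unfolding char_def by (simp add: integral_distr)
  finally show ?thesis .
qed

section \<open>Hill estimators\<close>

lemma (in prob_space) tight_seq_mult_convergent:
  assumes "tight_seq Z" and x: "x \<longlonglongrightarrow> (a::real)"
  shows "tight_seq (\<lambda>n \<omega>. x n * Z n \<omega>)"
  unfolding tight_seq_def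
proof (intro allI impI)
  fix \<eta> :: real assume "\<eta> > 0"
  then obtain C where C: "C > 0" "\<forall>\<^sub>F n in sequentially.
     \<exists>A\<in>events. prob A \<le> \<eta> \<and> (\<forall>\<omega>\<in>space M
         - A. \<bar>Z n \<omega>\<bar> \<le> C)"
    using tight_seqD[OF assms(1) \<open>\<eta> > 0\<close>] by (elim exE conjE)
  have a1: "\<bar>a\<bar> + 1 > 0" by linarith
  have "\<forall>\<^sub>F n in sequentially. \<bar>x n\<bar> < \<bar>a\<bar> + 1"
    by (rule order_tendstoD(2)[OF tendsto_rabs[OF x]]) simp
  with C(2) have "\<forall>\<^sub>F n in sequentially. \<exists>A\<in>events. prob A
      \<le> \<eta> \<and> (\<forall>\<omega>\<in>space M - A. \<bar>x n * Z n \<omega>\<bar>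
      \<le> (\<bar>a\<bar> + 1) * C)"
  proof eventually_elim
    case (elim n)
    then obtain A where A: "A \<in> events" "prob A
        \<le> \<eta>" "\<forall>\<omega>\<in>space M - A. \<bar>Z n \<omega>\<bar> \<le> C" by blast
    have "\<forall>\<omega>\<in>space M - A. \<bar>x n * Z n \<omega>\<bar> \<le> (\<bar>a\<bar> + 1) * C"
      unfolding abs_mult using A(3) elim(2) by (intro ballI mult_mono) auto
    then show ?case using A by blast
  qed
  moreover have "(\<bar>a\<bar> + 1) * C > 0" using a1 C(1) by simp
  ultimately show "\<exists>C>0. \<forall>\<^sub>F n in sequentially. \<exists>A\<in>events. prob A
      \<le> \<eta> \<and> (\<forall>\<omega>\<in>space M - A. \<bar>x n * Z n \<omega>\<bar> \<le> C)"
    by (intro exI[of _ "(\<bar>a\<bar> + 1) * C"] conjI)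
qed

locale hill_sample = pooled_sample M X Xs \<gamma> b c R N K
  for M :: "'a measure" and X :: "'a \<Rightarrow> real^('m::{finite,linorder})" and Xs
    and \<gamma> :: real and b c :: "real^('m::{finite,linorder})"
    and R :: "'m::{finite,linorder} \<Rightarrow> 'm \<Rightarrow> ereal \<Rightarrow> ereal \<Rightarrow>
        real"
    and N K :: "nat \<Rightarrow> 'm::{finite,linorder} \<Rightarrow> nat" +
  fixes \<beta> \<rho> lam :: "real^('m::{finite,linorder})"
      and A :: "'m::{finite,linorder} \<Rightarrow> real \<Rightarrow> real"
  assumes second_order: "second_order_cond M X (\<gamma> *\<^sub>R 1) \<rho> A"
    and \<rho>_neg: "\<And>j. \<rho> $ j < 0"
    and A_eq: "\<And>j t. t > 0 \<Longrightarrow> A j t = \<gamma> * \<beta> $ j * t powr (\<rho> $ j)"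
    and lam_lim: "\<And>j. (\<lambda>n. sqrt (real (K n j)) * A j (real (N n j)
        / real (K n j))) \<longlonglongrightarrow> lam $ j"
begin

lemma \<beta>_nz: "\<beta> $ j \<noteq> 0"
proof -
  have "(\<forall>t>0. A j t > 0) \<or> (\<forall>t>0. A j t < 0)"
      using second_order unfolding second_order_cond_def by blast
  then have "A j 1 \<noteq> 0" by (metis less_irrefl zero_less_one)
  then show ?thesis using A_eq[of 1 j] by auto
qed

lemma exp_\<tau>_lim: "(\<lambda>n. sqrt (K n j) * exp (\<rho> $ j
    * tail.\<tau> j n)) \<longlonglongrightarrow> lam $ j / (\<gamma> * \<beta> $ j)"
proof (rule Lim_transform_eventually)
  show "(\<lambda>n. sqrt (real (K n j)) * A j (real (N n j) / real (K n j)) / (\<gamma>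
      * \<beta> $ j)) \<longlonglongrightarrow> lam $ j / (\<gamma> * \<beta> $ j)"
    using \<beta>_nz \<gamma>_pos by (intro tendsto_divide lam_lim tendsto_const) auto
  show "\<forall>\<^sub>F n in sequentially. sqrt (real (K n j)) * A j (real (N n j) / real (K n j))
      / (\<gamma> * \<beta> $ j)
      = sqrt (K n j) * exp (\<rho> $ j * tail.\<tau> j n)"
    using eventually_good
  proof eventually_elim
    case (elim n)
    have K: "0 < K n j" "K n j < N n j" using elim by blast+
    then have "real (N n j) / real (K n j) > 0" by simp
    then have "A j (real (N n j) / real (K n j)) = \<gamma> * \<beta> $ j * exp (\<rho> $ j
        * tail.\<tau> j n)"
      using K by (simp add: A_eq powr_def tail.\<tau>_def)
    then show ?case using \<beta>_nz[of j] \<gamma>_pos by simp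
  qed
qed

text \<open>Almost surely each observation is the tail quantile function at the exponential of its
  score, and order statistics commute with this monotone map. The Hill estimator is thus
  \<open>top_sum\<close> of f = ln (U (exp x)) minus K copies of its value at the threshold, divided
  by K, and \<open>hill_expansion\<close> applies.\<close>

lemma hill_asymptotic:
  "((\<lambda>z. sqrt (K (fst z) j) * (hill (N (fst z) j) (K (fst z) j) (\<lambda>i. Xs i (snd z) $ j)
      - \<gamma>)
      - \<gamma> * ((\<Sum>i=1..N (fst z) j. tail.\<zeta> j (fst z) (Xs i (snd z)))
          / sqrt (K (fst z) j))) \<longlongrightarrow> lam $ j / (1 - \<rho> $ j)) in_prob"
proof -
  let ?U = "tail_quantile M X j"
  define d where "d = \<gamma> * \<beta> $ j"
  have d: "d \<noteq> 0" using \<beta>_nz \<gamma>_pos by (simp add: d_def)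
  have lim: "((\<lambda>t. 1 / A j t * (?U (t * x) / ?U t - x powr \<gamma>))
      \<longlongrightarrow> x powr \<gamma> * ((x powr (\<rho> $ j) - 1) / \<rho> $ j)) at_top"
    if "x > 0" for x
    using second_order \<rho>_neg[of j] that unfolding second_order_cond_def by (auto dest!: spec[of _ j])
  have Aj: "A j t = d * t powr (\<rho> $ j)" if "t > 0" for t using A_eq[OF that] by (simp add: d_def)
  have mono_U: "?U s \<le> ?U t" if "1 < s" "s \<le> t" for s t by (rule marg.tail_quantile_mono[OF that])
  obtain L \<epsilon> where \<epsilon>: "(\<epsilon> \<longlongrightarrow> 0) at_top" and
    ex: "\<forall>\<^sub>F x in at_top. 0 < ?U (exp x) \<and> ln (?U (exp x))
        = L + \<gamma> * x + exp (\<rho> $ j * x) * (d / \<rho> $ j + \<epsilon> x)"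
    by (rule second_order_expansion[OF \<gamma>_pos \<rho>_neg d Aj mono_U lim])
  define f where "f x = ln (?U (exp x))" for x
  have fex: "\<forall>\<^sub>F x in at_top. f x = L + \<gamma> * x + exp (\<rho> $ j * x) * (d / \<rho> $ j
      + \<epsilon> x)"
    using ex by eventually_elim (simp add: f_def)
  \<comment> \<open>Here a = d / \<open>\<rho>\<close> and \<open>\<kappa>\<close> = lam / d. The
    difference \<open>\<kappa>\<close> / (1 - \<open>\<rho>\<close>) - \<open>\<kappa>\<close>
    carries a factor \<open>\<rho>\<close> that cancels the denominator of a.\<close>
  have lim_eq: "d / \<rho> $ j * (lam $ j / d / (1 - \<rho> $ j) - lam $ j / d) = lam $ j / (1 - \<rho> $ j)"
    using d \<rho>_neg[of j] by (simp add: field_simps)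
  note main = tail.hill_expansion[OF \<rho>_neg[of j] exp_\<tau>_lim[of j, folded d_def] \<epsilon> fex]
  obtain x0 where x0: "\<And>x. x \<ge> x0 \<Longrightarrow> 0 < ?U (exp x)"
    using ex unfolding eventually_at_top_linorder by blast
  have reg: "\<forall>\<^sub>F z in in_prob. \<forall>i\<in>{1..N (fst z) j}. marg.regular j (Xs i (snd z) $
      j)"
  proof (rule eventually_in_prob_AE[where Q="\<lambda>n \<omega>. \<forall>i\<in>{1..N n j}. marg.regular j
      (Xs i \<omega> $ j)"], rule AE_finite_allI)
    fix n i assume "i \<in> {1..N n j}"
    then show "AE \<omega> in M. marg.regular j (Xs i \<omega> $ j)"
      by (intro AE_Xs measurable_compose[OF measurable_vec_nth[OF measurable_ident] marg.regular_measurable,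
          unfolded id_def]
          marg.AE_regular) auto
  qed simp
  have T0: "\<forall>\<^sub>F z in in_prob. x0 \<le> tail.T j (fst z) (snd z)"
    using tail.T_top[of j] unfolding filterlim_at_top by blast
  show ?thesis
  proof (rule Lim_transform_eventually[OF main[unfolded lim_eq]])
    show "\<forall>\<^sub>F z in in_prob. (tail.top_sum j f (fst z) (snd z) - real (K (fst z) j)
        * f (tail.T j (fst z) (snd z)) - \<gamma> * real (K (fst z) j)) / sqrt (real (K (fst z) j))
        - \<gamma> * ((\<Sum>i=1..N (fst z) j. tail.\<zeta> j (fst z) (Xs i (snd z)))
            / sqrt (real (K (fst z) j)))
      = sqrt (K (fst z) j) * (hill (N (fst z) j) (K (fst z) j) (\<lambda>i. Xs i (snd z) $ j) - \<gamma>)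
        - \<gamma> * ((\<Sum>i=1..N (fst z) j. tail.\<zeta> j (fst z) (Xs i (snd z))) / sqrt (K (fst z) j))"
      using reg T0 eventually_in_prob_sequentially[OF eventually_good]
    proof eventually_elim
      case (elim z)
      obtain n \<omega> where z: "z = (n, \<omega>)" by (cases z)
      have K: "0 < K n j" "K n j < N n j" using elim(3) z by auto
      let ?E = "\<lambda>i. marg.logS j (Xs i \<omega> $ j)"
      \<comment> \<open>Positive scores give arguments exp x > 1, the range in which the tail
        quantile is monotone; regularity makes all scores positive.\<close>
      have mono: "mono_on {0<..} (\<lambda>x. ?U (exp x))"
        by (intro mono_onI marg.tail_quantile_mono) auto
      have os: "order_stat i (N n j) (\<lambda>i. Xs i \<omega> $ j)
          = ?U (exp (order_stat i (N n j) ?E))" if "1 \<le> i" "i \<le> N n j" for i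
        by (rule order_stat_map_mono_on[OF mono _ _ that])
          (use elim(1) marg.regular_tail_quantile[of j] z in auto)
      have T: "order_stat (N n j - K n j) (N n j) (\<lambda>i. Xs i \<omega> $ j)
          = ?U (exp (tail.T j n \<omega>))"
        unfolding tail.T_def by (rule os) (use K in auto)
      have pT: "0 < ?U (exp (tail.T j n \<omega>))" using x0 elim(2) z by simp
      have "(\<Sum>i=1..K n j. ln (order_stat (N n j - i + 1) (N n j) (\<lambda>i. Xs i \<omega> $ j)
          / order_stat (N n j - K n j) (N n j) (\<lambda>i. Xs i \<omega> $ j)))
         = (\<Sum>i=1..K n j. f (order_stat (N n j - i + 1) (N n j) ?E) - f (tail.T j n \<omega>))"
      proof (rule sum.cong[OF refl])
        fix i assume i: "i \<in> {1..K n j}"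
        let ?o = "order_stat (N n j - i + 1) (N n j) ?E"
        have "tail.T j n \<omega> \<le> ?o" by (rule tail.order_stat_ge_T[OF K(2) i])
        then have "0 < ?U (exp ?o)" using elim(2) z by (intro x0) auto
        moreover have "order_stat (N n j - i + 1) (N n j) (\<lambda>i. Xs i \<omega> $ j) = ?U (exp ?o)"
          by (rule os) (use i K in auto)
        ultimately show "ln (order_stat (N n j - i + 1) (N n j) (\<lambda>i. Xs i \<omega> $ j)
            / order_stat (N n j - K n j) (N n j) (\<lambda>i. Xs i \<omega> $ j))
          = f ?o - f (tail.T j n \<omega>)"
          unfolding T f_def using pT by (simp add: ln_div)
      qed
      also have "\<dots> = tail.top_sum j f n \<omega> - real (K n j) * f (tail.T j n \<omega>)"
        by (simp add: tail.top_sum_def sum_subtractf)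
      finally have h: "hill (N n j) (K n j) (\<lambda>i. Xs i \<omega> $ j)
          = (tail.top_sum j f n \<omega> - real (K n j) * f (tail.T j n \<omega>)) / real (K n j)"
        by (simp add: hill_def)
      have gen: "(a - \<gamma> * k) / sqrt k = sqrt k * (a / k - \<gamma>)" if "k > 0" for a k :: real
        using that by (simp add: field_simps flip: real_sqrt_mult)
      show ?case unfolding z fst_conv snd_conv h using gen[of "real (K n j)"] K by simp
    qed
  qed
qed

text \<open>Scaled by the pooled k rather than by the size of the single sample, so that weighted
  sums over j need no further normalization.\<close>

definition hill_linear :: "nat \<Rightarrow> 'm \<Rightarrow> 'a \<Rightarrow> real" where
  "hill_linear n j \<omega> = sqrt (k_total n) / real (K n j) * \<gamma>
      * (\<Sum>i=1..N n j. tail.\<zeta> j n (Xs i \<omega>))"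

definition hill_error :: "nat \<Rightarrow> 'm \<Rightarrow> 'a \<Rightarrow> real" where
  "hill_error n j \<omega> = sqrt (k_total n) * (hill (N n j) (K n j) (\<lambda>i. Xs i \<omega> $ j)
      - \<gamma>)"

lemma sqrt_k_total_ratio: "(\<lambda>n. sqrt (k_total n) / sqrt (K n j))
    \<longlonglongrightarrow> sqrt c_inv_sum * sqrt (c $ j)"
  using tendsto_real_sqrt[OF k_total_ratio[of j]] by (simp add: real_sqrt_divide real_sqrt_mult)

lemma sqrt_quotient: "0 < K n j \<Longrightarrow> sqrt (k_total n) / real (K n j)
    = sqrt (k_total n) / sqrt (K n j) / sqrt (K n j)"
  by simp

text \<open>The change of scale sqrt (\<open>k_total\<close> / K) has limit sqrt
  (\<open>c_inv_sum\<close> c_j), which turns lam / (1 - \<open>\<rho>\<close>) into the j-th bias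
  component.\<close>

lemma hill_error_minus_linear: "((\<lambda>z. hill_error (fst z) j (snd z)
    - hill_linear (fst z) j (snd z)) \<longlongrightarrow> B_asym c lam \<rho> $ j) in_prob"
proof (rule Lim_transform_eventually)
  let ?h = "\<lambda>z. sqrt (K (fst z) j) * (hill (N (fst z) j) (K (fst z) j) (\<lambda>i. Xs i (snd z) $ j)
      - \<gamma>)
      - \<gamma> * ((\<Sum>i=1..N (fst z) j. tail.\<zeta> j (fst z) (Xs i (snd z))) / sqrt (K (fst z) j))"
  have "((\<lambda>z. sqrt (k_total (fst z)) / sqrt (K (fst z) j) * ?h z)
      \<longlongrightarrow> sqrt c_inv_sum * sqrt (c $ j) * (lam $ j / (1 - \<rho> $ j))) in_prob"
    by (intro tendsto_mult hill_asymptotic tendsto_in_prob_const[OF sqrt_k_total_ratio])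
  then show "((\<lambda>z. sqrt (k_total (fst z)) / sqrt (K (fst z) j) * ?h z)
      \<longlongrightarrow> B_asym c lam \<rho> $ j) in_prob"
    by (simp add: B_asym_def c_inv_sum_def mult.assoc)
  show "\<forall>\<^sub>F z in in_prob. sqrt (k_total (fst z)) / sqrt (K (fst z) j) * ?h z
      = hill_error (fst z) j (snd z) - hill_linear (fst z) j (snd z)"
    using eventually_in_prob_sequentially[OF eventually_good]
  proof eventually_elim
    case (elim z)
    define n where "n = fst z"
    have K: "0 < K n j" using elim by (simp add: n_def)
    have gen: "p / s * (s * h - \<gamma> * (S / s))
        = p * h - p / s / s * \<gamma> * S" if "s > 0" for p s h S :: real
      using that by (simp add: field_simps)
    show ?case unfolding hill_error_def hill_linear_def n_def[symmetric] sqrt_quotient[OF K] using gen K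
        by simp
  qed
qed

lemma hill_linear_tight: "tight_seq (\<lambda>n \<omega>. hill_linear n j \<omega>)"
proof (rule tight_seq_add_tendsto)
  show "tight_seq (\<lambda>n \<omega>. (sqrt (k_total n) / sqrt (K n j) * \<gamma>)
      * ((\<Sum>i=1..N n j. tail.\<zeta> j n (Xs i \<omega>)) / sqrt (K n j)))"
    by (rule tight_seq_mult_convergent[OF tail.\<zeta>_sum_tight tendsto_mult[OF sqrt_k_total_ratio
        tendsto_const]])
  show "((\<lambda>z. hill_linear (fst z) j (snd z) - (sqrt (k_total (fst z)) / sqrt (K (fst z) j)
      * \<gamma>) * ((\<Sum>i=1..N (fst z) j. tail.\<zeta> j (fst z) (Xs i (snd z)))
      / sqrt (K (fst z) j))) \<longlongrightarrow> 0) in_prob"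
  proof (rule tendsto_eventually)
    show "\<forall>\<^sub>F z in in_prob. hill_linear (fst z) j (snd z) - (sqrt (k_total (fst z))
        / sqrt (K (fst z) j) * \<gamma>) * ((\<Sum>i=1..N (fst z) j. tail.\<zeta> j (fst z) (Xs i (snd z)))
        / sqrt (K (fst z) j)) = 0"
      using eventually_in_prob_sequentially[OF eventually_good]
    proof eventually_elim
      case (elim z)
      then have K: "0 < K (fst z) j" by blast
      have gen: "p / s / s * g * S - p / s * g * (S / s) = 0" for p s g S :: real
        by (cases "s = 0") (simp_all add: field_simps)
      show ?case unfolding hill_linear_def sqrt_quotient[OF K] by (rule gen)
    qed
  qed
qed

lemma k_total_top: "filterlim k_total at_top sequentially"
proof (rule filterlim_at_top_mono[OF tail.K_real_top])
  show "\<forall>\<^sub>F n in sequentially. real (K n (Min UNIV)) \<le> k_total n"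
    unfolding k_total_def by (intro always_eventually allI of_nat_mono member_le_sum) auto
qed

lemma hill_consistent: "((\<lambda>z. hill (N (fst z) j) (K (fst z) j) (\<lambda>i. Xs i (snd z) $ j))
    \<longlongrightarrow> \<gamma>) in_prob"
proof -
  have "tight_seq (\<lambda>n \<omega>. hill_error n j \<omega>)"
      by (rule tight_seq_add_tendsto[OF hill_linear_tight hill_error_minus_linear])
  moreover have "((\<lambda>z. 1 / sqrt (k_total (fst z))) \<longlongrightarrow> 0) in_prob"
    by (intro tendsto_in_prob_const tendsto_divide_0[OF tendsto_const] filterlim_at_top_imp_at_infinity
        filterlim_compose[OF sqrt_at_top k_total_top])
  ultimately have "((\<lambda>z. 1 / sqrt (k_total (fst z))
      * hill_error (fst z) j (snd z)) \<longlongrightarrow> 0) in_prob"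
    by (rule tendsto_mult_tight[of _ "\<lambda>n _. 1 / sqrt (k_total n)"])
  from tendsto_add[OF this tendsto_const[of \<gamma>]]
  have "((\<lambda>z. 1 / sqrt (k_total (fst z)) * hill_error (fst z) j (snd z)
      + \<gamma>) \<longlongrightarrow> \<gamma>) in_prob" by simp
  moreover have "\<forall>\<^sub>F z in in_prob. 1 / sqrt (k_total (fst z)) * hill_error (fst z) j (snd z)
      + \<gamma> = hill (N (fst z) j) (K (fst z) j) (\<lambda>i. Xs i (snd z) $ j)"
  proof -
    have "\<forall>\<^sub>F n in sequentially. 0 < k_total n" using k_total_top
        by (simp add: filterlim_at_top_dense)
    from eventually_in_prob_sequentially[OF this] show ?thesis
      by eventually_elim (simp add: hill_error_def)
  qed
  ultimately show ?thesis by (rule Lim_transform_eventually)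
qed

lemma pooled_hill_consistent:
  assumes "w \<bullet> 1 = 1"
  shows "((\<lambda>z. pooled_hill (\<lambda>i. Xs i (snd z)) (N (fst z)) (K (fst z)) w)
      \<longlongrightarrow> \<gamma>) in_prob"
proof -
  have "((\<lambda>z. \<Sum>j\<in>UNIV. w $ j * hill (N (fst z) j) (K (fst z) j) (\<lambda>i. Xs i (snd z) $
      j)) \<longlongrightarrow> (\<Sum>j\<in>UNIV. w $ j * \<gamma>)) in_prob"
    by (intro tendsto_sum tendsto_mult tendsto_const hill_consistent)
  moreover have "(\<Sum>j\<in>UNIV. w $ j * \<gamma>) = \<gamma>"
    using assms by (simp add: inner_vec_def flip: sum_distrib_right)
  ultimately show ?thesis by (simp add: pooled_hill_def)
qed

lemma Xs_nth_measurable: "1 \<le> i \<Longrightarrow> (\<lambda>\<omega>. Xs i \<omega> $ j) \<in>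
    borel_measurable M"
  by (intro measurable_vec_nth Xs_measurable)

lemma pooled_hill_measurable:
  assumes "\<And>j. (\<lambda>\<omega>. W \<omega> $ j) \<in> borel_measurable M"
  shows "(\<lambda>\<omega>. pooled_hill (\<lambda>i. Xs i \<omega>) (N n) (K n) (W \<omega>)) \<in>
      borel_measurable M"
  unfolding pooled_hill_def
  by (intro borel_measurable_sum borel_measurable_times assms borel_measurable_hill Xs_nth_measurable)

text \<open>Weights summing to one make the pooled error the weighted sum of the single errors. Each
  error is a tight linear part plus a term tending to the bias, so replacing W by its limit w costs
  only a vanishing factor times a tight one. The law then comes from the linear parts by
  characteristic functions.\<close>

lemma asymptotic_normality:
  assumes W: "\<And>j. ((\<lambda>z. W (fst z) (snd z) $ j) \<longlongrightarrow> w $ j) in_prob"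
    and one: "\<forall>\<^sub>F z in in_prob. 1 \<bullet> W (fst z) (snd z) = 1"
    and meas: "\<And>n j. (\<lambda>\<omega>. W n \<omega> $ j) \<in> borel_measurable M"
    and s: "0 < w \<bullet> (V_asym \<gamma> R c b *v w)"
  shows "tendsto_in_distr M (\<lambda>n \<omega>. sqrt (real (\<Sum>j\<in>UNIV. K n j))
      * (pooled_hill (\<lambda>i. Xs i \<omega>) (N n) (K n) (W n \<omega>) - \<gamma>))
    (normal_law (w \<bullet> B_asym c lam \<rho>) (w \<bullet> (V_asym \<gamma> R c b *v w)))"
proof -
  let ?B = "B_asym c lam \<rho>" and ?s = "w \<bullet> (V_asym \<gamma> R c b *v w)"
  define Q where "Q n \<omega> = sqrt (k_total n) * (pooled_hill (\<lambda>i. Xs i \<omega>) (N n) (K n) (W n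
      \<omega>) - \<gamma>)" for n \<omega>
  define Y where "Y n \<omega> = (\<Sum>j\<in>UNIV. w $ j * (sqrt (k_total n) / real (K n j) * \<gamma>)
      * (\<Sum>i=1..N n j. tail.\<zeta> j n (Xs i \<omega>)))" for n \<omega>
  have Y_linear: "Y n \<omega> = (\<Sum>j\<in>UNIV. w $ j * hill_linear n j \<omega>)" for n \<omega>
      by (simp add: Y_def hill_linear_def mult.assoc)
  have Qm[measurable]: "Q n \<in> borel_measurable M" for n
    unfolding Q_def using pooled_hill_measurable[OF meas, of n] by simp
  have Ym[measurable]: "Y n \<in> borel_measurable M" for n
    unfolding Y_def by (intro borel_measurable_sum borel_measurable_times borel_measurable_const
        measurable_compose[OF Xs_measurable tail.\<zeta>_measurable]) auto
  \<comment> \<open>W (error) - w (linear) is split as W (error - linear) + (W - w) linear: the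
    first sum tends to the bias, the second to 0 by tightness.\<close>
  have "((\<lambda>z. (\<Sum>j\<in>UNIV. W (fst z) (snd z) $ j * (hill_error (fst z) j (snd z)
      - hill_linear (fst z) j (snd z)))
      + (\<Sum>j\<in>UNIV. (W (fst z) (snd z) $ j - w $ j) * hill_linear (fst z) j (snd z))
          - w \<bullet> ?B) \<longlongrightarrow> (\<Sum>j\<in>UNIV. w $ j * ?B $ j)
          + (\<Sum>j\<in>(UNIV::'m set). 0) - w \<bullet> ?B) in_prob"
  proof (intro tendsto_diff tendsto_add tendsto_sum tendsto_mult W hill_error_minus_linear tendsto_const)
    fix j
    have "((\<lambda>z. W (fst z) (snd z) $ j - w $ j) \<longlongrightarrow> 0) in_prob"
        using LIM_zero[OF W] .
    from tendsto_mult_tight[OF hill_linear_tight this]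
    show "((\<lambda>z. (W (fst z) (snd z) $ j - w $ j) * hill_linear (fst z) j (snd z))
        \<longlongrightarrow> 0) in_prob" .
  qed
  moreover have "(\<Sum>j\<in>UNIV. w $ j * ?B $ j) + (\<Sum>j\<in>(UNIV::'m set). 0) - w \<bullet> ?B
      = 0" by (simp add: inner_vec_def)
  moreover have "\<forall>\<^sub>F z in in_prob. (\<Sum>j\<in>UNIV. W (fst z) (snd z) $ j
      * (hill_error (fst z) j (snd z) - hill_linear (fst z) j (snd z)))
      + (\<Sum>j\<in>UNIV. (W (fst z) (snd z) $ j - w $ j) * hill_linear (fst z) j (snd z)) - w \<bullet> ?B
      = Q (fst z) (snd z) - (Y (fst z) (snd z) + w \<bullet> ?B)"
    using one
  proof eventually_elim
    case (elim z)
    obtain n \<omega> where z: "z = (n, \<omega>)" by (cases z)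
    \<comment> \<open>Without this identity a term sqrt k (sum of W - 1) \<open>\<gamma>\<close>
      would remain, which consistency of W does not control.\<close>
    have W1: "(\<Sum>j\<in>UNIV. W n \<omega> $ j) = 1" using elim z by (simp add: inner_one_vec)
    have "(\<Sum>j\<in>UNIV. W n \<omega> $ j * hill_error n j \<omega>)
        = sqrt (k_total n) * ((\<Sum>j\<in>UNIV. W n \<omega> $ j
        * hill (N n j) (K n j) (\<lambda>i. Xs i \<omega> $ j)) - (\<Sum>j\<in>UNIV. W n \<omega> $ j)
        * \<gamma>)"
      unfolding hill_error_def sum_distrib_right sum_subtractf[symmetric] sum_distrib_left
      by (intro sum.cong refl) (simp add: algebra_simps)
    then have "Q n \<omega> = (\<Sum>j\<in>UNIV. W n \<omega> $ j
        * hill_error n j \<omega>)" unfolding W1 Q_def pooled_hill_def by simp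
    then show ?case
      unfolding z fst_conv snd_conv Y_linear by (simp add: algebra_simps sum_subtractf sum.distrib)
  qed
  ultimately have "((\<lambda>z. Q (fst z) (snd z) - (Y (fst z) (snd z)
      + w \<bullet> ?B)) \<longlongrightarrow> 0) in_prob"
    by (simp only:) (rule Lim_transform_eventually)
  then have diff: "(\<lambda>n. char (distr M borel (Q n)) t
      - char (distr M borel (\<lambda>\<omega>. Y n \<omega> + w \<bullet> ?B)) t)
      \<longlonglongrightarrow> 0" for t
    by (intro char_diff_tendsto_0) simp_all
  have ch: "(\<lambda>n. char (distr M borel (Q n)) t)
      \<longlonglongrightarrow> char (normal_law (w \<bullet> ?B) ?s) t" for t
  proof -
    have "(\<lambda>n. char (distr M borel (Y n)) t)
        \<longlonglongrightarrow> complex_of_real (exp (- (t\<^sup>2 * ?s / 2)))"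
      unfolding Y_def by (rule pooled_linear_clt)
    from tendsto_mult[OF tendsto_const[of "iexp (t * (w \<bullet> ?B))"] this]
    have "(\<lambda>n. char (distr M borel (\<lambda>\<omega>. Y n \<omega>
        + w \<bullet> ?B)) t) \<longlonglongrightarrow> char (normal_law (w \<bullet> ?B) ?s) t"
      unfolding char_distr_shift[OF Ym] char_normal_law(1)[OF s] .
    from tendsto_add[OF diff[of t] this] show ?thesis by simp
  qed
  have "weak_conv_m (\<lambda>n. distr M borel (Q n)) (normal_law (w \<bullet> ?B) ?s)"
    by (rule levy_continuity[OF real_distribution_distr[OF Qm] char_normal_law(2)[OF s] ch])
  then show ?thesis unfolding tendsto_in_distr_def Q_def k_total_def by simp
qed

section \<open>Measurability and consistency of the plug-in bias and covariance\<close>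

lemma R_hat_measurable: "(\<lambda>\<omega>. R_hat (\<lambda>i. Xs i \<omega>) (N n) (K n) j l u v) \<in>
    borel_measurable M"
proof -
  have rank: "(\<lambda>\<omega>. real (sample_rank m i (\<lambda>i'. Xs i' \<omega> $ h))) \<in>
      borel_measurable M" if i: "i \<in> {1..m}" for m i h
  proof -
    have "real (sample_rank m i (\<lambda>i'. Xs i' \<omega> $ h))
        = (\<Sum>l=1..m. of_bool (Xs l \<omega> $ h \<le> Xs i \<omega> $ h))" for \<omega>
      by (simp add: sample_rank_def Int_def)
    moreover have "(\<lambda>\<omega>. \<Sum>l=1..m. of_bool (Xs l \<omega> $ h
        \<le> Xs i \<omega> $ h) :: real) \<in> borel_measurable M"
    proof (rule borel_measurable_sum)
      fix l assume "l \<in> {1..m}"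
      then have [measurable]: "(\<lambda>\<omega>. Xs l \<omega> $ h) \<in> borel_measurable M"
          "(\<lambda>\<omega>. Xs i \<omega> $ h) \<in> borel_measurable M"
        using i by (auto intro: Xs_nth_measurable)
      show "(\<lambda>\<omega>. of_bool (Xs l \<omega> $ h
          \<le> Xs i \<omega> $ h) :: real) \<in> borel_measurable M" by measurable
    qed
    ultimately show ?thesis by simp
  qed
  show ?thesis
    unfolding R_hat_def Let_def
  proof (intro borel_measurable_times borel_measurable_const borel_measurable_sum)
    fix i assume i: "i \<in> {1..min (N n j) (N n l)}"
    note [measurable] = rank[OF i]
    show "(\<lambda>\<omega>. of_bool
       ((real (min (N n j) (N n l)) + 1 - real (sample_rank (min (N n j) (N n l)) i (\<lambda>i'. Xs i'
           \<omega> $ j))) /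
        (real (if N n j < N n l then K n j else K n l) * (real (min (N n j) (N n l)) + 1)
            / real (min (N n j) (N n l))) \<le> u \<and>
        (real (min (N n j) (N n l)) + 1 - real (sample_rank (min (N n j) (N n l)) i (\<lambda>i'. Xs i'
            \<omega> $ l))) /
        (real (if N n j < N n l then K n j else K n l) * (real (min (N n j) (N n l)) + 1)
            / real (min (N n j) (N n l))) \<le> v) :: real)
      \<in> borel_measurable M"
      by measurable
  qed
qed

lemma V_hat_nth:
  "V_hat x N' K' w0 $ j $ l = (let k = real (\<Sum>i\<in>UNIV. K' i); g = pooled_hill x N' K' w0;
     upper = (\<lambda>j l. k * g\<^sup>2 * (1 / real (K' j)) * R_hat x N' K' j l (real (K' j)
         / real (K' l)) (real (N' j) / real (N' l)))
   in if j = l then k * g\<^sup>2 / real (K' j) else if j < l then upper j l else upper l j)"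
  by (simp add: V_hat_def Let_def)

lemma V_hat_measurable: "(\<lambda>\<omega>. V_hat (\<lambda>i. Xs i \<omega>) (N n) (K n) w0 $ j $ l) \<in>
    borel_measurable M"
proof -
  have [measurable]: "(\<lambda>\<omega>. pooled_hill (\<lambda>i. Xs i \<omega>) (N n) (K n) w0) \<in>
      borel_measurable M"
    by (rule pooled_hill_measurable) simp
  note R_hat_measurable[measurable]
  show ?thesis unfolding V_hat_nth Let_def by (cases "j = l"; cases "j < l") simp_all
qed

lemma V_hat_consistent:
  assumes "w0 \<bullet> 1 = 1"
  shows "((\<lambda>z. V_hat (\<lambda>i. Xs i (snd z)) (N (fst z)) (K (fst z)) w0 $ j $ l)
      \<longlongrightarrow> V_asym \<gamma> R c b $ j $ l) in_prob"
proof -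
  note g = tendsto_power[OF pooled_hill_consistent[OF assms], of 2]
  note k = tendsto_in_prob_const[OF k_total_ratio]
  have up: "((\<lambda>z. k_total (fst z) / real (K (fst z) j)
      * (pooled_hill (\<lambda>i. Xs i (snd z)) (N (fst z)) (K (fst z)) w0)\<^sup>2
       * R_hat (\<lambda>i. Xs i (snd z)) (N (fst z)) (K (fst z)) j l (real (K (fst z) j)
           / real (K (fst z) l)) (real (N (fst z) j) / real (N (fst z) l)))
     \<longlongrightarrow> c_inv_sum * c $ j * \<gamma>\<^sup>2 * Rr j l (c $ l / c $ j) (b $ l
         / b $ j)) in_prob" if "j < l" for j l
    by (intro tendsto_mult k g R_hat_consistent that)
  consider "j = l" | "j < l" | "l < j" by fastforce
  then show ?thesis
  proof cases
    case 1
    have "((\<lambda>z. k_total (fst z) / real (K (fst z) j)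
        * (pooled_hill (\<lambda>i. Xs i (snd z)) (N (fst z)) (K (fst z)) w0)\<^sup>2)
        \<longlongrightarrow> c_inv_sum * c $ j * \<gamma>\<^sup>2) in_prob"
      by (intro tendsto_mult k g)
    then show ?thesis using 1 by (simp add: V_hat_nth V_asym_nth k_total_def Let_def mult_ac)
  next
    case 2
    then show ?thesis using up[OF 2] less_imp_neq[OF 2]
        by (simp add: V_hat_nth V_asym_nth k_total_def Let_def mult_ac)
  next
    case 3
    then show ?thesis using up[OF 3] less_imp_neq[OF 3] less_not_sym[OF 3]
        by (simp add: V_hat_nth V_asym_nth k_total_def Let_def mult_ac)
  qed
qed

lemma B_hat_nth:
  "B_hat x N' K' w0 \<beta>' \<rho>' $ j = sqrt (real (\<Sum>i\<in>UNIV. K' i)) *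
     ((sqrt (real (K' j)) * pooled_hill x N' K' w0 * \<beta>' $ j * (real (N' j)
         / real (K' j)) powr (\<rho>' $ j)) / sqrt (real (K' j)) / (1 - \<rho>' $ j))"
  by (simp add: B_hat_def lambda_hat_def)

lemma B_hat_measurable:
  assumes "\<And>j. (\<lambda>\<omega>. \<beta>' \<omega> $ j) \<in> borel_measurable M" "\<And>j.
      (\<lambda>\<omega>. \<rho>' \<omega> $ j) \<in> borel_measurable M"
  shows "(\<lambda>\<omega>. B_hat (\<lambda>i. Xs i \<omega>) (N n) (K n) w0 (\<beta>' \<omega>) (\<rho>'
      \<omega>) $ j) \<in> borel_measurable M"
proof -
  have [measurable]: "(\<lambda>\<omega>. pooled_hill (\<lambda>i. Xs i \<omega>) (N n) (K n) w0) \<in>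
      borel_measurable M"
    by (rule pooled_hill_measurable) simp
  note assms[measurable]
  show ?thesis unfolding B_hat_nth by measurable
qed

text \<open>The power of N / K is split into exp (\<open>\<rho>\<close> \<open>\<tau>\<close>) and
  exp of the estimation error times \<open>\<tau>\<close>. The first, multiplied by sqrt K, tends to
  lam / (\<open>\<gamma>\<close> \<open>\<beta>\<close>), and the prefactor supplied by the pilot
  estimator and the estimator of \<open>\<beta>\<close> cancels that denominator; the second tends
  to 1.\<close>

lemma B_hat_consistent:
  assumes w0: "w0 \<bullet> 1 = 1"
    and \<beta>': "((\<lambda>z. \<beta>' (fst z) (snd z) $ j) \<longlongrightarrow> \<beta> $ j) in_prob"
    and \<rho>': "((\<lambda>z. (\<rho>' (fst z) (snd z) $ j - \<rho> $ j)
        * ln (real (N (fst z) j))) \<longlongrightarrow> 0) in_prob"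
  shows "((\<lambda>z. B_hat (\<lambda>i. Xs i (snd z)) (N (fst z)) (K (fst z)) w0 (\<beta>' (fst z) (snd z))
      (\<rho>' (fst z) (snd z)) $ j) \<longlongrightarrow> B_asym c lam \<rho> $ j) in_prob"
proof -
  let ?r = "\<lambda>z. \<rho>' (fst z) (snd z) $ j"
  have ln_top: "filterlim (\<lambda>n. ln (real (N n j))) at_top sequentially"
    by (rule filterlim_compose[OF ln_at_top filterlim_compose[OF filterlim_real_sequentially N_at_top]])
  \<comment> \<open>Eventually 0 < \<open>\<tau>\<close> \<le> ln N because K is at least 1, so the
    assumed logarithmic rate controls the exponent.\<close>
  have small: "((\<lambda>z. (?r z - \<rho> $ j) * tail.\<tau> j (fst z)) \<longlongrightarrow> 0) in_prob"
  proof (rule Lim_null_comparison[OF _ tendsto_rabs_zero[OF \<rho>']])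
    show "\<forall>\<^sub>F z in in_prob. norm ((?r z - \<rho> $ j) * tail.\<tau> j (fst z))
        \<le> \<bar>(?r z - \<rho> $ j) * ln (real (N (fst z) j))\<bar>"
      using eventually_in_prob_sequentially[OF eventually_good]
    proof eventually_elim
      case (elim z)
      have K: "0 < K (fst z) j" "K (fst z) j < N (fst z) j" "0 < tail.\<tau> j (fst z)" using elim by blast+
      have "tail.\<tau> j (fst z) = ln (real (N (fst z) j)) - ln (real (K (fst z) j))"
        using K by (simp add: tail.\<tau>_def ln_div)
      moreover have "0 \<le> ln (real (K (fst z) j))" using K by simp
      ultimately have "\<bar>tail.\<tau> j (fst z)\<bar> \<le> \<bar>ln (real (N (fst z) j))\<bar>"
          using K by linarith
      then show ?case by (simp add: abs_mult mult_left_mono)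
    qed
  qed
  have \<rho>lim: "(?r \<longlongrightarrow> \<rho> $ j) in_prob"
  proof -
    have "((\<lambda>z. (?r z - \<rho> $ j) * ln (real (N (fst z) j)) * (1 / ln (real (N (fst z) j)))
        + \<rho> $ j) \<longlongrightarrow> 0 * 0 + \<rho> $ j) in_prob"
      by (intro tendsto_add tendsto_mult \<rho>' tendsto_const
          tendsto_in_prob_const[OF tendsto_divide_0[OF tendsto_const filterlim_at_top_imp_at_infinity[OF
              ln_top]]])
    moreover have "\<forall>\<^sub>F z in in_prob. (?r z - \<rho> $ j) * ln (real (N (fst z) j)) * (1
        / ln (real (N (fst z) j))) + \<rho> $ j = ?r z"
    proof -
      have "\<forall>\<^sub>F n in sequentially. 0 < ln (real (N n j))" using ln_top
          by (simp add: filterlim_at_top_dense)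
      from eventually_in_prob_sequentially[OF this] show ?thesis by eventually_elim simp
    qed
    ultimately show ?thesis unfolding mult_zero_left add_0 by (rule Lim_transform_eventually)
  qed
  have "((\<lambda>z. sqrt (k_total (fst z)) / sqrt (K (fst z) j)
      * (pooled_hill (\<lambda>i. Xs i (snd z)) (N (fst z)) (K (fst z)) w0
      * \<beta>' (fst z) (snd z) $ j * (sqrt (K (fst z) j) * exp (\<rho> $ j * tail.\<tau> j (fst z)))
          * exp ((?r z - \<rho> $ j) * tail.\<tau> j (fst z)) / (1 - ?r z)))
    \<longlongrightarrow> sqrt c_inv_sum * sqrt (c $ j) * (\<gamma> * \<beta> $ j * (lam $ j / (\<gamma>
        * \<beta> $ j)) * exp 0 / (1 - \<rho> $ j))) in_prob"
    using \<rho>_neg[of j]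
    by (intro tendsto_mult tendsto_divide tendsto_diff tendsto_const tendsto_exp small \<rho>lim \<beta>'
        pooled_hill_consistent[OF w0]
        tendsto_in_prob_const[OF sqrt_k_total_ratio] tendsto_in_prob_const[OF exp_\<tau>_lim]) auto
  moreover have "sqrt c_inv_sum * sqrt (c $ j) * (\<gamma> * \<beta> $ j * (lam $ j / (\<gamma>
      * \<beta> $ j)) * exp 0 / (1 - \<rho> $ j)) = B_asym c lam \<rho> $ j"
    using \<gamma>_pos \<beta>_nz[of j] by (simp add: B_asym_def c_inv_sum_def)
  moreover have "\<forall>\<^sub>F z in in_prob. sqrt (k_total (fst z)) / sqrt (K (fst z) j)
      * (pooled_hill (\<lambda>i. Xs i (snd z)) (N (fst z)) (K (fst z)) w0
      * \<beta>' (fst z) (snd z) $ j * (sqrt (K (fst z) j) * exp (\<rho> $ j * tail.\<tau> j (fst z)))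
          * exp ((?r z - \<rho> $ j) * tail.\<tau> j (fst z)) / (1 - ?r z))
    = B_hat (\<lambda>i. Xs i (snd z)) (N (fst z)) (K (fst z)) w0 (\<beta>' (fst z) (snd z)) (\<rho>' (fst z)
        (snd z)) $ j"
    using eventually_in_prob_sequentially[OF eventually_good]
  proof eventually_elim
    case (elim z)
    have K: "0 < K (fst z) j" "0 < N (fst z) j" using elim by (blast, metis gr0I not_less0)
    have "(real (N (fst z) j) / real (K (fst z) j)) powr ?r z = exp (?r z * tail.\<tau> j (fst z))"
      using K by (simp add: powr_def tail.\<tau>_def)
    also have "\<dots> = exp (\<rho> $ j * tail.\<tau> j (fst z)) * exp ((?r z - \<rho> $ j)
        * tail.\<tau> j (fst z))"
      by (simp add: algebra_simps flip: exp_add)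
    finally have P: "(real (N (fst z) j) / real (K (fst z) j)) powr ?r z
        = exp (\<rho> $ j * tail.\<tau> j (fst z)) * exp ((?r z - \<rho> $ j) * tail.\<tau> j (fst z))" .
    show ?case unfolding B_hat_nth P k_total_def using K by simp
  qed
  ultimately show ?thesis by (simp only:) (rule Lim_transform_eventually)
qed

end

theorem corollary1:
  fixes M :: "'a measure"
    and X :: "'a \<Rightarrow> real ^ ('m :: {finite, linorder})"
    and Xs :: "nat \<Rightarrow> 'a \<Rightarrow> real ^ ('m :: {finite, linorder})"
    and \<gamma> :: real
    and \<beta> \<rho> b c lam w0 :: "real ^ ('m :: {finite, linorder})"
    and A :: "'m \<Rightarrow> real \<Rightarrow> real"
    and R :: "'m \<Rightarrow> 'm \<Rightarrow> ereal \<Rightarrow> ereal \<Rightarrow> real"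
    and N K :: "nat \<Rightarrow> 'm \<Rightarrow> nat"
    and beta_hat rho_hat :: "nat \<Rightarrow> 'a \<Rightarrow> real ^ ('m :: {finite, linorder})"
  assumes "prob_space M"
    and "X \<in> borel_measurable M"
    and "prob_space.indep_vars M (\<lambda>_. borel) Xs {1..}"
    and "\<forall>i\<ge>1. distr M borel (Xs i) = distr M borel X"
    and "\<forall>j. continuous_on UNIV (marg_cdf M X j)"
    and "\<forall>n. n = (\<Sum>j\<in>UNIV. N n j)"
    and "\<forall>j. filterlim (\<lambda>n. N n j) at_top sequentially"
    and "second_order_cond M X (\<gamma> *\<^sub>R 1) \<rho> A"
    and "tail_dependence_cond M X R"
    and "\<forall>j. \<rho> $ j < 0"
    and "\<forall>j. \<forall>t>0. A j t = \<gamma> * \<beta> $ j * t powr (\<rho> $ j)"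
    and "\<forall>n. mono (N n)"
    and "\<forall>j. filterlim (\<lambda>n. K n j) at_top sequentially"
    and "\<forall>j. (\<lambda>n. real (K n j) / real (N n j)) \<longlonglongrightarrow> 0"
    and "\<forall>j. 0 < b $ j \<and> b $ j \<le> 1 \<and>
           (\<lambda>n. real (N n (Min UNIV)) / real (N n j)) \<longlonglongrightarrow> b $ j"
    and "\<forall>j. 0 < c $ j \<and>
           (\<lambda>n. real (K n (Min UNIV)) / real (K n j)) \<longlonglongrightarrow> c $ j"
    and "\<forall>j. (\<lambda>n. sqrt (real (K n j)) * A j (real (N n j) / real (K n j))) \<longlonglongrightarrow> lam $ j"
    and "pos_def_matrix (V_asym \<gamma> R c b)"
    and "w0 \<bullet> 1 = 1"
    and "\<forall>n. beta_hat n \<in> borel_measurable M"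
    and "\<forall>n. rho_hat n \<in> borel_measurable M"
    and "\<forall>j. tendsto_in_prob M (\<lambda>n \<omega>. beta_hat n \<omega> $ j) (\<beta> $ j)"
    and "\<forall>j. tendsto_in_prob M (\<lambda>n \<omega>. (rho_hat n \<omega> $ j - \<rho> $ j) * ln (real (N n j))) 0"
  shows
    "let V = V_asym \<gamma> R c b;
         B = B_asym c lam \<rho>;
         w_amse = amse_weights B V;
         k = (\<lambda>n. \<Sum>j\<in>UNIV. K n j);
         gamma_hat = (\<lambda>n \<omega> w. pooled_hill (\<lambda>i. Xs i \<omega>) (N n) (K n) w);
         V_n = (\<lambda>n \<omega>. V_hat (\<lambda>i. Xs i \<omega>) (N n) (K n) w0);
         B_n = (\<lambda>n \<omega>. B_hat (\<lambda>i. Xs i \<omega>) (N n) (K n) w0 (beta_hat n \<omega>) (rho_hat n \<omega>))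
     in tendsto_in_distr M
          (\<lambda>n \<omega>. sqrt (real (k n)) * (gamma_hat n \<omega> (var_weights (V_n n \<omega>)) - \<gamma>))
          (normal_law ((1 \<bullet> (matrix_inv V *v B)) / (1 \<bullet> (matrix_inv V *v 1)))
                      (1 / (1 \<bullet> (matrix_inv V *v 1)))) \<and>
        tendsto_in_distr M
          (\<lambda>n \<omega>. sqrt (real (k n)) *
                   (gamma_hat n \<omega> (amse_weights (B_n n \<omega>) (V_n n \<omega>)) - \<gamma>))
          (normal_law (w_amse \<bullet> B) (w_amse \<bullet> (V *v w_amse))) \<and>
        (w_amse \<bullet> B)\<^sup>2 + w_amse \<bullet> (V *v w_amse) =
          (1 + B \<bullet> (matrix_inv V *v B)) /
          ((1 + B \<bullet> (matrix_inv V *v B)) * (1 \<bullet> (matrix_inv V *v 1))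
             - (1 \<bullet> (matrix_inv V *v B))\<^sup>2)"
proof -
  interpret prob_space M by fact
  have \<gamma>: "\<gamma> > 0" using assms(8) unfolding second_order_cond_def by simp
  interpret hill_sample M X Xs \<gamma> b c R N K \<beta> \<rho> lam A
  proof unfold_locales
    show "distr M borel (Xs i) = distr M borel X" if "i \<ge> 1" for i using assms(4) that by blast
    show "continuous_on UNIV (marg_cdf M X j)" for j using assms(5) by blast
    show "(\<Sum>j\<in>UNIV. N n j) = n" for n using assms(6) by metis
    show "A j t = \<gamma> * \<beta> $ j * t powr (\<rho> $ j)" if "t > 0" for j t using assms(11) that
        by blast
  qed (use assms \<gamma> in auto)
  define V where "V = V_asym \<gamma> R c b"
  define B where "B = B_asym c lam \<rho>"
  have V: "pos_def_matrix V" using assms(18) by (simp add: V_def)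
  note pd = pos_def_matrix_facts(2)[OF V]
  note wi = weights_identities(1)[OF V] weights_identities(2,3)[OF V, of B] weights_identities(4)[OF V]
    weights_identities(5,6)[OF V, of B]
  have \<beta>': "((\<lambda>z. beta_hat (fst z) (snd z) $ j)
      \<longlongrightarrow> \<beta> $ j) in_prob" for j
    using assms(20,22) by (intro tendsto_in_prob_imp_tendsto) (auto intro: measurable_vec_nth)
  have \<rho>': "((\<lambda>z. (rho_hat (fst z) (snd z) $ j - \<rho> $ j)
      * ln (real (N (fst z) j))) \<longlongrightarrow> 0) in_prob" for j
  proof (rule tendsto_in_prob_imp_tendsto)
    show "(\<lambda>\<omega>. (rho_hat n \<omega> $ j - \<rho> $ j)
        * ln (real (N n j))) \<in> borel_measurable M" for n
      using measurable_vec_nth[of "rho_hat n" M j] assms(21) by simp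
  qed (use assms(23) in blast)
  note Vc = V_hat_consistent[OF assms(19), folded V_def]
  note Bc = B_hat_consistent[OF assms(19) \<beta>' \<rho>', folded B_def]
  let ?V = "\<lambda>n \<omega>. V_hat (\<lambda>i. Xs i \<omega>) (N n) (K n) w0"
  let ?B = "\<lambda>n \<omega>. B_hat (\<lambda>i. Xs i \<omega>) (N n) (K n) w0 (beta_hat n \<omega>)
      (rho_hat n \<omega>)"
  have Bm: "(\<lambda>\<omega>. ?B n \<omega> $ j) \<in> borel_measurable M" for n j
    using assms(20,21) by (intro B_hat_measurable measurable_vec_nth) auto
  have p: "1 \<bullet> (matrix_inv V *v 1) \<noteq> 0" and d: "amse_denom B V \<noteq> 0" using wi(1,2)
      by auto
  have 1: "tendsto_in_distr M
      (\<lambda>n \<omega>. sqrt (real (\<Sum>j\<in>UNIV. K n j))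
          * (pooled_hill (\<lambda>i. Xs i \<omega>) (N n) (K n) (var_weights (?V n \<omega>)) - \<gamma>))
      (normal_law (var_weights V \<bullet> B) (var_weights V \<bullet> (V *v var_weights V)))"
    unfolding V_def B_def
  proof (rule asymptotic_normality[where W="\<lambda>n \<omega>. var_weights (?V n \<omega>)"], unfold
      V_def[symmetric] B_def[symmetric])
    show "((\<lambda>z. var_weights (?V (fst z) (snd z)) $ j)
        \<longlongrightarrow> var_weights V $ j) in_prob" for j
      by (rule tendsto_var_weights(1)[OF Vc pd p])
    show "\<forall>\<^sub>F z in in_prob. 1 \<bullet> var_weights (?V (fst z) (snd z)) = 1"
      by (rule tendsto_var_weights(2)[OF Vc pd p])
    show "(\<lambda>\<omega>. var_weights (?V n \<omega>) $ j) \<in> borel_measurable M" for n j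
      by (rule borel_measurable_var_weights[OF V_hat_measurable])
    show "0 < var_weights V \<bullet> (V *v var_weights V)" using wi(1,4) by simp
  qed
  have 2: "tendsto_in_distr M
      (\<lambda>n \<omega>. sqrt (real (\<Sum>j\<in>UNIV. K n j))
          * (pooled_hill (\<lambda>i. Xs i \<omega>) (N n) (K n) (amse_weights (?B n \<omega>) (?V n
          \<omega>)) - \<gamma>))
      (normal_law (amse_weights B V \<bullet> B) (amse_weights B V \<bullet> (V *v amse_weights B V)))"
    unfolding V_def B_def
  proof (rule asymptotic_normality[where W="\<lambda>n \<omega>. amse_weights (?B n \<omega>) (?V n
      \<omega>)"], unfold V_def[symmetric] B_def[symmetric])
    show "((\<lambda>z. amse_weights (?B (fst z) (snd z)) (?V (fst z) (snd z)) $ j)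
        \<longlongrightarrow> amse_weights B V $ j) in_prob" for j
      by (rule tendsto_amse_weights(1)[OF Vc pd Bc d])
    show "\<forall>\<^sub>F z in in_prob. 1 \<bullet> amse_weights (?B (fst z) (snd z)) (?V (fst z) (snd z))
        = 1"
      by (rule tendsto_amse_weights(2)[OF Vc pd Bc d])
    show "(\<lambda>\<omega>. amse_weights (?B n \<omega>) (?V n \<omega>) $ j) \<in> borel_measurable M" for
        n j
      by (rule borel_measurable_amse_weights[OF V_hat_measurable Bm])
    show "0 < amse_weights B V \<bullet> (V *v amse_weights B V)" by (rule wi(5))
  qed
  show ?thesis
    unfolding Let_def V_def[symmetric] B_def[symmetric]
    using 1[unfolded wi(3,4)] 2 wi(6)[unfolded amse_denom_def] by blast
qed

end
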